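(* Let $u(t,x)$ be the solution of the weakly nonlinear Schrödinger equation $$i\partial_t u+\partial_x^2 u=\varepsilon^2|u|^2u,\qquad x\in\mathbb{T},$$ with random initial data $u|_{t=0}=u_0^\omega$, where $u_0^\omega(x)=\sum_{k\in\mathbb{Z}}c_kg_ke^{ikx}$. For any $t=\mathcal{O}(\varepsilon^{-1}|\log\varepsilon|)$ and $z_0>0$, the identity $$\lim_{\varepsilon\to0^+}\varepsilon\log\mathbb{P}\Big(\|u(t,\cdot)\|_{\mathcal{F}L^1(\mathbb{T})}>z_0\varepsilon^{-1/2}\Big)=-\frac{z_0^2}{\sum_{k}c_k^2}$$ holds if and only if $(c_k)\in\ell^1$.
   Context: $\mathbb{T}=\mathbb{R}/(2\pi\mathbb{Z})$. The coefficients $c_k\ge0$, $k\in\mathbb{Z}$, are nonnegative real numbers. $(g_k)_{k\in\mathbb{Z}}$ are independent, identically distributed complex Gaussian random variables with $\mathbb{E}g_k=0$, $\mathbb{E}g_kg_j=0$, $\mathbb{E}g_k\overline{g_j}=\delta_{kj}$. For $f(x)=\sum_{n\in\mathbb{Z}}\widehat f(n)e^{inx}$ on $\mathbb{T}$, $\|f\|_{\mathcal{F}L^1(\mathbb{T})}=\sum_{n\in\mathbb{Z}}|\widehat f(n)|$. The solution $u$ depends on $\varepsilon>0$ through the equation, and the time $t$ is allowed to depend on $\varepsilon$. *)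

theory Defs
  imports "HOL-Probability.Probability" "HOL-Library.Landau_Symbols"
begin

text \<open>Functions on the torus are represented as \<open>2\<pi>\<close>-periodic functions on the real line.\<close>

definition square_integrable_torus :: "(real \<Rightarrow> complex) \<Rightarrow> bool" where
  "square_integrable_torus f \<longleftrightarrow>
     f \<in> borel_measurable borel \<and> (\<forall>x. f (x + 2 * pi) = f x) \<and>
     set_integrable lborel {0..2*pi} (\<lambda>x. (norm (f x))\<^sup>2)"

definition L2_dist_torus :: "(real \<Rightarrow> complex) \<Rightarrow> (real \<Rightarrow> complex) \<Rightarrow> real" where
  "L2_dist_torus f h = sqrt (LINT x:{0..2*pi}|lborel. (norm (f x - h x))\<^sup>2)"

definition fourier_coeff :: "(real \<Rightarrow> complex) \<Rightarrow> int \<Rightarrow> complex" where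
  "fourier_coeff f n =
     (LINT x:{0..2*pi}|lborel. f x * exp (- (\<i> * of_int n * of_real x))) / of_real (2 * pi)"

definition FL1_norm :: "(real \<Rightarrow> complex) \<Rightarrow> ennreal" where
  "FL1_norm f = (\<Sum>\<^sub>\<infinity>n::int. ennreal (norm (fourier_coeff f n)))"

definition is_fourier_series_sum :: "(real \<Rightarrow> complex) \<Rightarrow> (int \<Rightarrow> complex) \<Rightarrow> bool" where
  "is_fourier_series_sum f a \<longleftrightarrow>
     square_integrable_torus f \<and>
     (\<lambda>N. L2_dist_torus f
        (\<lambda>x. \<Sum>k\<in>{- int N..int N}. a k * exp (\<i> * of_int k * of_real x))) \<longlonglongrightarrow> 0"

text \<open>
  Global solutions of \<open>i \<partial>\<^sub>t u + \<partial>\<^sub>x\<^sup>2 u = \<epsilon>\<^sup>2 |u|\<^sup>2 u\<close> with initial datum \<open>\<Sum>\<^sub>k a\<^sub>k e\<^sup>i\<^sup>k\<^sup>x\<close> are taken in the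
  classical \<open>L\<^sup>2\<close> well-posedness class \<open>C(\<real>; L\<^sup>2) \<inter> L\<^sup>4\<^sub>l\<^sub>o\<^sub>c(\<real> \<times> \<T>)\<close>, in which they are
  unique. The last clause is the Duhamel formula
  \<open>u(t) = S(t) u\<^sub>0 - i \<epsilon>\<^sup>2 \<integral>\<^sub>0\<^sup>t S(t - s) (|u|\<^sup>2 u)(s) ds\<close>, \<open>S(t) = exp (i t \<partial>\<^sub>x\<^sup>2)\<close>, read mode by mode;
  \<open>S(t)\<close> multiplies the \<open>n\<close>-th Fourier coefficient by \<open>exp (- i n\<^sup>2 t)\<close>. The \<open>L\<^sup>4\<close> bound makes
  \<open>|u|\<^sup>2 u\<close> locally integrable on \<open>\<real> \<times> \<T>\<close>, so that the integrals make sense.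
\<close>

definition NLS_solution ::
    "real \<Rightarrow> (int \<Rightarrow> complex) \<Rightarrow> (real \<Rightarrow> real \<Rightarrow> complex) \<Rightarrow> bool" where
  "NLS_solution \<epsilon> a u \<longleftrightarrow>
     case_prod u \<in> borel_measurable borel \<and>
     (\<forall>t. square_integrable_torus (u t)) \<and>
     (\<forall>s. ((\<lambda>t. L2_dist_torus (u t) (u s)) \<longlongrightarrow> 0) (at s)) \<and>
     (\<forall>T>0. set_integrable lborel ({-T..T} \<times> {0..2*pi}) (\<lambda>(s, x). (norm (u s x)) ^ 4)) \<and>
     is_fourier_series_sum (u 0) a \<and>
     (\<forall>t n. fourier_coeff (u t) n =
        exp (- (\<i> * of_real ((of_int n)\<^sup>2 * t))) * fourier_coeff (u 0) n
        - \<i> * of_real (\<epsilon>\<^sup>2) *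
          (LBINT s=ereal 0..ereal t.
             exp (- (\<i> * of_real ((of_int n)\<^sup>2 * (t - s)))) *
             fourier_coeff (\<lambda>x. of_real ((norm (u s x))\<^sup>2) * u s x) n))"

text \<open>
  A complex random variable is Gaussian if its law is the image of the standard Gaussian
  measure on the plane under a real-affine map (degenerate and non-circular laws included).
\<close>

definition complex_gaussian :: "'w measure \<Rightarrow> ('w \<Rightarrow> complex) \<Rightarrow> bool" where
  "complex_gaussian M X \<longleftrightarrow>
     X \<in> borel_measurable M \<and>
     (\<exists>m a b. distr M borel X =
        distr (density lborel std_normal_density \<Otimes>\<^sub>M density lborel std_normal_density) borel
          (\<lambda>(x, y). m + of_real x * a + of_real y * b))"

definition iid_standard_complex_gaussians ::
    "'w measure \<Rightarrow> (int \<Rightarrow> 'w \<Rightarrow> complex) \<Rightarrow> bool" where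
  "iid_standard_complex_gaussians M g \<longleftrightarrow>
     prob_space.indep_vars M (\<lambda>_. borel) g UNIV \<and>
     (\<forall>k j. distr M borel (g k) = distr M borel (g j)) \<and>
     (\<forall>k. complex_gaussian M (g k)) \<and>
     (\<forall>k. prob_space.expectation M (g k) = 0) \<and>
     (\<forall>k j. prob_space.expectation M (\<lambda>\<omega>. g k \<omega> * g j \<omega>) = 0) \<and>
     (\<forall>k j. prob_space.expectation M (\<lambda>\<omega>. g k \<omega> * cnj (g j \<omega>)) = of_bool (k = j))"

text \<open>The library has \<open>ln 0 = 0\<close>; here the logarithm of a probability takes the value \<open>-\<infinity>\<close> at \<open>0\<close>.\<close>

definition log_prob :: "real \<Rightarrow> ereal" where
  "log_prob p = (if p = 0 then -\<infinity> else ereal (ln p))"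

end

theory Submission
  imports Defs "HOL-Real_Asymp.Real_Asymp"
begin

text \<open>
  With \<open>b\<^sub>n(t) = exp (i n\<^sup>2 t) u\<^sub>n(t)\<close> the equation becomes a cubic system whose resonant part only rotates the
  phases of the modes, while the nonresonant part oscillates. Freezing the coefficients over time
  steps of length \<open>\<epsilon>\<^sup>-\<^sup>1\<^sup>/\<^sup>2\<close> shows that an \<open>\<ell>\<^sup>1\<close> norm of size \<open>\<epsilon>\<^sup>-\<^sup>1\<^sup>/\<^sup>2\<close> changes by a negligible amount up to
  times \<open>O(\<epsilon>\<^sup>-\<^sup>1 \<bar>ln \<epsilon>\<bar>)\<close>, in both time directions. That an \<open>L\<^sup>2\<close> solution stays in \<open>\<ell>\<^sup>1\<close> at all is seen by
  comparing it in \<open>L\<^sup>4\<close> with the Picard iterates of an \<open>\<ell>\<^sup>1\<close> datum, using Zygmund's \<open>L\<^sup>4\<close> bound for free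
  waves and the Christ--Kiselev argument for the Duhamel term.

  Hence the probability in question is that of \<open>\<Sum>\<^sub>k c\<^sub>k \<bar>g\<^sub>k\<bar> > z\<^sub>0 \<epsilon>\<^sup>-\<^sup>1\<^sup>/\<^sup>2\<close> up to a change of \<open>z\<^sub>0\<close>, where the
  \<open>\<bar>g\<^sub>k\<bar>\<^sup>2\<close> are independent exponential variables. For \<open>c \<in> \<ell>\<^sup>1\<close>, Chernoff's bound and the events
  \<open>\<bar>g\<^sub>k\<bar> > R c\<^sub>k / \<Sum>\<^sub>j c\<^sub>j\<^sup>2\<close> give the same rate from above and below. For \<open>c \<notin> \<ell>\<^sup>1\<close> the sum is almost
  surely infinite, so the probability is \<open>1\<close> and the limit is \<open>0\<close>.
\<close>

section \<open>Fourier series on the torus\<close>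

text \<open>A Gronwall bound lets the \<open>\<ell>\<^sup>1\<close> norm \<open>L\<close> grow at a
  relative rate of order \<open>\<epsilon>\<^sup>2 L\<^sup>2\<close>, which is \<epsilon> here, so
  over the times considered it loses a power of \<epsilon>. With the rotation split off, a step of
  length \<eta> costs only a boundary term of order \<open>\<epsilon>\<^sup>2 L\<^sup>3\<close> from
  the oscillation and a second-order term
  \<open>\<epsilon>\<^sup>4 \<eta>\<^sup>2 L\<^sup>5\<close>. These balance at
  \<open>\<eta> = \<epsilon> powr (-1/2)\<close>, the origin of the step length. The computation
  rearranges sums over frequency triples and so needs a finite \<open>\<ell>\<^sup>1\<close> norm,
  which the solution class does not supply. The local argument supplying it works for a time
  governed by the size of that norm and by how the \<open>L\<^sup>4\<close> mass is spread over
  time; both are uniform on a compact interval, so it can be interleaved with the long-time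
  estimate. The backward flow is essential for rough data: smallness at time \<open>t\<close> is
  carried back to time 0, so a datum of infinite norm cannot evolve into a small one.\<close>

definition segm :: "real \<Rightarrow> real \<Rightarrow> real measure" where
  "segm a b = density lborel (\<lambda>x. ennreal (indicator {a..b} x))"

abbreviation torus :: "real measure" where
  "torus \<equiv> segm 0 (2 * pi)"

text \<open>Encoding an interval by a density on the whole line, not by a restricted space, keeps
  the \<sigma>-algebra equal to \<open>borel\<close>, so one set of measurability facts serves time
  intervals and the torus alike.\<close>

lemma sets_segm [simp, measurable_cong]: "sets (segm a b) = sets borel"
  by (simp add: segm_def)

lemma space_segm [simp]: "space (segm a b) = UNIV"
  by (simp add: segm_def)

lemma nn_integral_segm:
  assumes "f \<in> borel_measurable borel"
  shows "nn_integral (segm a b) f = (\<integral>\<^sup>+x\<in>{a..b}. f x \<partial>lborel)"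
  using assms unfolding segm_def
  by (subst nn_integral_density) (auto intro!: nn_integral_cong simp: mult.commute ennreal_indicator)

lemma emeasure_segm: "emeasure (segm a b) UNIV = ennreal (b - a)"
proof -
  have "emeasure (segm a b) UNIV = (\<integral>\<^sup>+x. 1 \<partial>segm a b)" by simp
  also have "\<dots> = (\<integral>\<^sup>+x\<in>{a..b}. 1 \<partial>lborel)" by (subst nn_integral_segm) auto
  also have "\<dots> = emeasure lborel {a..b}" by simp
  also have "\<dots> = ennreal (b - a)"
    by (cases "a \<le> b") (simp_all add: ennreal_neg)
  finally show ?thesis .
qed

lemma finite_measure_segm: "finite_measure (segm a b)"
  by standard (simp add: emeasure_segm)

interpretation segm: finite_measure "segm a b" for a b
  by (rule finite_measure_segm)

interpretation segm2: pair_sigma_finite "segm a b" "segm c d" for a b c d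
  by standard

lemma measure_segm: "a \<le> b \<Longrightarrow> measure (segm a b) UNIV = b - a"
  by (simp add: measure_def emeasure_segm)

lemma integral_segm:
  fixes f :: "real \<Rightarrow> 'b::{banach, second_countable_topology}"
  assumes "f \<in> borel_measurable borel"
  shows "integral\<^sup>L (segm a b) f = set_lebesgue_integral lborel {a..b} f"
  using assms unfolding segm_def set_lebesgue_integral_def
  by (subst integral_density) auto

lemma integrable_segm:
  fixes f :: "real \<Rightarrow> 'b::{banach, second_countable_topology}"
  assumes "f \<in> borel_measurable borel"
  shows "integrable (segm a b) f \<longleftrightarrow> set_integrable lborel {a..b} f"
  using assms unfolding segm_def set_integrable_def
  by (subst integrable_density) auto

lemma AE_segm: "(AE x in segm a b. P x) \<longleftrightarrow> (AE x in lborel. x \<in> {a..b} \<longrightarrow> P x)"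
  unfolding segm_def by (subst AE_density) (auto simp: indicator_def ennreal_zero_less_one)

lemma integrable_segm_bounded:
  fixes f :: "real \<Rightarrow> 'b::{banach, second_countable_topology}"
  assumes "f \<in> borel_measurable borel" "\<And>x. x \<in> {a..b} \<Longrightarrow> norm (f x) \<le> B"
  shows "integrable (segm a b) f"
proof (rule segm.integrable_const_bound)
  show "AE x in segm a b. norm (f x) \<le> B" unfolding AE_segm using assms(2) by auto
qed (use assms in auto)

lemma norm_integral_segm_le:
  fixes f :: "real \<Rightarrow> 'b::{banach, second_countable_topology}"
  assumes "\<And>x. x \<in> {a..b} \<Longrightarrow> norm (f x) \<le> B" "a \<le> b" "0 \<le> B"
  shows "norm (integral\<^sup>L (segm a b) f) \<le> B * (b - a)"
proof -
  have "norm (integral\<^sup>L (segm a b) f) \<le> (LINT x|segm a b. norm (f x))" by simp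
  also have "\<dots> \<le> (LINT x|segm a b. B)"
    by (rule integral_mono_AE') (use assms AE_segm in auto)
  also have "\<dots> = B * (b - a)" using assms by (simp add: measure_segm)
  finally show ?thesis .
qed

text \<open>Used in the time variable as well: the phases of the flow have integer frequencies, so
  \<open>exp (- \<i> n\<^sup>2 t)\<close> is \<open>chr (- n\<^sup>2) t\<close>, and time integrals
  over a full period are orthogonality relations too.\<close>

definition chr :: "int \<Rightarrow> real \<Rightarrow> complex" where
  "chr n x = cis (of_int n * x)"

lemma chr_conv_exp: "chr n x = exp (\<i> * of_int n * of_real x)"
  by (simp add: chr_def cis_conv_exp mult.assoc)

lemma norm_chr [simp]: "norm (chr n x) = 1"
  by (simp add: chr_def)

lemma chr_0 [simp]: "chr 0 x = 1" "chr n 0 = 1"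
  by (simp_all add: chr_def)

lemma chr_add: "chr (m + n) x = chr m x * chr n x"
  by (simp add: chr_def cis_mult ring_distribs)

lemma cnj_chr: "cnj (chr n x) = chr (-n) x"
  by (simp add: chr_def cis_cnj)

lemma chr_cancel [simp]: "chr (-n) x * chr n x = 1" "chr n x * chr (-n) x = 1"
  by (simp_all flip: chr_add)

lemma chr_add_right: "chr n (x + y) = chr n x * chr n y"
  by (simp add: chr_def cis_mult ring_distribs)

lemma chr_2pi [simp]: "chr n (2 * pi) = 1"
  using cis_multiple_2pi[of "of_int n"] by (simp add: chr_def mult_ac)

lemma continuous_on_chr: "continuous_on S (chr n)"
  unfolding chr_def by (intro continuous_intros)

lemma borel_measurable_chr [measurable]: "chr n \<in> borel_measurable borel"
  by (intro borel_measurable_continuous_onI continuous_on_chr)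

lemma integral_chr:
  assumes "m \<noteq> 0" "a \<le> b"
  shows "(LINT x|segm a b. chr m x) = (chr m b - chr m a) / (\<i> * of_int m)"
proof -
  define F where "F = (\<lambda>x. chr m x / (\<i> * of_int m))"
  have "(F has_vector_derivative chr m x) (at x within {a..b})" for x
  proof -
    have "((\<lambda>z. exp (\<i> * of_int m * z) / (\<i> * of_int m)) has_field_derivative exp (\<i> * of_int m * of_real x)) (at (of_real x))"
      using assms by (auto intro!: derivative_eq_intros)
    from has_vector_derivative_real_field[OF this] show ?thesis
      by (simp add: F_def chr_conv_exp)
  qed
  then have "(LINT x|lborel. indicat_real {a..b} x *\<^sub>R chr m x) = F b - F a"
    by (intro integral_FTC_Icc continuous_on_chr) (use assms in auto)
  then show ?thesis
    by (subst integral_segm) (auto simp: set_lebesgue_integral_def F_def diff_divide_distrib)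
qed

lemma integral_chr_period:
  "(LINT x|segm a (a + 2 * pi). chr m x) = (if m = 0 then 2 * pi else 0)"
  by (simp add: integral_chr measure_segm chr_add_right of_real_def)

lemma integral_chr_torus: "(LINT x|torus. chr m x) = (if m = 0 then 2 * pi else 0)"
  using integral_chr_period[of 0 m] by simp

lemma fourier_coeff_eq:
  assumes [measurable]: "f \<in> borel_measurable borel"
  shows "fourier_coeff f n = (LINT x|torus. f x * chr (-n) x) / (2 * pi)"
  unfolding fourier_coeff_def
  by (subst integral_segm) (simp_all add: chr_conv_exp)

section \<open>Trigonometric polynomials and uniform approximation\<close>

definition trigpoly :: "(real \<Rightarrow> complex) \<Rightarrow> bool" where
  "trigpoly \<phi> \<longleftrightarrow> (\<exists>N a. \<phi> = (\<lambda>x. \<Sum>n\<in>{-int N..int N}. a n * chr n x))"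

lemma trigpolyI:
  "\<phi> = (\<lambda>x. \<Sum>n\<in>{-int N..int N}. a n * chr n x) \<Longrightarrow> trigpoly \<phi>"
  unfolding trigpoly_def by (intro exI[of _ N] exI[of _ a])

lemma trigpoly_extend:
  assumes "N \<le> M"
  shows "(\<Sum>n\<in>{-int N..int N}. a n * chr n x)
    = (\<Sum>n\<in>{-int M..int M}. (if \<bar>n\<bar> \<le> int N then a n else 0) * chr n x)"
  using assms by (intro sum.mono_neutral_cong_left) auto

lemma trigpoly_add:
  assumes "trigpoly \<phi>" "trigpoly \<psi>" shows "trigpoly (\<lambda>x. \<phi> x + \<psi> x)"
proof -
  from assms obtain N a M b where
    1: "\<phi> = (\<lambda>x. \<Sum>n\<in>{-int N..int N}. a n * chr n x)"
       "\<psi> = (\<lambda>x. \<Sum>n\<in>{-int M..int M}. b n * chr n x)" unfolding trigpoly_def by auto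
  define K where "K = max N M"
  have "(\<lambda>x. \<phi> x + \<psi> x) = (\<lambda>x. \<Sum>n\<in>{-int K..int K}.
     ((if \<bar>n\<bar> \<le> int N then a n else 0) + (if \<bar>n\<bar> \<le> int M then b n else 0)) * chr n x)"
    unfolding 1 using trigpoly_extend[of N K a] trigpoly_extend[of M K b]
    by (simp add: K_def sum.distrib ring_distribs)
  then show ?thesis by (rule trigpolyI)
qed

lemma trigpoly_chr: "trigpoly (\<lambda>x. c * chr n x)"
proof -
  have "(\<lambda>x. c * chr n x) = (\<lambda>x. \<Sum>k\<in>{-int (nat \<bar>n\<bar>)..int (nat \<bar>n\<bar>)}. (if k = n then c else 0) * chr k x)"
  proof
    fix x
    have "(\<Sum>k\<in>{-int (nat \<bar>n\<bar>)..int (nat \<bar>n\<bar>)}. (if k = n then c else 0) * chr k x)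
      = (\<Sum>k\<in>{-int (nat \<bar>n\<bar>)..int (nat \<bar>n\<bar>)}. (if k = n then c * chr n x else 0))"
      by (intro sum.cong) auto
    then show "c * chr n x = (\<Sum>k\<in>{-int (nat \<bar>n\<bar>)..int (nat \<bar>n\<bar>)}. (if k = n then c else 0) * chr k x)"
      by (auto simp: sum.delta)
  qed
  then show ?thesis by (rule trigpolyI)
qed

lemma trigpoly_const: "trigpoly (\<lambda>x. c)"
  using trigpoly_chr[of c 0] by simp

lemma trigpoly_sum:
  "finite I \<Longrightarrow> (\<And>i. i \<in> I \<Longrightarrow> trigpoly (\<phi> i)) \<Longrightarrow> trigpoly (\<lambda>x. \<Sum>i\<in>I. \<phi> i x)"
  by (induction I rule: finite_induct) (auto intro: trigpoly_add trigpoly_const)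

lemma trigpoly_mult:
  assumes "trigpoly \<phi>" "trigpoly \<psi>" shows "trigpoly (\<lambda>x. \<phi> x * \<psi> x)"
proof -
  from assms obtain N a M b where
    1: "\<phi> = (\<lambda>x. \<Sum>n\<in>{-int N..int N}. a n * chr n x)"
       "\<psi> = (\<lambda>x. \<Sum>n\<in>{-int M..int M}. b n * chr n x)" unfolding trigpoly_def by auto
  have eq: "(\<lambda>x. \<phi> x * \<psi> x) = (\<lambda>x. \<Sum>m\<in>{-int N..int N}. \<Sum>n\<in>{-int M..int M}. (a m * b n) * chr (m + n) x)"
    unfolding 1 by (simp add: sum_product chr_add mult_ac)
  show ?thesis unfolding eq by (intro trigpoly_sum trigpoly_chr) auto
qed

lemma trigpoly_measurable: "trigpoly \<phi> \<Longrightarrow> \<phi> \<in> borel_measurable borel"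
  unfolding trigpoly_def by auto

lemma trigpoly_bounded:
  assumes "trigpoly \<phi>" obtains B where "\<And>x. norm (\<phi> x) \<le> B"
proof -
  from assms obtain N a where 1: "\<phi> = (\<lambda>x. \<Sum>n\<in>{-int N..int N}. a n * chr n x)"
    unfolding trigpoly_def by auto
  have "norm (\<phi> x) \<le> (\<Sum>n\<in>{-int N..int N}. norm (a n))" for x
    unfolding 1 by (rule order_trans[OF norm_sum]) (simp add: norm_mult)
  with that show ?thesis by blast
qed

text \<open>Real polynomial functions on the plane are generated by linear functionals and
  constants. On the unit circle a functional \<open>f\<close> is
  \<open>cos x * f 1 + sin x * f \<i>\<close>, a combination of \<open>chr 1\<close> and
  \<open>chr (-1)\<close>; sums and products stay inside the class.\<close>

lemma trigpoly_real_polynomial_cis: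
  "real_polynomial_function p \<Longrightarrow> trigpoly (\<lambda>x. complex_of_real (p (cis x)))"
proof (induction p rule: real_polynomial_function.induct)
  case (linear f)
  have star: "complex_of_real (f (cis x)) = (f 1 / 2) * (chr 1 x + chr (-1) x) + (f \<i> / (2 * \<i>)) * (chr 1 x - chr (-1) x)" for x
  proof -
    have "f (cis x) = f (cos x *\<^sub>R 1 + sin x *\<^sub>R \<i>)"
      by (rule arg_cong[of _ _ f]) (simp add: complex_eq_iff)
    also have "\<dots> = cos x * f 1 + sin x * f \<i>"
      using linear by (simp add: linear_simps)
    finally show ?thesis by (simp add: chr_def complex_eq_iff)
  qed
  have eq: "(\<lambda>x. complex_of_real (f (cis x))) = (\<lambda>x. ((f 1 / 2) * chr 1 x + (f 1 / 2) * chr (-1) x)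
      + ((f \<i> / (2 * \<i>)) * chr 1 x + (- (f \<i> / (2 * \<i>))) * chr (-1) x))"
    by (intro ext) (unfold star, simp only: ring_distribs minus_mult_left [symmetric] diff_conv_add_uminus mult_minus_right)
  show ?case unfolding eq by (intro trigpoly_add trigpoly_chr)
next
  case (add f g) then show ?case by (simp add: trigpoly_add)
next
  case (mult f g) then show ?case by (simp add: trigpoly_mult)
qed (simp_all add: trigpoly_const)

text \<open>Stone--Weierstrass is applied on the unit circle to \<open>k\<close> composed with the
  argument. That composite could jump at the branch point 1; the vanishing of \<open>k\<close>
  within \<open>d\<close> of both end points makes it identically zero on the arc where the real
  part exceeds \<open>cos d\<close>, hence continuous there.\<close>

lemma trigpoly_uniform_real:
  fixes k :: "real \<Rightarrow> real"
  assumes k: "continuous_on UNIV k" and d: "0 < d" "d < pi"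
    and z: "\<And>x. x \<in> {0..d} \<union> {2*pi-d..2*pi} \<Longrightarrow> k x = 0" and e: "e > 0"
  obtains \<phi> where "trigpoly \<phi>" "\<And>x. x \<in> {0..2*pi} \<Longrightarrow> norm (of_real (k x) - \<phi> x) < e"
proof -
  define h where "h = (\<lambda>w. k (Arg2pi w))"
  have zero: "h w = 0" if "Re w > cos d" "norm w = 1" for w
  proof -
    define x where "x = Arg2pi w"
    have x: "0 \<le> x" "x < 2 * pi" "w = cis x"
      using that Arg2pi_eq[of w] by (simp_all add: x_def Arg2pi_ge_0 Arg2pi_lt_2pi cis_conv_exp)
    have c: "cos x > cos d" using that x by simp
    have "x \<le> d \<or> x \<ge> 2*pi - d"
    proof (rule ccontr)
      assume "\<not> ?thesis" then have n: "d < x" "x < 2*pi - d" by auto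
      show False
      proof (cases "x \<le> pi")
        case True then show False using cos_monotone_0_pi[of d x] n c d by auto
      next
        case False
        have "cos (2*pi - x) = cos x" by (simp add: cos_diff)
        then show False using cos_monotone_0_pi[of d "2*pi-x"] n c d False by auto
      qed
    qed
    then show ?thesis unfolding h_def x_def[symmetric] using z x by auto
  qed
  have "continuous_on (sphere 0 1) h"
    unfolding continuous_on_eq_continuous_within
  proof
    fix w :: complex assume w: "w \<in> sphere 0 1"
    show "continuous (at w within sphere 0 1) h"
    proof (cases "w \<in> \<real>\<^sub>\<ge>\<^sub>0")
      case False
      then have "isCont Arg2pi w" by (rule continuous_at_Arg2pi)
      moreover have "isCont k (Arg2pi w)" using k by (simp add: continuous_on_eq_continuous_at)
      ultimately have "isCont h w" unfolding h_def by (rule isCont_o2)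
      then show ?thesis by (rule continuous_at_imp_continuous_at_within)
    next
      case True
      with w have w1: "w = 1" by (auto simp: complex_nonneg_Reals_iff complex_eq_iff cmod_def power2_eq_1_iff)
      have cd: "cos d < 1" using cos_monotone_0_pi[of 0 d] d by simp
      have "eventually (\<lambda>v. Re v > cos d) (nhds w)"
        using cd w1 by (intro eventually_nhds_in_open[of "{v. Re v > cos d}", simplified])
           (auto intro: open_halfspace_Re_gt)
      then have "eventually (\<lambda>v. h v = 0) (at w within sphere 0 1)"
        unfolding eventually_at_filter by eventually_elim (auto intro: zero)
      moreover have "h w = 0" using zero[of w] w1 cd by simp
      ultimately show ?thesis unfolding continuous_within
        by (auto intro: tendsto_eventually)
    qed
  qed
  then obtain p where p: "real_polynomial_function p" "\<And>w. w \<in> sphere 0 1 \<Longrightarrow> \<bar>h w - p w\<bar> < e"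
    using Stone_Weierstrass_real_polynomial_function[of "sphere 0 1" h e] e by auto
  have "norm (of_real (k x) - complex_of_real (p (cis x))) < e" if x: "x \<in> {0..2*pi}" for x
  proof -
    have "k x = h (cis x)"
    proof (cases "x = 2 * pi")
      case True
      have "k x = 0" using True d z by auto
      moreover have "h (cis x) = 0" using True zero[of 1] cos_monotone_0_pi[of 0 d] d by simp
      ultimately show ?thesis by simp
    next
      case False
      have "Arg2pi (cis x) = x"
        by (rule Arg2pi_unique[of 1]) (use x False in \<open>auto simp: cis_conv_exp\<close>)
      then show ?thesis by (simp add: h_def)
    qed
    then have "\<bar>k x - p (cis x)\<bar> < e" using p(2)[of "cis x"] by simp
    then show ?thesis by (metis norm_of_real of_real_diff)
  qed
  with trigpoly_real_polynomial_cis[OF p(1)] that show ?thesis by blast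
qed

lemma trigpoly_uniform:
  fixes k :: "real \<Rightarrow> complex"
  assumes k: "continuous_on UNIV k" and d: "0 < d" "d < pi"
    and z: "\<And>x. x \<in> {0..d} \<union> {2*pi-d..2*pi} \<Longrightarrow> k x = 0" and e: "e > 0"
  obtains \<phi> where "trigpoly \<phi>" "\<And>x. x \<in> {0..2*pi} \<Longrightarrow> norm (k x - \<phi> x) < e"
proof -
  have c: "continuous_on UNIV (\<lambda>x. Re (k x))" "continuous_on UNIV (\<lambda>x. Im (k x))"
    using k by (auto intro!: continuous_intros)
  obtain \<phi> where 1: "trigpoly \<phi>" "\<And>x. x \<in> {0..2*pi} \<Longrightarrow> norm (of_real (Re (k x)) - \<phi> x) < e / 2"
    using trigpoly_uniform_real[OF c(1) d, of "e/2"] z e by (metis half_gt_zero zero_complex.simps(1))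
  obtain \<psi> where 2: "trigpoly \<psi>" "\<And>x. x \<in> {0..2*pi} \<Longrightarrow> norm (of_real (Im (k x)) - \<psi> x) < e / 2"
    using trigpoly_uniform_real[OF c(2) d, of "e/2"] z e by (metis half_gt_zero zero_complex.simps(2))
  have "trigpoly (\<lambda>x. \<phi> x + \<i> * \<psi> x)" by (intro trigpoly_add trigpoly_mult trigpoly_const 1 2)
  moreover have "norm (k x - (\<phi> x + \<i> * \<psi> x)) < e" if "x \<in> {0..2*pi}" for x
  proof -
    have "k x - (\<phi> x + \<i> * \<psi> x) = (of_real (Re (k x)) - \<phi> x) + \<i> * (of_real (Im (k x)) - \<psi> x)"
      by (subst complex_eq[of "k x"]) (simp add: algebra_simps)
    then have "norm (k x - (\<phi> x + \<i> * \<psi> x)) \<le> norm (of_real (Re (k x)) - \<phi> x) + norm (of_real (Im (k x)) - \<psi> x)"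
      by (metis norm_triangle_ineq norm_mult norm_ii mult_1)
    also have "\<dots> < e" using 1(2)[OF that] 2(2)[OF that] by simp
    finally show ?thesis .
  qed
  ultimately show ?thesis using that by blast
qed

lemma measurable_segm_iff [simp]: "f \<in> borel_measurable (segm a b) \<longleftrightarrow> f \<in> borel_measurable borel"
  by (simp cong: measurable_cong_sets)

section \<open>Square-integrable functions on the torus\<close>

definition L2 :: "(real \<Rightarrow> complex) \<Rightarrow> bool" where
  "L2 f \<longleftrightarrow> f \<in> borel_measurable borel \<and> integrable torus (\<lambda>x. (norm (f x))\<^sup>2)"

lemma L2_measurable: "L2 f \<Longrightarrow> f \<in> borel_measurable borel"
  by (simp add: L2_def)

lemma square_integrable_torus_L2: "square_integrable_torus f \<Longrightarrow> L2 f"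
  unfolding square_integrable_torus_def L2_def by (auto simp: integrable_segm)

lemma L2_bounded:
  assumes [measurable]: "f \<in> borel_measurable borel" and "\<And>x. norm (f x) \<le> B"
  shows "L2 f"
  unfolding L2_def
proof (intro conjI integrable_segm_bounded[of _ _ _ "B\<^sup>2"])
  show "norm ((norm (f x))\<^sup>2) \<le> B\<^sup>2" for x using assms(2)[of x] by (simp add: power_mono)
qed auto

lemma L2_trigpoly: "trigpoly \<phi> \<Longrightarrow> L2 \<phi>"
  by (metis L2_bounded trigpoly_bounded trigpoly_measurable)

lemma L2_dominated:
  assumes [measurable]: "h \<in> borel_measurable borel" and "L2 f" "\<And>x. norm (h x) \<le> norm (f x)"
  shows "L2 h"
  unfolding L2_def
proof (intro conjI)
  show "integrable torus (\<lambda>x. (norm (h x))\<^sup>2)"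
    by (rule Bochner_Integration.integrable_bound[of _ "\<lambda>x. (norm (f x))\<^sup>2"])
       (use assms in \<open>auto simp: L2_def power_mono\<close>)
qed fact

lemma norm_add_squared_le: "(norm (a + b))\<^sup>2 \<le> 2 * (norm a)\<^sup>2 + 2 * (norm b)\<^sup>2"
  for a b :: "'a::real_normed_vector"
proof -
  have "(norm (a + b))\<^sup>2 \<le> (norm a + norm b)\<^sup>2" by (intro power_mono norm_triangle_ineq) auto
  also have "\<dots> \<le> 2 * (norm a)\<^sup>2 + 2 * (norm b)\<^sup>2"
    using sum_squares_bound[of "norm a" "norm b"] by (simp add: power2_sum)
  finally show ?thesis .
qed

lemma L2_add: assumes "L2 f" "L2 g" shows "L2 (\<lambda>x. f x + g x)"
  unfolding L2_def
proof (intro conjI)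
  have [measurable]: "f \<in> borel_measurable borel" "g \<in> borel_measurable borel"
    using assms by (auto simp: L2_def)
  show "(\<lambda>x. f x + g x) \<in> borel_measurable borel" by measurable
  show "integrable torus (\<lambda>x. (norm (f x + g x))\<^sup>2)"
    by (rule Bochner_Integration.integrable_bound[of _ "\<lambda>x. 2 * (norm (f x))\<^sup>2 + 2 * (norm (g x))\<^sup>2"])
       (use assms norm_add_squared_le in \<open>auto simp: L2_def abs_of_nonneg\<close>)
qed

lemma L2_cmult: assumes "L2 f" shows "L2 (\<lambda>x. c * f x)"
  using assms by (auto simp: L2_def norm_mult power_mult_distrib)

lemma L2_diff: assumes "L2 f" "L2 g" shows "L2 (\<lambda>x. f x - g x)"
  using L2_add[OF assms(1) L2_cmult[OF assms(2), of "-1"]] by simp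

lemma L2_mult_integrable:
  assumes "L2 f" "L2 g" shows "integrable torus (\<lambda>x. f x * g x)"
proof (rule Bochner_Integration.integrable_bound[of _ "\<lambda>x. (norm (f x))\<^sup>2 + (norm (g x))\<^sup>2"])
  show "integrable torus (\<lambda>x. (norm (f x))\<^sup>2 + (norm (g x))\<^sup>2)" using assms by (auto simp: L2_def)
  show "(\<lambda>x. f x * g x) \<in> borel_measurable torus" using assms by (auto simp: L2_def)
  have "norm (f x * g x) \<le> (norm (f x))\<^sup>2 + (norm (g x))\<^sup>2" for x
    using sum_squares_bound[of "norm (f x)" "norm (g x)"] mult_nonneg_nonneg[OF norm_ge_zero[of "f x"] norm_ge_zero[of "g x"]]
    unfolding norm_mult by linarith
  then show "AE x in torus. norm (f x * g x) \<le> norm ((norm (f x))\<^sup>2 + (norm (g x))\<^sup>2)"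
    by (auto simp: abs_of_nonneg)
qed

lemma borel_measurable_cnj [measurable (raw)]:
  "f \<in> borel_measurable M \<Longrightarrow> (\<lambda>x. cnj (f x)) \<in> borel_measurable M"
  by (rule borel_measurable_continuous_on[OF continuous_on_cnj[OF continuous_on_id]])

lemma L2_cnj: "L2 f \<Longrightarrow> L2 (\<lambda>x. cnj (f x))"
  by (auto simp: L2_def intro: borel_measurable_cnj)

text \<open>Membership in the \<open>L\<^sup>2\<close> closure of the trigonometric polynomials,
  phrased for a single function so that the class can be enlarged in stages: continuous functions
  vanishing near the end points, bounded functions, all of \<open>L2\<close>.\<close>

definition trig_dense :: "(real \<Rightarrow> complex) \<Rightarrow> bool" where
  "trig_dense f \<longleftrightarrow> L2 f \<and> (\<forall>e>0. \<exists>\<phi>. trigpoly \<phi> \<and> (LINT x|torus. (norm (f x - \<phi> x))\<^sup>2) < e)"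

lemma trig_dense_closed:
  assumes "L2 f" and "\<And>e. e > 0 \<Longrightarrow> \<exists>h. trig_dense h \<and> (LINT x|torus. (norm (f x - h x))\<^sup>2) < e"
  shows "trig_dense f"
  unfolding trig_dense_def
proof (intro conjI allI impI)
  fix e :: real assume e: "e > 0"
  then obtain h where h: "trig_dense h" "(LINT x|torus. (norm (f x - h x))\<^sup>2) < e / 4"
    using assms(2)[of "e/4"] by auto
  with e obtain \<phi> where p: "trigpoly \<phi>" "(LINT x|torus. (norm (h x - \<phi> x))\<^sup>2) < e / 4"
    unfolding trig_dense_def by (meson divide_pos_pos zero_less_numeral)
  have l: "L2 (\<lambda>x. f x - h x)" "L2 (\<lambda>x. h x - \<phi> x)" "L2 (\<lambda>x. f x - \<phi> x)"
    using assms(1) h(1) p(1) by (auto simp: trig_dense_def intro!: L2_diff intro: L2_trigpoly)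
  have "(LINT x|torus. (norm (f x - \<phi> x))\<^sup>2) \<le> (LINT x|torus. 2 * (norm (f x - h x))\<^sup>2 + 2 * (norm (h x - \<phi> x))\<^sup>2)"
    by (rule integral_mono) (use l norm_add_squared_le[of "f x - h x" "h x - \<phi> x" for x] in \<open>auto simp: L2_def\<close>)
  also have "\<dots> = 2 * (LINT x|torus. (norm (f x - h x))\<^sup>2) + 2 * (LINT x|torus. (norm (h x - \<phi> x))\<^sup>2)"
    using l by (simp add: L2_def)
  also have "\<dots> < e" using h p by simp
  finally show "\<exists>\<phi>. trigpoly \<phi> \<and> (LINT x|torus. (norm (f x - \<phi> x))\<^sup>2) < e" using p by blast
qed fact

lemma trig_dense_limit:
  assumes f: "f \<in> borel_measurable borel" and h: "\<And>n. trig_dense (h n)"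
    and lim: "AE x in torus. (\<lambda>n. h n x) \<longlonglongrightarrow> f x"
    and w: "L2 w" "\<And>n x. norm (h n x) \<le> norm (w x)" "\<And>x. norm (f x) \<le> norm (w x)"
  shows "trig_dense f"
proof (rule trig_dense_closed)
  show L: "L2 f" by (rule L2_dominated[OF f w(1,3)])
  have [measurable]: "f \<in> borel_measurable borel" "\<And>n. h n \<in> borel_measurable borel"
    using f h by (auto simp: trig_dense_def L2_def)
  have "(\<lambda>n. LINT x|torus. (norm (f x - h n x))\<^sup>2) \<longlonglongrightarrow> (LINT x|torus. 0)"
  proof (rule integral_dominated_convergence[where w = "\<lambda>x. 4 * (norm (w x))\<^sup>2"])
    show "AE x in torus. (\<lambda>n. (norm (f x - h n x))\<^sup>2) \<longlonglongrightarrow> 0"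
      using lim
    proof eventually_elim
      case (elim x)
      have "(\<lambda>n. (norm (f x - h n x))\<^sup>2) \<longlonglongrightarrow> (norm (f x - f x))\<^sup>2"
        by (intro tendsto_intros elim)
      then show ?case by simp
    qed
    show "AE x in torus. norm ((norm (f x - h n x))\<^sup>2) \<le> 4 * (norm (w x))\<^sup>2" for n
    proof (rule AE_I2)
      fix x
      have "norm (f x - h n x) \<le> 2 * norm (w x)"
        using norm_triangle_ineq4[of "f x" "h n x"] w(2)[of n x] w(3)[of x] by simp
      then have "(norm (f x - h n x))\<^sup>2 \<le> (2 * norm (w x))\<^sup>2" by (intro power_mono) auto
      then show "norm ((norm (f x - h n x))\<^sup>2) \<le> 4 * (norm (w x))\<^sup>2" by (simp add: power_mult_distrib)
    qed
  qed (use w in \<open>auto simp: L2_def\<close>)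
  then show "\<exists>g. trig_dense g \<and> (LINT x|torus. (norm (f x - g x))\<^sup>2) < e" if "e > 0" for e
    using h order_tendstoD(2)[of _ _ sequentially e] that by (force simp: eventually_sequentially)
qed

lemma trig_dense_continuous:
  assumes k: "continuous_on UNIV k" and d: "0 < d" "d < pi"
    and z: "\<And>x. x \<in> {0..d} \<union> {2*pi-d..2*pi} \<Longrightarrow> k x = 0" and B: "\<And>x. norm (k x) \<le> B"
  shows "trig_dense k"
  unfolding trig_dense_def
proof (intro conjI allI impI)
  have [measurable]: "k \<in> borel_measurable borel" using k by (rule borel_measurable_continuous_onI)
  then show L: "L2 k" using B by (rule L2_bounded)
  fix e :: real assume e: "e > 0"
  define r where "r = sqrt (e / (4 * pi))"
  have r: "r > 0" "r\<^sup>2 = e / (4 * pi)" using e by (auto simp: r_def)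
  obtain \<phi> where p: "trigpoly \<phi>" "\<And>x. x \<in> {0..2*pi} \<Longrightarrow> norm (k x - \<phi> x) < r"
    using trigpoly_uniform[OF k d z r(1)] by blast
  have "norm (LINT x|torus. (norm (k x - \<phi> x))\<^sup>2) \<le> r\<^sup>2 * (2 * pi - 0)"
  proof (rule norm_integral_segm_le)
    fix x assume "x \<in> {0..2*pi}"
    from p(2)[OF this] show "norm ((norm (k x - \<phi> x))\<^sup>2) \<le> r\<^sup>2" by (simp add: power_mono)
  qed auto
  also have "\<dots> < e" using e by (simp add: r)
  finally show "\<exists>\<phi>. trigpoly \<phi> \<and> (LINT x|torus. (norm (k x - \<phi> x))\<^sup>2) < e" using p(1) by auto
qed

text \<open>A piecewise linear cutoff for \<open>n > 0\<close>: 0 within \<open>1/n\<close> of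
  either end point of the period, 1 at distance at least \<open>2/n\<close> from both. It enforces
  the vanishing at the end points required by \<open>trigpoly_uniform\<close>.\<close>

definition bump :: "nat \<Rightarrow> real \<Rightarrow> real" where
  "bump n x = max 0 (min 1 (min (real n * x - 1) (real n * (2 * pi - x) - 1)))"

lemma bump_bounds: "0 \<le> bump n x" "bump n x \<le> 1"
  by (auto simp: bump_def)

lemma bump_tendsto:
  assumes "0 < x" "x < 2 * pi" shows "(\<lambda>n. bump n x) \<longlonglongrightarrow> 1"
proof -
  obtain N where N: "real N > 2 / x" "real N > 2 / (2 * pi - x)"
    by (metis max_less_iff_conj reals_Archimedean2)
  have "bump n x = 1" if "n \<ge> N" for n
  proof -
    have "real n > 2 / x" "real n > 2 / (2 * pi - x)" using N that by auto
    then have "real n * x > 2" "real n * (2 * pi - x) > 2"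
      using assms by (simp_all add: field_simps)
    then show ?thesis by (simp add: bump_def)
  qed
  then show ?thesis by (intro tendsto_eventually) (auto simp only: eventually_sequentially)
qed

lemma trig_dense_bounded:
  assumes f: "f \<in> borel_measurable borel" and B: "\<And>x. norm (f x) \<le> B" "B > 0"
  shows "trig_dense f"
proof -
  have "f measurable_on UNIV"
    using f by (intro lebesgue_measurable_imp_measurable_on measurable_completion) auto
  then obtain N g where N: "negligible N" and g: "\<And>n. continuous_on UNIV (g n)"
    and lim: "\<And>x. x \<notin> N \<Longrightarrow> (\<lambda>n. g n x) \<longlonglongrightarrow> f x"
    unfolding measurable_on_def by auto
  \<comment> \<open>The factor \<open>B / max B (norm (g n x))\<close> is the radial projection onto
    the ball of radius \<open>B\<close>: it keeps continuity, supplies a uniform bound for dominated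
    convergence, and tends to 1 because the limit already lies in the ball.\<close>
  define h where "h = (\<lambda>n x. of_real (bump n x * (B / max B (norm (g n x)))) * g n x)"
  have hB: "norm (h n x) \<le> B" for n x
  proof -
    have "norm (h n x) = bump n x * (B * norm (g n x) / max B (norm (g n x)))"
      using B(2) bump_bounds[of n x] by (simp add: h_def norm_mult norm_divide)
    also have "\<dots> \<le> 1 * (B * norm (g n x) / max B (norm (g n x)))"
      using B(2) bump_bounds[of n x] by (intro mult_right_mono) (auto intro!: divide_nonneg_nonneg)
    also have "\<dots> \<le> B" using B(2) by (auto simp: max_def field_simps)
    finally show ?thesis .
  qed
  show ?thesis
  proof (rule trig_dense_limit[where h = h and w = "\<lambda>_. of_real B"])
    show "trig_dense (h n)" for n
    proof (rule trig_dense_continuous[where d = "1 / (real n + 1)" and B = B])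
      have "continuous_on UNIV (bump n)" unfolding bump_def by (intro continuous_intros)
      then show "continuous_on UNIV (h n)"
        unfolding h_def using B(2) by (intro continuous_intros g) (auto simp: max_def)
      show "1 / (real n + 1) < pi" using pi_gt3 by (simp add: field_simps) (smt (verit) mult_nonneg_nonneg of_nat_0_le_iff)
      show "h n x = 0" if "x \<in> {0..1 / (real n + 1)} \<union> {2 * pi - 1 / (real n + 1)..2 * pi}" for x
      proof -
        have "real n * x \<le> 1 \<or> real n * (2 * pi - x) \<le> 1"
        proof -
          have *: "real n * y \<le> 1" if "y \<le> 1 / (real n + 1)" for y
          proof -
            have "real n * y \<le> real n * (1 / (real n + 1))" using that by (intro mult_left_mono) auto
            also have "\<dots> \<le> 1" by simp
            finally show ?thesis .
          qed
          show ?thesis using that *[of x] *[of "2 * pi - x"] by auto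
        qed
        then have "bump n x = 0" by (auto simp: bump_def)
        then show ?thesis by (simp add: h_def)
      qed
    qed (use hB in auto)
    have "AE x in lborel. x \<notin> N \<union> {0, 2 * pi}"
    proof -
      have "negligible (N \<union> {0, 2 * pi})" using N by (simp add: negligible_Un)
      then have "AE x in lebesgue. x \<notin> N \<union> {0, 2 * pi}"
        by (intro AE_not_in) (simp add: negligible_iff_null_sets)
      then show ?thesis by (simp add: AE_completion_iff)
    qed
    then show "AE x in torus. (\<lambda>n. h n x) \<longlonglongrightarrow> f x"
      unfolding AE_segm
    proof eventually_elim
      case (elim x)
      show ?case
      proof
        assume "x \<in> {0..2 * pi}"
        with elim have x: "0 < x" "x < 2 * pi" "x \<notin> N" by auto
        have "(\<lambda>n. h n x) \<longlonglongrightarrow> of_real (1 * (B / max B (norm (f x)))) * f x"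
          unfolding h_def using B(2) by (intro tendsto_intros bump_tendsto lim x) (auto simp: max_def)
        also have "of_real (1 * (B / max B (norm (f x)))) * f x = f x"
          using B by (simp add: max_absorb1)
        finally show "(\<lambda>n. h n x) \<longlonglongrightarrow> f x" .
      qed
    qed
    show "L2 (\<lambda>_. complex_of_real B)" by (rule L2_bounded[of _ B]) (use B in auto)
  qed (use f B hB in auto)
qed

lemma trig_dense_L2:
  assumes "L2 f" shows "trig_dense f"
proof (rule trig_dense_limit[where h = "\<lambda>n x. if norm (f x) \<le> real n + 1 then f x else 0" and w = f])
  have [measurable]: "f \<in> borel_measurable borel" using assms by (simp add: L2_def)
  show "trig_dense (\<lambda>x. if norm (f x) \<le> real n + 1 then f x else 0)" for n
    by (rule trig_dense_bounded[where B = "real n + 1"]) auto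
  show "AE x in torus. (\<lambda>n. if norm (f x) \<le> real n + 1 then f x else 0) \<longlonglongrightarrow> f x"
  proof (rule AE_I2)
    fix x
    obtain N where "norm (f x) \<le> real N" using real_arch_simple by blast
    then have "(if norm (f x) \<le> real n + 1 then f x else 0) = f x" if "n \<ge> N" for n
      using that by auto
    then show "(\<lambda>n. if norm (f x) \<le> real n + 1 then f x else 0) \<longlonglongrightarrow> f x"
      by (intro tendsto_eventually) (auto simp only: eventually_sequentially)
  qed
  show "f \<in> borel_measurable borel" by measurable
qed (use assms in auto)

section \<open>Partial Fourier sums\<close>

definition partial_fourier :: "(real \<Rightarrow> complex) \<Rightarrow> nat \<Rightarrow> real \<Rightarrow> complex" where
  "partial_fourier f N x = (\<Sum>n\<in>{-int N..int N}. fourier_coeff f n * chr n x)"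

lemma trigpoly_partial_fourier: "trigpoly (partial_fourier f N)"
  unfolding partial_fourier_def by (rule trigpolyI[OF refl])

lemma fourier_coeff_diff:
  assumes "L2 f" "L2 g"
  shows "fourier_coeff (\<lambda>x. f x - g x) n = fourier_coeff f n - fourier_coeff g n"
proof -
  have L: "L2 (chr (-n))" by (rule L2_bounded[of _ 1]) auto
  show ?thesis
    using assms L2_mult_integrable[OF assms(1) L] L2_mult_integrable[OF assms(2) L]
    by (subst (1 2 3) fourier_coeff_eq) (auto simp: L2_def left_diff_distrib diff_divide_distrib)
qed

lemma fourier_coeff_trig_sum:
  assumes "finite A"
  shows "fourier_coeff (\<lambda>x. \<Sum>n\<in>A. a n * chr n x) m = (if m \<in> A then a m else 0)"
proof -
  have "(LINT x|torus. (\<Sum>n\<in>A. a n * chr n x) * chr (-m) x) = (LINT x|torus. (\<Sum>n\<in>A. a n * chr (n - m) x))"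
    by (simp add: sum_distrib_right mult.assoc flip: chr_add)
  also have "\<dots> = (\<Sum>n\<in>A. LINT x|torus. a n * chr (n - m) x)"
    by (rule Bochner_Integration.integral_sum) (auto intro!: integrable_segm_bounded[where B = "norm (a _)"] simp: norm_mult)
  also have "\<dots> = (\<Sum>n\<in>A. if n = m then 2 * pi * a m else 0)"
    by (intro sum.cong) (auto simp: integral_chr_torus)
  also have "\<dots> = (if m \<in> A then 2 * pi * a m else 0)" using assms by (simp add: sum.delta)
  finally show ?thesis by (subst fourier_coeff_eq) auto
qed

lemma L2_trig_sum: "finite A \<Longrightarrow> L2 (\<lambda>x. \<Sum>n\<in>A. a n * chr n x)"
  by (intro L2_trigpoly trigpoly_sum trigpoly_chr)

text \<open>The remainder \<open>r\<close> has zero coefficients on \<open>A\<close>, so it is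
  orthogonal to every trigonometric sum over \<open>A\<close>. Leaving \<open>b\<close> free covers
  two uses: the coefficients of \<open>f\<close> give Bessel's inequality, their difference to those
  of a competitor gives best approximation.\<close>

lemma fourier_pythagoras:
  fixes b :: "int \<Rightarrow> complex"
  assumes f: "L2 f" and A: "finite A"
  defines "r \<equiv> \<lambda>x. f x - (\<Sum>n\<in>A. fourier_coeff f n * chr n x)" and "q \<equiv> \<lambda>x. \<Sum>n\<in>A. b n * chr n x"
  shows "(LINT x|torus. (norm (r x + q x))\<^sup>2) = (LINT x|torus. (norm (r x))\<^sup>2) + (LINT x|torus. (norm (q x))\<^sup>2)"
proof -
  have L: "L2 r" "L2 q" unfolding r_def q_def by (intro L2_diff f L2_trig_sum A)+
  have Lc: "L2 (chr (-n))" for n by (rule L2_bounded[of _ 1]) auto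
  have fr: "(LINT x|torus. r x * chr (-n) x) = 0" if "n \<in> A" for n
  proof -
    have "fourier_coeff r n = 0"
      unfolding r_def using that A by (subst fourier_coeff_diff[OF f L2_trig_sum]) (auto simp: fourier_coeff_trig_sum)
    then show ?thesis using L by (simp add: fourier_coeff_eq L2_def)
  qed
  have "(LINT x|torus. r x * cnj (q x)) = (LINT x|torus. (\<Sum>n\<in>A. cnj (b n) * (r x * chr (-n) x)))"
    by (simp add: q_def sum_distrib_left cnj_chr mult_ac)
  also have "\<dots> = (\<Sum>n\<in>A. LINT x|torus. cnj (b n) * (r x * chr (-n) x))"
    by (rule Bochner_Integration.integral_sum) (intro integrable_mult_right L2_mult_integrable L Lc)
  also have "\<dots> = 0" using fr by (intro sum.neutral) auto
  finally have orth: "(LINT x|torus. r x * cnj (q x)) = 0" .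
  have "(norm (r x + q x))\<^sup>2 = (norm (r x))\<^sup>2 + (norm (q x))\<^sup>2 + 2 * Re (r x * cnj (q x))" for x
    unfolding cmod_power2 by (simp add: power2_sum algebra_simps)
  then have "(LINT x|torus. (norm (r x + q x))\<^sup>2) = (LINT x|torus. (norm (r x))\<^sup>2 + (norm (q x))\<^sup>2 + 2 * Re (r x * cnj (q x)))"
    by simp
  also have "\<dots> = (LINT x|torus. (norm (r x))\<^sup>2) + (LINT x|torus. (norm (q x))\<^sup>2) + 2 * Re (LINT x|torus. r x * cnj (q x))"
    using L L2_mult_integrable[OF L(1) L2_cnj[OF L(2)]] by (simp add: L2_def del: times_complex.sel)
  finally show ?thesis unfolding orth by simp
qed

lemma integral_trig_sum_squared:
  assumes A: "finite A"
  shows "(LINT x|torus. (norm (\<Sum>n\<in>A. a n * chr n x))\<^sup>2) = 2 * pi * (\<Sum>n\<in>A. (norm (a n))\<^sup>2)"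
proof -
  define q where "q = (\<lambda>x. \<Sum>n\<in>A. a n * chr n x)"
  have L: "L2 q" unfolding q_def by (rule L2_trig_sum[OF A])
  have Lc: "L2 (chr (-n))" for n by (rule L2_bounded[of _ 1]) auto
  have qf: "(LINT x|torus. q x * chr (-n) x) = 2 * pi * a n" if "n \<in> A" for n
    using fourier_coeff_trig_sum[OF A, of a n] that L by (simp add: q_def[symmetric] fourier_coeff_eq L2_def divide_eq_eq mult.commute)
  have "complex_of_real (LINT x|torus. (norm (q x))\<^sup>2) = (LINT x|torus. q x * cnj (q x))"
    unfolding integral_complex_of_real[symmetric] complex_norm_square ..
  also have "\<dots> = (LINT x|torus. (\<Sum>n\<in>A. cnj (a n) * (q x * chr (-n) x)))"
    by (subst (2) q_def) (simp add: sum_distrib_left cnj_chr mult_ac)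
  also have "\<dots> = (\<Sum>n\<in>A. LINT x|torus. cnj (a n) * (q x * chr (-n) x))"
    by (rule Bochner_Integration.integral_sum) (intro integrable_mult_right L2_mult_integrable L Lc)
  also have "\<dots> = (\<Sum>n\<in>A. 2 * pi * complex_of_real ((norm (a n))\<^sup>2))"
  proof (rule sum.cong[OF refl])
    fix n assume n: "n \<in> A"
    show "(LINT x|torus. cnj (a n) * (q x * chr (-n) x)) = 2 * pi * complex_of_real ((norm (a n))\<^sup>2)"
      unfolding integral_mult_right_zero qf[OF n] complex_norm_square by (simp only: mult_ac)
  qed
  also have "\<dots> = complex_of_real (2 * pi * (\<Sum>n\<in>A. (norm (a n))\<^sup>2))"
    by (simp add: sum_distrib_left)
  finally show ?thesis unfolding q_def of_real_eq_iff .
qed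

lemma bessel:
  assumes f: "L2 f" and A: "finite A"
  shows "(\<Sum>n\<in>A. (norm (fourier_coeff f n))\<^sup>2) \<le> (LINT x|torus. (norm (f x))\<^sup>2)"
proof -
  have "(\<Sum>n\<in>A. (norm (fourier_coeff f n))\<^sup>2) \<le> 2 * pi * (\<Sum>n\<in>A. (norm (fourier_coeff f n))\<^sup>2)"
    using pi_ge_two mult_right_mono[of 1 "2 * pi" "\<Sum>n\<in>A. (norm (fourier_coeff f n))\<^sup>2"] by (simp add: sum_nonneg)
  also have "\<dots> = (LINT x|torus. (norm (\<Sum>n\<in>A. fourier_coeff f n * chr n x))\<^sup>2)"
    by (rule integral_trig_sum_squared[OF A, symmetric])
  also have "\<dots> \<le> (LINT x|torus. (norm (f x))\<^sup>2)"
    using fourier_pythagoras[OF f A, of "fourier_coeff f"] by (simp add: integral_nonneg_AE)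
  finally show ?thesis .
qed

lemma partial_fourier_best:
  assumes f: "L2 f" and p: "\<phi> = (\<lambda>x. \<Sum>n\<in>{-int N..int N}. a n * chr n x)"
  shows "(LINT x|torus. (norm (f x - partial_fourier f N x))\<^sup>2) \<le> (LINT x|torus. (norm (f x - \<phi> x))\<^sup>2)"
proof -
  have eq: "f x - partial_fourier f N x + (\<Sum>n\<in>{-int N..int N}. (fourier_coeff f n - a n) * chr n x) = f x - \<phi> x" for x
    by (simp add: p partial_fourier_def sum_subtractf left_diff_distrib)
  have "(LINT x|torus. (norm (f x - \<phi> x))\<^sup>2) = (LINT x|torus. (norm (f x - partial_fourier f N x))\<^sup>2)
      + (LINT x|torus. (norm (\<Sum>n\<in>{-int N..int N}. (fourier_coeff f n - a n) * chr n x))\<^sup>2)"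
    using fourier_pythagoras[OF f, of "{-int N..int N}" "\<lambda>n. fourier_coeff f n - a n"]
    unfolding partial_fourier_def[symmetric] eq by simp
  then show ?thesis by (simp add: integral_nonneg_AE)
qed

lemma partial_fourier_tendsto:
  assumes f: "L2 f"
  shows "(\<lambda>N. LINT x|torus. (norm (f x - partial_fourier f N x))\<^sup>2) \<longlonglongrightarrow> 0"
proof (rule LIMSEQ_I)
  fix e :: real assume "e > 0"
  then obtain \<phi> where p: "trigpoly \<phi>" "(LINT x|torus. (norm (f x - \<phi> x))\<^sup>2) < e"
    using trig_dense_L2[OF f] unfolding trig_dense_def by auto
  then obtain N a where pe: "\<phi> = (\<lambda>x. \<Sum>n\<in>{-int N..int N}. a n * chr n x)"
    unfolding trigpoly_def by auto
  have "norm ((LINT x|torus. (norm (f x - partial_fourier f M x))\<^sup>2) - 0) < e" if "M \<ge> N" for M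
    using partial_fourier_best[OF f, of \<phi> "\<lambda>n. if \<bar>n\<bar> \<le> int N then a n else 0" M] p(2)
      trigpoly_extend[OF that, of a] by (simp add: pe)
  then show "\<exists>N. \<forall>M\<ge>N. norm ((LINT x|torus. (norm (f x - partial_fourier f M x))\<^sup>2) - 0) < e" by blast
qed

text \<open>The partial Fourier sums of \<open>f - g\<close> are all zero and converge to it in
  \<open>L\<^sup>2\<close>. This is what allows an \<open>L\<^sup>2\<close> function with summable
  coefficients to be replaced by its absolutely convergent series.\<close>

lemma L2_fourier_coeff_eq_imp_AE_eq:
  assumes "L2 f" "L2 g" "\<And>n. fourier_coeff f n = fourier_coeff g n"
  shows "AE x in torus. f x = g x"
proof -
  define r where "r = (\<lambda>x. f x - g x)"
  have L: "L2 r" unfolding r_def by (intro L2_diff assms)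
  have "partial_fourier r N x = 0" for N x
    using assms by (simp add: partial_fourier_def r_def fourier_coeff_diff)
  with partial_fourier_tendsto[OF L] have "(LINT x|torus. (norm (r x))\<^sup>2) = 0"
    by (simp add: LIMSEQ_const_iff)
  then have "AE x in torus. (norm (r x))\<^sup>2 = 0"
    using L by (subst (asm) integral_nonneg_eq_0_iff_AE) (auto simp: L2_def)
  then show ?thesis by eventually_elim (simp add: r_def)
qed

text \<open>Fatou along an almost everywhere convergent subsequence of the partial sums.\<close>
lemma nn_integral_power4_le_partial_fourier:
  assumes f: "L2 f"
  shows "(\<integral>\<^sup>+x. ennreal (norm (f x) ^ 4) \<partial>torus)
    \<le> liminf (\<lambda>N. \<integral>\<^sup>+x. ennreal (norm (partial_fourier f N x) ^ 4) \<partial>torus)"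
proof -
  define G where "G = (\<lambda>N. \<integral>\<^sup>+x. ennreal (norm (partial_fourier f N x) ^ 4) \<partial>torus)"
  \<comment> \<open>The subsequence realising the liminf is fixed before the almost everywhere
    convergent one is extracted from it, so that the final bound is by the liminf of the full
    sequence.\<close>
  obtain r0 where r0: "strict_mono r0" "(G \<circ> r0) \<longlonglongrightarrow> liminf G"
    using liminf_subseq_lim by blast
  have [measurable]: "partial_fourier f N \<in> borel_measurable borel" "f \<in> borel_measurable borel" for N
    using f by (auto simp: L2_def intro!: trigpoly_measurable trigpoly_partial_fourier)
  define e where "e = (\<lambda>N x. (norm (f x - partial_fourier f N x))\<^sup>2)"
  have int: "integrable torus (e N)" for N
    using L2_diff[OF f L2_trigpoly[OF trigpoly_partial_fourier]] by (simp add: L2_def e_def)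
  have "(\<lambda>N. LINT x|torus. norm (e (r0 N) x)) \<longlonglongrightarrow> 0"
    using LIMSEQ_subseq_LIMSEQ[OF partial_fourier_tendsto[OF f] r0(1)] by (simp add: e_def o_def)
  then obtain r1 where r1: "strict_mono r1" "AE x in torus. (\<lambda>N. e (r0 (r1 N)) x) \<longlonglongrightarrow> 0"
    using tendsto_L1_AE_subseq[of torus "\<lambda>N. e (r0 N)"] int by auto
  have "(\<integral>\<^sup>+x. ennreal (norm (f x) ^ 4) \<partial>torus) \<le>
    (\<integral>\<^sup>+x. liminf (\<lambda>N. ennreal (norm (partial_fourier f (r0 (r1 N)) x) ^ 4)) \<partial>torus)"
  proof (rule nn_integral_mono_AE)
    show "AE x in torus. ennreal (norm (f x) ^ 4) \<le> liminf (\<lambda>N. ennreal (norm (partial_fourier f (r0 (r1 N)) x) ^ 4))"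
      using r1(2)
    proof eventually_elim
      case (elim x)
      have "(\<lambda>N. sqrt (e (r0 (r1 N)) x)) \<longlonglongrightarrow> sqrt 0" by (intro tendsto_intros elim)
      then have "(\<lambda>N. norm (f x - partial_fourier f (r0 (r1 N)) x)) \<longlonglongrightarrow> 0" by (simp add: e_def)
      then have "(\<lambda>N. f x - partial_fourier f (r0 (r1 N)) x) \<longlonglongrightarrow> 0" by (rule tendsto_norm_zero_cancel)
      from tendsto_diff[OF tendsto_const[of "f x"] this]
      have "(\<lambda>N. partial_fourier f (r0 (r1 N)) x) \<longlonglongrightarrow> f x" by simp
      then have "(\<lambda>N. ennreal (norm (partial_fourier f (r0 (r1 N)) x) ^ 4)) \<longlonglongrightarrow> ennreal (norm (f x) ^ 4)"
        by (intro tendsto_intros tendsto_ennrealI)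
      from lim_imp_Liminf[OF _ this] show ?case by simp
    qed
  qed
  also have "\<dots> \<le> liminf (\<lambda>N. (G \<circ> r0) (r1 N))"
    unfolding G_def o_def by (rule nn_integral_liminf) measurable
  also have "\<dots> = liminf G"
    using LIMSEQ_subseq_LIMSEQ[OF r0(2) r1(1)] by (intro lim_imp_Liminf) (auto simp: o_def)
  finally show ?thesis by (simp add: G_def)
qed

section \<open>Strichartz estimates\<close>

lemma nn_integral_segm_mono:
  assumes [measurable]: "f \<in> borel_measurable borel" and "{a..b} \<subseteq> {c..d}"
  shows "nn_integral (segm a b) f \<le> nn_integral (segm c d) f"
  using assms(2) by (subst (1 2) nn_integral_segm) (auto intro!: nn_integral_mono split: split_indicator)

lemma borel_measurable_segm_pair [simp]:
  "f \<in> borel_measurable (segm a b \<Otimes>\<^sub>M segm c d) \<longleftrightarrow> f \<in> borel_measurable (borel \<Otimes>\<^sub>M borel)"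
  by (intro arg_cong2[where f = "(\<in>)"] refl measurable_cong_sets sets_pair_measure_cong) auto

text \<open>A frequency-truncated free wave. Later the coefficient argument is itself made to depend
  on time, so that a curve in the interaction picture becomes a wave with moving
  coefficients.\<close>

definition wave :: "int \<Rightarrow> (int \<Rightarrow> complex) \<Rightarrow> int set \<Rightarrow> real \<Rightarrow> real \<Rightarrow> complex" where
  "wave \<sigma> a A t x = (\<Sum>n\<in>A. a n * chr (- \<sigma> * n\<^sup>2) t * chr n x)"

lemma wave_measurable [measurable]:
  "(\<lambda>(t, x). wave \<sigma> a A t x) \<in> borel_measurable (borel \<Otimes>\<^sub>M borel)"
  unfolding wave_def by measurable

lemma wave_measurable1 [measurable]: "wave \<sigma> a A t \<in> borel_measurable borel"
  unfolding wave_def by measurable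

lemma norm_wave_le: "norm (wave \<sigma> a A t x) \<le> (\<Sum>n\<in>A. norm (a n))"
  unfolding wave_def by (rule order_trans[OF norm_sum]) (simp add: norm_mult)

text \<open>Eliminating \<open>k\<close> turns the quadratic relation into
  \<open>2 * ((n - m) * (n - l)) = 0\<close>: two pairs of integers with equal sums and equal sums
  of squares coincide up to order.\<close>

lemma resonant_quadruple:
  fixes n m k l \<sigma> :: int
  assumes "n - m + (k - l) = 0" "\<sigma> * (n\<^sup>2 - m\<^sup>2) + \<sigma> * (k\<^sup>2 - l\<^sup>2) = 0" "\<sigma> \<noteq> 0"
  shows "(n = m \<and> k = l) \<or> (n = l \<and> m = k)"
proof -
  have k: "k = l - (n - m)" using assms(1) by simp
  have "\<sigma> * (n\<^sup>2 - m\<^sup>2 + (k\<^sup>2 - l\<^sup>2)) = 0" using assms(2) by (simp add: ring_distribs)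
  with assms(3) have "n\<^sup>2 - m\<^sup>2 + (k\<^sup>2 - l\<^sup>2) = 0" by simp
  then have "2 * ((n - m) * (n - l)) = 0" unfolding k by (simp add: power2_eq_square algebra_simps)
  then show ?thesis using k by auto
qed

lemma integral_sum_sum:
  fixes f :: "_ \<Rightarrow> _ \<Rightarrow> _ \<Rightarrow> 'b::{banach, second_countable_topology}"
  assumes "\<And>p q. p \<in> A \<Longrightarrow> q \<in> B \<Longrightarrow> integrable M (f p q)"
  shows "(LINT x|M. (\<Sum>p\<in>A. \<Sum>q\<in>B. f p q x)) = (\<Sum>p\<in>A. \<Sum>q\<in>B. integral\<^sup>L M (f p q))"
  using assms by (simp add: Bochner_Integration.integral_sum Bochner_Integration.integrable_sum)

text \<open>Zygmund's computation. Expanding the fourth power as the square of the wave times its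
  conjugate gives a quadruple sum; integrating over a full period in both variables keeps only the
  quadruples satisfying both relations of \<open>resonant_quadruple\<close>. Each of its two
  alternatives contributes \<open>(2 pi)\<^sup>2\<close> times the squared
  \<open>\<ell>\<^sup>2\<close> mass, hence \<open>8 pi\<^sup>2\<close>.\<close>

lemma zygmund_real:
  assumes A: "finite A" and s: "\<sigma> \<noteq> 0"
  shows "(LINT t|segm \<alpha> (\<alpha> + 2 * pi). LINT x|torus. norm (wave \<sigma> a A t x) ^ 4)
    \<le> 8 * pi\<^sup>2 * (\<Sum>n\<in>A. (norm (a n))\<^sup>2)\<^sup>2"
proof -
  let ?B = "A \<times> A"
  define c where "c = (\<lambda>(n, m). a n * cnj (a m))"
  define d where "d = (\<lambda>(n::int, m::int). n - m)"
  define e where "e = (\<lambda>(n::int, m::int). - (\<sigma> * (n\<^sup>2 - m\<^sup>2)))"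
  define S where "S = (\<Sum>n\<in>A. (norm (a n))\<^sup>2)"
  have pw: "complex_of_real (norm (wave \<sigma> a A t x) ^ 4)
    = (\<Sum>p\<in>?B. \<Sum>q\<in>?B. c p * c q * chr (e p + e q) t * chr (d p + d q) x)" for t x
  proof -
    let ?w = "wave \<sigma> a A t x"
    have e: "chr (e (n, m)) t = chr (- \<sigma> * n\<^sup>2) t * chr (\<sigma> * m\<^sup>2) t" for n m
      by (simp add: e_def algebra_simps flip: chr_add)
    have d: "chr (d (n, m)) x = chr n x * chr (- m) x" for n m
      by (simp add: d_def flip: chr_add)
    have "?w * cnj ?w = (\<Sum>n\<in>A. \<Sum>m\<in>A. c (n, m) * chr (e (n, m)) t * chr (d (n, m)) x)"
      unfolding wave_def cnj_sum sum_product
      by (intro sum.cong refl) (simp add: e d c_def cnj_chr mult_ac)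
    also have "\<dots> = (\<Sum>p\<in>?B. c p * chr (e p) t * chr (d p) x)"
      by (simp add: sum.cartesian_product)
    finally have 1: "?w * cnj ?w = \<dots>" .
    have "complex_of_real (norm ?w ^ 4) = (?w * cnj ?w) * (?w * cnj ?w)"
      by (simp add: complex_norm_square[symmetric] flip: power_add of_real_mult of_real_power)
    also have "\<dots> = (\<Sum>p\<in>?B. \<Sum>q\<in>?B. c p * c q * chr (e p + e q) t * chr (d p + d q) x)"
      unfolding 1 sum_product by (simp add: chr_add mult_ac)
    finally show ?thesis .
  qed
  have int: "integrable (segm u v) (\<lambda>x. k * chr n x)" for k n u v
    by (rule integrable_segm_bounded[where B = "norm k"]) (auto simp: norm_mult)
  have "complex_of_real (LINT t|segm \<alpha> (\<alpha> + 2 * pi). LINT x|torus. norm (wave \<sigma> a A t x) ^ 4)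
    = (LINT t|segm \<alpha> (\<alpha> + 2 * pi). LINT x|torus. complex_of_real (norm (wave \<sigma> a A t x) ^ 4))"
    by (simp only: integral_complex_of_real)
  also have "\<dots> = (LINT t|segm \<alpha> (\<alpha> + 2 * pi). (\<Sum>p\<in>?B. \<Sum>q\<in>?B.
      (c p * c q * (if d p + d q = 0 then 2 * pi else 0)) * chr (e p + e q) t))"
    unfolding pw
    by (subst integral_sum_sum, rule int, unfold integral_mult_right_zero integral_chr_torus)
       (intro Bochner_Integration.integral_cong sum.cong refl, simp only: mult_ac)
  also have "\<dots> = (\<Sum>p\<in>?B. \<Sum>q\<in>?B.
      c p * c q * (if d p + d q = 0 then 2 * pi else 0) * (if e p + e q = 0 then 2 * pi else 0))"
    by (subst integral_sum_sum, rule int, unfold integral_mult_right_zero integral_chr_period) (rule refl)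
  finally have "norm (complex_of_real (LINT t|segm \<alpha> (\<alpha> + 2 * pi). LINT x|torus. norm (wave \<sigma> a A t x) ^ 4))
     \<le> (\<Sum>p\<in>?B. \<Sum>q\<in>?B. norm (c p * c q * (if d p + d q = 0 then 2 * pi else 0) * (if e p + e q = 0 then 2 * pi else 0)))"
    by (simp only:) (intro order_trans[OF norm_sum] sum_mono order_refl)
  \<comment> \<open>Quadruples whose four frequencies are equal satisfy both alternatives and are
    counted twice; this only enlarges the right-hand side.\<close>
  also have "\<dots> \<le> (\<Sum>p\<in>?B. \<Sum>q\<in>?B. 4 * pi\<^sup>2 * ((if fst p = snd p then norm (c p) else 0) * (if fst q = snd q then norm (c q) else 0)
      + (if q = (snd p, fst p) then norm (c p) * norm (c q) else 0)))"
  proof (intro sum_mono)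
    fix p q
    show "norm (c p * c q * (if d p + d q = 0 then 2 * pi else 0) * (if e p + e q = 0 then 2 * pi else 0))
      \<le> 4 * pi\<^sup>2 * ((if fst p = snd p then norm (c p) else 0) * (if fst q = snd q then norm (c q) else 0)
      + (if q = (snd p, fst p) then norm (c p) * norm (c q) else 0))" (is "?l \<le> ?r")
    proof (cases "d p + d q = 0 \<and> e p + e q = 0")
      case True
      obtain n m k l where pq: "p = (n, m)" "q = (k, l)" by (cases p, cases q)
      have "(n = m \<and> k = l) \<or> (n = l \<and> m = k)"
        by (rule resonant_quadruple[of n m k l \<sigma>]) (use True s in \<open>auto simp: pq d_def e_def\<close>)
      then have "4 * pi\<^sup>2 * (norm (c p) * norm (c q)) \<le> ?r"
        by (intro mult_left_mono) (auto simp: pq)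
      moreover have "?l = 4 * pi\<^sup>2 * (norm (c p) * norm (c q))"
        using True by (simp add: norm_mult power2_eq_square)
      ultimately show ?thesis by (rule ord_eq_le_trans[rotated])
    next
      case False
      then have "?l = 0" by auto
      moreover have "0 \<le> ?r" by auto
      ultimately show ?thesis by (rule ord_eq_le_trans)
    qed
  qed
  also have "\<dots> = 4 * pi\<^sup>2 * ((\<Sum>p\<in>?B. if fst p = snd p then norm (c p) else 0)\<^sup>2
      + (\<Sum>p\<in>?B. \<Sum>q\<in>?B. if q = (snd p, fst p) then norm (c p) * norm (c q) else 0))"
    by (simp add: sum.distrib power2_eq_square sum_product flip: sum_distrib_left)
  also have "(\<Sum>p\<in>?B. if fst p = snd p then norm (c p) else 0) = S"
  proof -
    have "(\<Sum>p\<in>?B. if fst p = snd p then norm (c p) else 0) = (\<Sum>n\<in>A. \<Sum>m\<in>A. if n = m then norm (c (n, m)) else 0)"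
      unfolding sum.cartesian_product by (intro sum.cong) auto
    also have "\<dots> = S" using A unfolding S_def
      by (intro sum.cong) (simp_all add: sum.delta c_def norm_mult power2_eq_square)
    finally show ?thesis .
  qed
  also have "(\<Sum>p\<in>?B. \<Sum>q\<in>?B. if q = (snd p, fst p) then norm (c p) * norm (c q) else 0) = S\<^sup>2"
  proof -
    have "(\<Sum>p\<in>?B. \<Sum>q\<in>?B. if q = (snd p, fst p) then norm (c p) * norm (c q) else 0) = (\<Sum>p\<in>?B. norm (c p) * norm (c (snd p, fst p)))"
      using A by (intro sum.cong) (auto simp: sum.delta)
    also have "\<dots> = (\<Sum>n\<in>A. \<Sum>m\<in>A. (norm (a n))\<^sup>2 * (norm (a m))\<^sup>2)"
      by (simp add: sum.cartesian_product case_prod_unfold c_def norm_mult power2_eq_square mult_ac)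
    also have "\<dots> = S\<^sup>2" by (simp add: S_def power2_eq_square sum_product)
    finally show ?thesis .
  qed
  also have "4 * pi\<^sup>2 * (S\<^sup>2 + S\<^sup>2) = 8 * pi\<^sup>2 * S\<^sup>2" by simp
  finally show ?thesis unfolding S_def by (simp only: norm_of_real)
qed

lemma zygmund:
  assumes A: "finite A" and s: "\<sigma> \<noteq> 0" and ab: "\<beta> \<le> \<alpha> + 2 * pi"
  shows "(\<integral>\<^sup>+t. \<integral>\<^sup>+x. ennreal (norm (wave \<sigma> a A t x) ^ 4) \<partial>torus \<partial>segm \<alpha> \<beta>)
    \<le> ennreal (8 * pi\<^sup>2 * (\<Sum>n\<in>A. (norm (a n))\<^sup>2)\<^sup>2)"
proof -
  define C where "C = (\<Sum>n\<in>A. norm (a n)) ^ 4"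
  have le: "norm (wave \<sigma> a A t x) ^ 4 \<le> C" for t x
    unfolding C_def by (intro power_mono norm_wave_le) auto
  have i1: "integrable torus (\<lambda>x. norm (wave \<sigma> a A t x) ^ 4)" for t
    by (rule integrable_segm_bounded[where B = C]) (use le in auto)
  have m: "(\<lambda>t. LINT x|torus. norm (wave \<sigma> a A t x) ^ 4) \<in> borel_measurable borel"
    by measurable
  have "norm (LINT x|torus. norm (wave \<sigma> a A t x) ^ 4) \<le> C * (2 * pi - 0)" for t
    by (rule norm_integral_segm_le) (use le in \<open>auto simp: C_def sum_nonneg\<close>)
  then have i2: "integrable (segm \<alpha> (\<alpha> + 2 * pi)) (\<lambda>t. LINT x|torus. norm (wave \<sigma> a A t x) ^ 4)"
    by (intro integrable_segm_bounded[where B = "C * (2 * pi - 0)"] m)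
  have eq: "(\<integral>\<^sup>+x. ennreal (norm (wave \<sigma> a A t x) ^ 4) \<partial>torus) = ennreal (LINT x|torus. norm (wave \<sigma> a A t x) ^ 4)" for t
    using i1 by (subst nn_integral_eq_integral) auto
  have "(\<integral>\<^sup>+t. \<integral>\<^sup>+x. ennreal (norm (wave \<sigma> a A t x) ^ 4) \<partial>torus \<partial>segm \<alpha> \<beta>)
     \<le> (\<integral>\<^sup>+t. \<integral>\<^sup>+x. ennreal (norm (wave \<sigma> a A t x) ^ 4) \<partial>torus \<partial>segm \<alpha> (\<alpha> + 2 * pi))"
    unfolding eq using m ab by (intro nn_integral_segm_mono) auto
  also have "\<dots> = ennreal (LINT t|segm \<alpha> (\<alpha> + 2 * pi). LINT x|torus. norm (wave \<sigma> a A t x) ^ 4)"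
    unfolding eq using i2 by (subst nn_integral_eq_integral) auto
  also have "\<dots> \<le> ennreal (8 * pi\<^sup>2 * (\<Sum>n\<in>A. (norm (a n))\<^sup>2)\<^sup>2)"
    by (intro ennreal_leI zygmund_real A s)
  finally show ?thesis .
qed

text \<open>Hoelder's inequality with exponents 2, 4, 4, by two applications of Cauchy--Schwarz.
  Stating it for the fourth power avoids roots of extended nonnegative numbers.\<close>

lemma nn_integral_product_power4:
  assumes [measurable]: "v \<in> borel_measurable M" "w \<in> borel_measurable M" "u \<in> borel_measurable M"
  shows "(\<integral>\<^sup>+x. v x * (w x * u x) \<partial>M) ^ 4
    \<le> (\<integral>\<^sup>+x. v x ^ 2 \<partial>M)\<^sup>2 * ((\<integral>\<^sup>+x. w x ^ 4 \<partial>M) * (\<integral>\<^sup>+x. u x ^ 4 \<partial>M))"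
proof -
  have "(\<integral>\<^sup>+x. v x * (w x * u x) \<partial>M) ^ 4 = ((\<integral>\<^sup>+x. v x * (w x * u x) \<partial>M)\<^sup>2)\<^sup>2" by simp
  also have "\<dots> \<le> ((\<integral>\<^sup>+x. v x ^ 2 \<partial>M) * (\<integral>\<^sup>+x. (w x * u x) ^ 2 \<partial>M))\<^sup>2"
    by (intro power_mono Cauchy_Schwarz_nn_integral) auto
  also have "\<dots> = (\<integral>\<^sup>+x. v x ^ 2 \<partial>M)\<^sup>2 * (\<integral>\<^sup>+x. w x ^ 2 * u x ^ 2 \<partial>M)\<^sup>2"
    by (simp add: power_mult_distrib)
  also have "(\<integral>\<^sup>+x. w x ^ 2 * u x ^ 2 \<partial>M)\<^sup>2 \<le> (\<integral>\<^sup>+x. (w x ^ 2)\<^sup>2 \<partial>M) * (\<integral>\<^sup>+x. (u x ^ 2)\<^sup>2 \<partial>M)"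
    by (intro Cauchy_Schwarz_nn_integral) auto
  finally show ?thesis by (simp add: mult_left_mono flip: power_mult)
qed

text \<open>The dual form of the \<open>L\<^sup>4\<close> bound: only trigonometric polynomials are tested.\<close>
lemma dual_estimate:
  fixes G :: "real \<Rightarrow> real \<Rightarrow> complex" and V W :: "real \<Rightarrow> real \<Rightarrow> real"
  assumes A: "finite A" and \<sigma>: "\<sigma> \<noteq> 0" and st: "t \<le> s + 2 * pi"
    and [measurable]: "(\<lambda>(r, x). G r x) \<in> borel_measurable (borel \<Otimes>\<^sub>M borel)"
      "(\<lambda>(r, x). V r x) \<in> borel_measurable (borel \<Otimes>\<^sub>M borel)"
      "(\<lambda>(r, x). W r x) \<in> borel_measurable (borel \<Otimes>\<^sub>M borel)"
    and le: "\<And>r x. norm (G r x) \<le> V r x * W r x" and nn: "\<And>r x. V r x \<ge> 0" "\<And>r x. W r x \<ge> 0"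
    and Va: "(\<integral>\<^sup>+r. \<integral>\<^sup>+x. ennreal ((V r x)\<^sup>2) \<partial>torus \<partial>segm s t) \<le> ennreal a"
    and Wb: "(\<integral>\<^sup>+r. \<integral>\<^sup>+x. ennreal (W r x ^ 4) \<partial>torus \<partial>segm s t) \<le> ennreal b"
    and ab: "a \<ge> 0" "b \<ge> 0"
  shows "(\<Sum>n\<in>A. (norm (LINT r|segm s t. chr (\<sigma> * n\<^sup>2) r * fourier_coeff (G r) n))\<^sup>2)\<^sup>2 \<le> 8 * pi\<^sup>2 * (a\<^sup>2 * b)"
proof -
  let ?P = "segm s t \<Otimes>\<^sub>M torus"
  define y where "y = (\<lambda>n. LINT r|segm s t. chr (\<sigma> * n\<^sup>2) r * fourier_coeff (G r) n)"
  define S where "S = (\<Sum>n\<in>A. (norm (y n))\<^sup>2)"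
  have mG: "G r \<in> borel_measurable borel" for r
    by measurable
  have Va': "(\<integral>\<^sup>+p. (ennreal (V (fst p) (snd p)))\<^sup>2 \<partial>?P) \<le> ennreal a"
    using Va by (subst segm.nn_integral_fst[symmetric]) (auto simp: ennreal_power nn)
  have Wb': "(\<integral>\<^sup>+p. (ennreal (W (fst p) (snd p))) ^ 4 \<partial>?P) \<le> ennreal b"
    using Wb by (subst segm.nn_integral_fst[symmetric]) (auto simp: ennreal_power nn)
  have key: "(\<integral>\<^sup>+p. ennreal (norm (G (fst p) (snd p)) * norm (U p)) \<partial>?P) ^ 4
      \<le> ennreal (a\<^sup>2 * b * c)"
    if [measurable]: "U \<in> borel_measurable (borel \<Otimes>\<^sub>M borel)"
      and U: "(\<integral>\<^sup>+p. (ennreal (norm (U p))) ^ 4 \<partial>?P) \<le> ennreal c" "c \<ge> 0" for U :: "_ \<Rightarrow> complex" and c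
  proof -
    have "(\<integral>\<^sup>+p. ennreal (norm (G (fst p) (snd p)) * norm (U p)) \<partial>?P)
      \<le> (\<integral>\<^sup>+p. ennreal (V (fst p) (snd p)) * (ennreal (W (fst p) (snd p)) * ennreal (norm (U p))) \<partial>?P)"
      using le nn by (intro nn_integral_mono)
        (simp flip: ennreal_mult mult.assoc, intro ennreal_leI mult_right_mono, auto)
    then have "(\<integral>\<^sup>+p. ennreal (norm (G (fst p) (snd p)) * norm (U p)) \<partial>?P) ^ 4 \<le>
      (\<integral>\<^sup>+p. ennreal (V (fst p) (snd p)) * (ennreal (W (fst p) (snd p)) * ennreal (norm (U p))) \<partial>?P) ^ 4"
      by (intro power_mono) auto
    also have "\<dots> \<le> (\<integral>\<^sup>+p. (ennreal (V (fst p) (snd p)))\<^sup>2 \<partial>?P)\<^sup>2 * ((\<integral>\<^sup>+p. (ennreal (W (fst p) (snd p))) ^ 4 \<partial>?P) *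
       (\<integral>\<^sup>+p. (ennreal (norm (U p))) ^ 4 \<partial>?P))"
      by (rule nn_integral_product_power4) simp_all
    also have "\<dots> \<le> (ennreal a)\<^sup>2 * (ennreal b * ennreal c)"
      by (intro mult_mono power_mono Va' Wb' U) auto
    also have "\<dots> = ennreal (a\<^sup>2 * b * c)"
      using ab U by (simp add: ennreal_mult ennreal_power mult.assoc)
    finally show ?thesis .
  qed
  \<comment> \<open>Integrability of \<open>G\<close> comes from the same Hoelder bound
    \<open>key\<close>, tested against the constant 1 on a finite measure space.\<close>
  have intG: "integrable ?P (\<lambda>p. G (fst p) (snd p))"
  proof (rule integrableI_bounded)
    have "emeasure ?P (space ?P) = ennreal (t - s) * ennreal (2 * pi)"
      using segm.emeasure_pair_measure_Times[of UNIV "segm s t" UNIV 0 "2 * pi"]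
      by (simp add: space_pair_measure emeasure_segm)
    then have "(\<integral>\<^sup>+p. (ennreal (norm (1::complex))) ^ 4 \<partial>?P) \<le> ennreal (max 0 (t - s) * (2 * pi))"
      by (simp add: ennreal_mult ennreal_max_0)
    from key[OF _ this] have "(\<integral>\<^sup>+p. ennreal (norm (G (fst p) (snd p))) \<partial>?P) ^ 4 \<le> ennreal (a\<^sup>2 * b * (max 0 (t - s) * (2 * pi)))"
      by simp
    also have "\<dots> < \<infinity>" by simp
    finally show "(\<integral>\<^sup>+p. ennreal (norm (G (fst p) (snd p))) \<partial>?P) < \<infinity>"
      by (cases "(\<integral>\<^sup>+p. ennreal (norm (G (fst p) (snd p))) \<partial>?P) = \<infinity>") (auto simp: top_power_ennreal less_top)
  qed simp
  have intc: "integrable ?P (\<lambda>p. h p * G (fst p) (snd p))"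
    if [measurable]: "h \<in> borel_measurable (borel \<Otimes>\<^sub>M borel)" and "\<And>p. norm (h p) \<le> c" for h :: "_ \<Rightarrow> complex" and c
  proof (rule Bochner_Integration.integrable_bound[OF integrable_mult_right[OF intG, of "of_real c"]])
    have "norm (h p * G (fst p) (snd p)) \<le> norm (of_real c * G (fst p) (snd p))" for p
      using that(2)[of p] by (simp add: norm_mult mult_right_mono)
    then show "AE p in ?P. norm (h p * G (fst p) (snd p)) \<le> norm (of_real c * G (fst p) (snd p))" by simp
  qed simp
  have y: "y n = (LINT p|?P. (chr (\<sigma> * n\<^sup>2) (fst p) * chr (-n) (snd p)) * G (fst p) (snd p)) / (2 * pi)" for n
  proof -
    have "y n = (LINT r|segm s t. (LINT x|torus. (chr (\<sigma> * n\<^sup>2) r * chr (-n) x) * G r x) / (2 * pi))"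
    proof -
      have fc: "fourier_coeff (G r) n = (LINT x|torus. chr (-n) x * G r x) / (2 * pi)" for r
        by (simp add: fourier_coeff_eq[OF mG] mult.commute)
      show ?thesis unfolding y_def fc by (simp add: mult.assoc)
    qed
    also have "\<dots> = (LINT r|segm s t. (LINT x|torus. (chr (\<sigma> * n\<^sup>2) r * chr (-n) x) * G r x)) / (2 * pi)"
      by simp
    also have "(LINT r|segm s t. (LINT x|torus. (chr (\<sigma> * n\<^sup>2) r * chr (-n) x) * G r x)) =
      (LINT p|?P. (chr (\<sigma> * n\<^sup>2) (fst p) * chr (-n) (snd p)) * G (fst p) (snd p))"
      using segm2.integral_fst'[OF intc[of "\<lambda>p. chr (\<sigma> * n\<^sup>2) (fst p) * chr (-n) (snd p)" 1]]
      by (simp add: norm_mult)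
    finally show ?thesis .
  qed
  \<comment> \<open>The test function is the free wave whose coefficients are the numbers
    \<open>y n\<close> to be estimated, so that its pairing with \<open>G\<close> is
    \<open>2 pi S\<close>. Zygmund's bound controls its \<open>L\<^sup>4\<close> norm by
    \<open>S\<close> again, and the resulting inequality
    \<open>S\<^sup>4 \<le> 8 pi\<^sup>2 a\<^sup>2 b S\<^sup>2\<close> is divided by
    \<open>S\<^sup>2\<close>.\<close>
  define U where "U = (\<lambda>p. wave \<sigma> y A (fst p) (snd p))"
  have mU [measurable]: "U \<in> borel_measurable (borel \<Otimes>\<^sub>M borel)"
    unfolding U_def wave_def by measurable
  have "complex_of_real S = (\<Sum>n\<in>A. cnj (y n) * y n)"
    unfolding S_def of_real_sum complex_norm_square by (simp add: mult.commute)
  also have "\<dots> = (\<Sum>n\<in>A. cnj (y n) * (LINT p|?P. (chr (\<sigma> * n\<^sup>2) (fst p) * chr (-n) (snd p)) * G (fst p) (snd p)) / (2 * pi))"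
    unfolding times_divide_eq_right[symmetric] y[symmetric] ..
  also have "\<dots> = (\<Sum>n\<in>A. LINT p|?P. (cnj (y n) * (chr (\<sigma> * n\<^sup>2) (fst p) * chr (-n) (snd p))) * G (fst p) (snd p)) / (2 * pi)"
    unfolding sum_divide_distrib integral_mult_right_zero[symmetric] mult.assoc ..
  also have "(\<Sum>n\<in>A. LINT p|?P. (cnj (y n) * (chr (\<sigma> * n\<^sup>2) (fst p) * chr (-n) (snd p))) * G (fst p) (snd p))
    = (LINT p|?P. (\<Sum>n\<in>A. (cnj (y n) * (chr (\<sigma> * n\<^sup>2) (fst p) * chr (-n) (snd p))) * G (fst p) (snd p)))"
  proof (rule Bochner_Integration.integral_sum[symmetric])
    show "integrable ?P (\<lambda>p. (cnj (y n) * (chr (\<sigma> * n\<^sup>2) (fst p) * chr (-n) (snd p))) * G (fst p) (snd p))" for n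
      by (rule intc[where c = "norm (y n)"]) (simp_all add: norm_mult)
  qed
  also have "\<dots> = (LINT p|?P. cnj (U p) * G (fst p) (snd p))"
    by (simp add: U_def wave_def sum_distrib_left sum_distrib_right cnj_chr mult_ac)
  finally have Seq: "complex_of_real S = \<dots> / (2 * pi)" .
  have S0: "S \<ge> 0" by (simp add: S_def sum_nonneg)
  have "ennreal S = ennreal (norm (complex_of_real S))" using S0 by simp
  also have "\<dots> \<le> ennreal (norm (LINT p|?P. cnj (U p) * G (fst p) (snd p)))"
    unfolding Seq
  proof (rule ennreal_leI)
    have "norm (z / (2 * pi)) \<le> norm z" for z :: complex
    proof -
      have "norm z * 1 \<le> norm z * (2 * pi)" using pi_ge_two by (intro mult_left_mono) auto
      then show ?thesis by (simp add: norm_divide divide_le_eq norm_mult)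
    qed
    then show "norm ((LINT p|?P. cnj (U p) * G (fst p) (snd p)) / (2 * pi)) \<le> norm (LINT p|?P. cnj (U p) * G (fst p) (snd p))" .
  qed
  also have "\<dots> \<le> (\<integral>\<^sup>+p. ennreal (norm (cnj (U p) * G (fst p) (snd p))) \<partial>?P)"
  proof (rule integral_norm_bound_ennreal)
    show "integrable ?P (\<lambda>p. cnj (U p) * G (fst p) (snd p))"
    proof (rule intc[where c = "\<Sum>n\<in>A. norm (y n)"])
      show "(\<lambda>p. cnj (U p)) \<in> borel_measurable (borel \<Otimes>\<^sub>M borel)" by measurable
      show "norm (cnj (U p)) \<le> (\<Sum>n\<in>A. norm (y n))" for p
        unfolding U_def complex_mod_cnj by (rule norm_wave_le)
    qed
  qed
  also have "\<dots> = (\<integral>\<^sup>+p. ennreal (norm (G (fst p) (snd p)) * norm (U p)) \<partial>?P)"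
    by (simp add: norm_mult mult.commute)
  finally have "ennreal S ^ 4 \<le> (\<integral>\<^sup>+p. ennreal (norm (G (fst p) (snd p)) * norm (U p)) \<partial>?P) ^ 4"
    by (intro power_mono) auto
  also have "\<dots> \<le> ennreal (a\<^sup>2 * b * (8 * pi\<^sup>2 * S\<^sup>2))"
  proof (rule key[OF mU])
    have "(\<integral>\<^sup>+p. (ennreal (norm (U p))) ^ 4 \<partial>?P) = (\<integral>\<^sup>+r. \<integral>\<^sup>+x. ennreal (norm (wave \<sigma> y A r x) ^ 4) \<partial>torus \<partial>segm s t)"
      by (subst segm.nn_integral_fst[symmetric]) (auto simp: ennreal_power U_def)
    also have "\<dots> \<le> ennreal (8 * pi\<^sup>2 * S\<^sup>2)" unfolding S_def by (rule zygmund[OF A \<sigma> st])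
    finally show "(\<integral>\<^sup>+p. (ennreal (norm (U p))) ^ 4 \<partial>?P) \<le> ennreal (8 * pi\<^sup>2 * S\<^sup>2)" .
  qed simp
  finally have "S ^ 4 \<le> a\<^sup>2 * b * (8 * pi\<^sup>2 * S\<^sup>2)"
    using ab S0 by (simp add: ennreal_power ennreal_le_iff)
  then have "S\<^sup>2 * S\<^sup>2 \<le> (8 * pi\<^sup>2 * (a\<^sup>2 * b)) * S\<^sup>2" by (simp add: mult_ac flip: power_add)
  then have "S\<^sup>2 \<le> 8 * pi\<^sup>2 * (a\<^sup>2 * b)"
    using ab S0 mult_right_le_imp_le[of "S\<^sup>2" "S\<^sup>2" "8 * pi\<^sup>2 * (a\<^sup>2 * b)"] by (cases "S = 0") auto
  then show ?thesis by (simp add: S_def y_def)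
qed

lemma power4_add_le: "(x + y) ^ 4 \<le> 8 * x ^ 4 + 8 * y ^ 4" for x y :: real
proof -
  have sq: "(u + v)\<^sup>2 \<le> 2 * u\<^sup>2 + 2 * v\<^sup>2" for u v :: real
    using norm_add_squared_le[of u v] by simp
  have "(x + y) ^ 4 = ((x + y)\<^sup>2)\<^sup>2" by simp
  also have "\<dots> \<le> (2 * x\<^sup>2 + 2 * y\<^sup>2)\<^sup>2" by (intro power_mono sq) auto
  also have "\<dots> \<le> 2 * (2 * x\<^sup>2)\<^sup>2 + 2 * (2 * y\<^sup>2)\<^sup>2" by (rule sq)
  finally show ?thesis by (simp add: power_mult_distrib flip: power_mult)
qed

text \<open>Splitting off one term at a time costs a factor 8 per split. The geometric weights are
  affordable in \<open>christ_kiselev\<close>, where the fourth powers of the pieces decay like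
  powers of 1/256.\<close>

lemma power4_sum_le:
  fixes a :: "nat \<Rightarrow> real"
  shows "(\<Sum>j\<le>J. a j) ^ 4 \<le> 8 * (\<Sum>j\<le>J. 8 ^ j * a j ^ 4)"
proof (induction J arbitrary: a)
  case 0
  have "0 \<le> a 0 ^ 4" by simp
  then show ?case by simp
next
  case (Suc J)
  have "(\<Sum>j\<le>Suc J. a j) ^ 4 = (a 0 + (\<Sum>j\<le>J. a (Suc j))) ^ 4"
    by (simp only: sum.atMost_Suc_shift)
  also have "\<dots> \<le> 8 * a 0 ^ 4 + 8 * (\<Sum>j\<le>J. a (Suc j)) ^ 4" by (rule power4_add_le)
  also have "\<dots> \<le> 8 * a 0 ^ 4 + 8 * (8 * (\<Sum>j\<le>J. 8 ^ j * a (Suc j) ^ 4))"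
    using Suc[of "\<lambda>j. a (Suc j)"] by simp
  also have "\<dots> = 8 * (\<Sum>j\<le>Suc J. 8 ^ j * a j ^ 4)"
    by (simp only: sum.atMost_Suc_shift) (simp add: sum_distrib_left mult.assoc)
  finally show ?case .
qed

lemma wave_sum: "wave \<sigma> (\<lambda>n. \<Sum>j\<in>I. a j n) A t x = (\<Sum>j\<in>I. wave \<sigma> (a j) A t x)"
  unfolding wave_def sum_distrib_right by (rule sum.swap)

lemma tendsto_power4_le:
  fixes f :: "nat \<Rightarrow> 'a::real_normed_vector"
  assumes le: "\<And>k. norm (f k - l) ^ 4 \<le> g k" and g: "g \<longlonglongrightarrow> 0"
  shows "f \<longlonglongrightarrow> l"
proof -
  have "(\<lambda>k. norm (f k - l) ^ 4) \<longlonglongrightarrow> 0"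
    by (rule tendsto_sandwich[OF _ _ tendsto_const g]) (simp_all add: le)
  from tendsto_real_sqrt[OF tendsto_real_sqrt[OF this]]
  have "(\<lambda>k. sqrt (sqrt (norm (f k - l) ^ 4))) \<longlonglongrightarrow> 0" by simp
  moreover have "sqrt (sqrt (u ^ 4)) = u" if "u \<ge> 0" for u :: real
  proof -
    have "sqrt (sqrt ((u\<^sup>2)\<^sup>2)) = u" using that by (simp only: real_sqrt_abs abs_power2 abs_of_nonneg)
    then show ?thesis by simp
  qed
  ultimately have "(\<lambda>k. norm (f k - l)) \<longlonglongrightarrow> 0" by simp
  then have "(\<lambda>k. f k - l) \<longlonglongrightarrow> 0" by (rule tendsto_norm_zero_cancel)
  then show ?thesis by (rule LIM_zero_cancel)
qed

text \<open>At each time \<iota> selects one of finitely many free waves. Bounding it by the sum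
  over all candidates costs the factor \<open>card I\<close> but removes the dependence of the
  coefficients on time, after which \<open>zygmund\<close> applies to each candidate.\<close>

lemma nn_integral_wave_step:
  fixes \<iota> :: "real \<Rightarrow> int"
  assumes A: "finite A" and \<sigma>: "\<sigma> \<noteq> 0" and ab: "\<beta> \<le> \<alpha> + 2 * pi"
    and \<iota>: "\<And>t. t \<in> {\<alpha>..\<beta>} \<Longrightarrow> \<iota> t \<in> I" and I: "finite I"
    and K: "\<And>i. i \<in> I \<Longrightarrow> (\<Sum>n\<in>A. (norm (g i n))\<^sup>2)\<^sup>2 \<le> K"
  shows "(\<integral>\<^sup>+t. \<integral>\<^sup>+x. ennreal (norm (wave \<sigma> (g (\<iota> t)) A t x) ^ 4) \<partial>torus \<partial>segm \<alpha> \<beta>)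
    \<le> ennreal (real (card I) * (8 * pi\<^sup>2 * K))"
proof -
  have "(\<integral>\<^sup>+t. \<integral>\<^sup>+x. ennreal (norm (wave \<sigma> (g (\<iota> t)) A t x) ^ 4) \<partial>torus \<partial>segm \<alpha> \<beta>)
    \<le> (\<integral>\<^sup>+t. (\<Sum>i\<in>I. \<integral>\<^sup>+x. ennreal (norm (wave \<sigma> (g i) A t x) ^ 4) \<partial>torus) \<partial>segm \<alpha> \<beta>)"
  proof (rule nn_integral_mono_AE)
    show "AE t in segm \<alpha> \<beta>. (\<integral>\<^sup>+x. ennreal (norm (wave \<sigma> (g (\<iota> t)) A t x) ^ 4) \<partial>torus)
      \<le> (\<Sum>i\<in>I. \<integral>\<^sup>+x. ennreal (norm (wave \<sigma> (g i) A t x) ^ 4) \<partial>torus)"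
      unfolding AE_segm
    proof (rule AE_I2, rule impI)
      fix t assume "t \<in> {\<alpha>..\<beta>}"
      from \<iota>[OF this] I show "(\<integral>\<^sup>+x. ennreal (norm (wave \<sigma> (g (\<iota> t)) A t x) ^ 4) \<partial>torus)
        \<le> (\<Sum>i\<in>I. \<integral>\<^sup>+x. ennreal (norm (wave \<sigma> (g i) A t x) ^ 4) \<partial>torus)"
        by (intro member_le_sum[where f = "\<lambda>i. \<integral>\<^sup>+x. ennreal (norm (wave \<sigma> (g i) A t x) ^ 4) \<partial>torus"]) auto
    qed
  qed
  also have "\<dots> = (\<Sum>i\<in>I. \<integral>\<^sup>+t. \<integral>\<^sup>+x. ennreal (norm (wave \<sigma> (g i) A t x) ^ 4) \<partial>torus \<partial>segm \<alpha> \<beta>)"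
    by (rule nn_integral_sum) measurable
  also have "\<dots> \<le> (\<Sum>i\<in>I. ennreal (8 * pi\<^sup>2 * K))"
  proof (rule sum_mono)
    fix i assume i: "i \<in> I"
    have "(\<integral>\<^sup>+t. \<integral>\<^sup>+x. ennreal (norm (wave \<sigma> (g i) A t x) ^ 4) \<partial>torus \<partial>segm \<alpha> \<beta>)
      \<le> ennreal (8 * pi\<^sup>2 * (\<Sum>n\<in>A. (norm (g i n))\<^sup>2)\<^sup>2)" by (rule zygmund[OF A \<sigma> ab])
    also have "\<dots> \<le> ennreal (8 * pi\<^sup>2 * K)" using K[OF i] by (intro ennreal_leI mult_left_mono) auto
    finally show "(\<integral>\<^sup>+t. \<integral>\<^sup>+x. ennreal (norm (wave \<sigma> (g i) A t x) ^ 4) \<partial>torus \<partial>segm \<alpha> \<beta>) \<le> ennreal (8 * pi\<^sup>2 * K)" .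
  qed
  also have "\<dots> = ennreal (real (card I) * (8 * pi\<^sup>2 * K))"
    by (simp add: ennreal_mult' ennreal_of_nat_eq_real_of_nat)
  finally show ?thesis .
qed

text \<open>
  The Christ--Kiselev argument. The curve \<open>y\<close> is approximated by step functions whose jumps sit
  at the points where the clock \<open>h\<close> reaches a multiple of \<open>16\<^sup>-\<^sup>j\<close>; passing from \<open>j\<close> to \<open>j + 1\<close> costs
  \<open>O(16\<^sup>j)\<close> free waves, each of fourth power \<open>O(16\<^sup>-\<^sup>3\<^sup>j)\<close>.
\<close>
lemma christ_kiselev:
  fixes h :: "real \<Rightarrow> real" and y :: "int \<Rightarrow> real \<Rightarrow> complex"
  assumes A: "finite A" and \<sigma>: "\<sigma> \<noteq> 0" and ab: "\<alpha> \<le> \<beta>" "\<beta> \<le> \<alpha> + 2 * pi"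
    and h: "mono h" "continuous_on {\<alpha>..\<beta>} h" "h \<alpha> = 0" "h \<beta> \<le> 1" and D: "D \<ge> 0"
    and inc: "\<And>s t. \<alpha> \<le> s \<Longrightarrow> s \<le> t \<Longrightarrow> t \<le> \<beta> \<Longrightarrow>
        (\<Sum>n\<in>A. (norm (y n t - y n s))\<^sup>2)\<^sup>2 \<le> D * (h t - h s) ^ 3"
    and y0: "\<And>n. n \<in> A \<Longrightarrow> y n \<alpha> = 0"
  shows "(\<integral>\<^sup>+t. \<integral>\<^sup>+x. ennreal (norm (wave \<sigma> (\<lambda>n. y n t) A t x) ^ 4) \<partial>torus \<partial>segm \<alpha> \<beta>)
    \<le> ennreal (2 ^ 20 * pi\<^sup>2 * D)"
proof -
  have h01: "0 \<le> h t" "h t \<le> h \<beta>" "h t \<le> 1" if "t \<in> {\<alpha>..\<beta>}" for t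
    using monoD[OF h(1), of \<alpha> t] monoD[OF h(1), of t \<beta>] h(3,4) that by auto
  have mh [measurable]: "h \<in> borel_measurable borel" using h(1) by (rule borel_measurable_mono)
  \<comment> \<open>\<open>H\<close> inverts the clock on its range, and \<open>z\<close> is the
    curve read in clock time, where the increment hypothesis becomes a uniform modulus of
    continuity.\<close>
  define H where "H = (\<lambda>s. SOME t. t \<in> {\<alpha>..\<beta>} \<and> h t = s)"
  have H: "H s \<in> {\<alpha>..\<beta>}" "h (H s) = s" if "0 \<le> s" "s \<le> h \<beta>" for s
  proof -
    have "\<exists>t. \<alpha> \<le> t \<and> t \<le> \<beta> \<and> h t = s" using that ab h by (intro IVT') auto
    then have "\<exists>t. t \<in> {\<alpha>..\<beta>} \<and> h t = s" by auto
    from someI_ex[OF this] show "H s \<in> {\<alpha>..\<beta>}" "h (H s) = s" by (simp_all add: H_def)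
  qed
  define z where "z = (\<lambda>s n. y n (H s))"
  have zinc: "(\<Sum>n\<in>A. (norm (z s' n - z s n))\<^sup>2)\<^sup>2 \<le> D * (s' - s) ^ 3"
    if "0 \<le> s" "s \<le> s'" "s' \<le> h \<beta>" for s s'
  proof (cases "s = s'")
    case False
    then have "H s \<le> H s'" using H[of s] H[of s'] that monoD[OF h(1), of "H s'" "H s"] by force
    then show ?thesis using inc[of "H s" "H s'"] H[of s] H[of s'] that by (simp add: z_def)
  qed simp
  \<comment> \<open>On a plateau of \<open>h\<close> the increment bound forces \<open>y\<close> to
    be constant, so it does not matter which preimage \<open>H\<close> selects.\<close>
  have zy: "z (h t) n = y n t" if t: "t \<in> {\<alpha>..\<beta>}" and n: "n \<in> A" for t n
  proof -
    have eq0: "y n u = y n v" if "\<alpha> \<le> u" "u \<le> v" "v \<le> \<beta>" "h u = h v" for u v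
    proof -
      have "(\<Sum>n\<in>A. (norm (y n v - y n u))\<^sup>2)\<^sup>2 \<le> 0" using inc[of u v] that by simp
      then have "(\<Sum>n\<in>A. (norm (y n v - y n u))\<^sup>2) = 0" by simp
      then have "(norm (y n v - y n u))\<^sup>2 = 0" using A n by (subst (asm) sum_nonneg_eq_0_iff) auto
      then show ?thesis by simp
    qed
    show ?thesis
      using eq0[of t "H (h t)"] eq0[of "H (h t)" t] H[of "h t"] h01[OF t] t unfolding z_def by fastforce
  qed
  have z0: "z 0 n = 0" if "n \<in> A" for n using zy[of \<alpha> n] that h ab y0 by simp
  \<comment> \<open>The cell number of the clock value at level \<open>j\<close>. Dividing by 16
    gives the parent cell, so \<open>e\<close> is the jump from the left end of the parent to the
    left end of the child, and the sum of the \<open>\<Delta>\<close> telescopes to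
    \<open>Y\<close>.\<close>
  define \<iota> where "\<iota> = (\<lambda>j t. \<lfloor>16 ^ j * h t\<rfloor>)"
  define w where "w = (\<lambda>(j::nat) (i::int). z (of_int i / 16 ^ j))"
  define Y where "Y = (\<lambda>j t. w j (\<iota> j t))"
  define e where "e = (\<lambda>j i n. w (Suc j) i n - w j (i div 16) n)"
  define \<Delta> where "\<Delta> = (\<lambda>j t. case j of 0 \<Rightarrow> Y 0 t | Suc k \<Rightarrow> e k (\<iota> (Suc k) t))"
  have \<iota>Suc: "\<iota> (Suc j) t div 16 = \<iota> j t" for j t
  proof -
    have "\<lfloor>(16 ^ Suc j * h t) / real_of_int 16\<rfloor> = \<lfloor>16 ^ Suc j * h t\<rfloor> div 16"
      by (rule floor_divide_real_eq_div) simp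
    then show ?thesis by (simp add: \<iota>_def)
  qed
  have \<Delta>sum: "(\<Sum>j\<le>J. \<Delta> j t n) = Y J t n" for J t n
    by (induction J) (simp_all add: \<Delta>_def e_def Y_def \<iota>Suc)
  have \<iota>r: "\<iota> j t \<ge> 0" "\<iota> j t \<le> 16 ^ j" "of_int (\<iota> j t) / 16 ^ j \<le> h t" "h t \<le> (of_int (\<iota> j t) + 1) / 16 ^ j"
    if "t \<in> {\<alpha>..\<beta>}" for t j
  proof -
    show "\<iota> j t \<ge> 0" using h01[OF that] by (simp add: \<iota>_def)
    have "16 ^ j * h t \<le> 16 ^ j" using h01[OF that] by (intro mult_left_le) auto
    then have "\<lfloor>16 ^ j * h t\<rfloor> \<le> \<lfloor>(16::real) ^ j\<rfloor>" by (rule floor_mono)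
    also have "\<lfloor>(16::real) ^ j\<rfloor> = 16 ^ j" by (metis floor_of_int of_int_numeral of_int_power)
    finally show "\<iota> j t \<le> 16 ^ j" by (simp add: \<iota>_def)
    show "of_int (\<iota> j t) / 16 ^ j \<le> h t" using of_int_floor_le[of "16 ^ j * h t"]
      by (simp add: \<iota>_def divide_le_eq mult.commute)
    show "h t \<le> (of_int (\<iota> j t) + 1) / 16 ^ j"
      using real_of_int_floor_add_one_ge[of "16 ^ j * h t"] by (simp add: \<iota>_def le_divide_eq mult.commute)
  qed
  \<comment> \<open>For \<open>j = k + 1\<close> there are at most
    \<open>16^j + 1 \<le> 17 * 16^k\<close> cells, each with a squared mass of jumps whose square is
    at most \<open>D * (1/16^k)^3\<close>. With Zygmund's constant this gives
    \<open>136 * pi\<^sup>2 * D * (1/256)^k\<close>; passing from \<open>k\<close> to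
    \<open>j\<close> multiplies by 256, and 34816 = 136 * 256. Summation with the weights
    \<open>8 * 8^j\<close> gives a series of ratio 1/32, at most \<open>16 * K\<close> in all, which
    is below \<open>2^20 * pi\<^sup>2 * D\<close>.\<close>
  define K where "K = 34816 * pi\<^sup>2 * D"
  have K0: "K \<ge> 0" using D by (simp add: K_def)
  have \<Delta>bound: "(\<integral>\<^sup>+t. \<integral>\<^sup>+x. ennreal (norm (wave \<sigma> (\<Delta> j t) A t x) ^ 4) \<partial>torus \<partial>segm \<alpha> \<beta>)
    \<le> ennreal (K * (1 / 256) ^ j)" for j
  proof (cases j)
    case 0
    define I where "I = {i::int. 0 \<le> i \<and> i \<le> 1 \<and> of_int i \<le> h \<beta>}"
    have sub: "I \<subseteq> {0, 1}" by (auto simp: I_def)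
    then have fin: "finite I" and card: "card I \<le> 2"
      using finite_subset[OF sub] card_mono[OF _ sub] by auto
    have "(\<integral>\<^sup>+t. \<integral>\<^sup>+x. ennreal (norm (wave \<sigma> (w 0 (\<iota> 0 t)) A t x) ^ 4) \<partial>torus \<partial>segm \<alpha> \<beta>)
      \<le> ennreal (real (card I) * (8 * pi\<^sup>2 * D))"
    proof (rule nn_integral_wave_step[OF A \<sigma> ab(2) _ fin])
      show "\<iota> 0 t \<in> I" if "t \<in> {\<alpha>..\<beta>}" for t
        using \<iota>r[OF that, of 0] h01[OF that] by (auto simp: I_def)
      fix i assume i: "i \<in> I"
      have "(\<Sum>n\<in>A. (norm (z (of_int i) n - z 0 n))\<^sup>2)\<^sup>2 \<le> D * (of_int i - 0) ^ 3"
        using i by (intro zinc) (auto simp: I_def)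
      also have "\<dots> \<le> D * 1" using i D by (intro mult_left_mono) (auto simp: I_def power_le_one)
      finally show "(\<Sum>n\<in>A. (norm (w 0 i n))\<^sup>2)\<^sup>2 \<le> D" by (simp add: w_def z0 cong: sum.cong)
    qed
    also have "\<dots> \<le> ennreal (K * (1 / 256) ^ j)"
    proof (rule ennreal_leI)
      have "real (card I) * (8 * pi\<^sup>2 * D) \<le> 34816 * (pi\<^sup>2 * D)"
        using card D mult_right_mono[of "real (card I)" 2 "8 * pi\<^sup>2 * D"] by simp
      then show "real (card I) * (8 * pi\<^sup>2 * D) \<le> K * (1 / 256) ^ j" by (simp add: 0 K_def)
    qed
    finally show ?thesis by (simp add: \<Delta>_def Y_def 0)
  next
    case (Suc k)
    define I where "I = {i::int. 0 \<le> i \<and> i \<le> 16 ^ j \<and> of_int i / 16 ^ j \<le> h \<beta>}"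
    have sub: "I \<subseteq> {0..16 ^ j}" by (auto simp: I_def)
    have fin: "finite I" using finite_subset[OF sub] by simp
    have "card I \<le> card {0..(16::int) ^ j}" by (rule card_mono[OF _ sub]) simp
    also have "\<dots> = 16 ^ j + 1" by (simp add: nat_add_distrib nat_power_eq)
    also have "\<dots> \<le> 17 * 16 ^ k" by (simp add: Suc)
    finally have card: "real (card I) \<le> 17 * 16 ^ k"
      by (metis of_nat_le_iff of_nat_mult of_nat_numeral of_nat_power)
    have "(\<integral>\<^sup>+t. \<integral>\<^sup>+x. ennreal (norm (wave \<sigma> (e k (\<iota> j t)) A t x) ^ 4) \<partial>torus \<partial>segm \<alpha> \<beta>)
      \<le> ennreal (real (card I) * (8 * pi\<^sup>2 * (D * (1 / 16 ^ k) ^ 3)))"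
    proof (rule nn_integral_wave_step[OF A \<sigma> ab(2) _ fin])
      show "\<iota> j t \<in> I" if "t \<in> {\<alpha>..\<beta>}" for t
        using \<iota>r[OF that, of j] h01[OF that] by (auto simp: I_def)
      fix i assume i: "i \<in> I"
      have split: "(of_int i :: real) = 16 * of_int (i div 16) + of_int (i mod 16)"
        by (metis mult_div_mod_eq of_int_add of_int_mult of_int_numeral)
      have m: "0 \<le> (of_int (i mod 16) :: real)" "(of_int (i mod 16) :: real) \<le> 16"
        using pos_mod_bound[of 16 i] by (auto simp: less_imp_le)
      have diff: "of_int i / 16 ^ Suc k - of_int (i div 16) / 16 ^ k = (of_int (i mod 16) :: real) / 16 ^ Suc k"
        by (simp add: split field_simps)
      have "(\<Sum>n\<in>A. (norm (z (of_int i / 16 ^ Suc k) n - z (of_int (i div 16) / 16 ^ k) n))\<^sup>2)\<^sup>2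
        \<le> D * (of_int i / 16 ^ Suc k - of_int (i div 16) / 16 ^ k) ^ 3"
      proof (rule zinc)
        show "(of_int (i div 16) :: real) / 16 ^ k \<le> of_int i / 16 ^ Suc k"
        proof -
          have "0 \<le> (of_int (i mod 16) :: real) / 16 ^ Suc k" using m by (intro divide_nonneg_nonneg) auto
          with diff show ?thesis by linarith
        qed
      qed (use i in \<open>auto simp: I_def Suc pos_imp_zdiv_nonneg_iff\<close>)
      also have "\<dots> \<le> D * (1 / 16 ^ k) ^ 3"
        unfolding diff using m D by (intro mult_left_mono power_mono) (auto simp: field_simps)
      finally show "(\<Sum>n\<in>A. (norm (e k i n))\<^sup>2)\<^sup>2 \<le> D * (1 / 16 ^ k) ^ 3"
        by (simp add: e_def w_def)
    qed
    also have "\<dots> \<le> ennreal (K * (1 / 256) ^ j)"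
    proof (rule ennreal_leI)
      have "real (card I) * (8 * pi\<^sup>2 * (D * (1 / 16 ^ k) ^ 3)) \<le> (17 * 16 ^ k) * (8 * pi\<^sup>2 * (D * (1 / 16 ^ k) ^ 3))"
        using D by (intro mult_right_mono card) auto
      also have "\<dots> = (136 * pi\<^sup>2 * D) * (16 ^ k * (1 / 16 ^ k) ^ 3)" by simp
      also have "(16::real) ^ k * (1 / 16 ^ k) ^ 3 = (1 / 256) ^ k"
        by (simp add: power3_eq_cube field_simps flip: power_mult_distrib)
      also have "(136 * pi\<^sup>2 * D) * (1 / 256) ^ k = K * (1 / 256) ^ j" by (simp add: Suc K_def)
      finally show "real (card I) * (8 * pi\<^sup>2 * (D * (1 / 16 ^ k) ^ 3)) \<le> K * (1 / 256) ^ j" .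
    qed
    finally show ?thesis by (simp add: \<Delta>_def Suc)
  qed
  have comp: "(\<lambda>t. f (\<iota> j t)) \<in> borel_measurable borel" for f :: "int \<Rightarrow> complex" and j
  proof -
    have "\<iota> j \<in> measurable borel (count_space UNIV)" unfolding \<iota>_def by measurable
    from measurable_compose[OF this, of f borel] show ?thesis by simp
  qed
  have [measurable]: "(\<lambda>t. Y j t n) \<in> borel_measurable borel" "(\<lambda>t. \<Delta> j t n) \<in> borel_measurable borel" for j n
    unfolding Y_def \<Delta>_def using comp[where f = "\<lambda>i. w j i n"] comp[where f = "\<lambda>i. w 0 i n"]
      comp[where f = "\<lambda>i. e _ i n"] by (cases j; simp)+
  have [measurable]: "(\<lambda>(t, x). wave \<sigma> (Y j t) A t x) \<in> borel_measurable (borel \<Otimes>\<^sub>M borel)"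
     "(\<lambda>(t, x). wave \<sigma> (\<Delta> j t) A t x) \<in> borel_measurable (borel \<Otimes>\<^sub>M borel)" for j
    unfolding wave_def by measurable
  have Jbound: "(\<integral>\<^sup>+t. \<integral>\<^sup>+x. ennreal (norm (wave \<sigma> (Y J t) A t x) ^ 4) \<partial>torus \<partial>segm \<alpha> \<beta>)
    \<le> ennreal (2 ^ 20 * pi\<^sup>2 * D)" for J
  proof -
    have pw: "ennreal (norm (wave \<sigma> (Y J t) A t x) ^ 4)
       \<le> (\<Sum>j\<le>J. ennreal (8 * 8 ^ j) * ennreal (norm (wave \<sigma> (\<Delta> j t) A t x) ^ 4))" for t x
    proof -
      have "Y J t = (\<lambda>n. \<Sum>j\<le>J. \<Delta> j t n)" using \<Delta>sum by auto
      then have "norm (wave \<sigma> (Y J t) A t x) ^ 4 = norm (\<Sum>j\<le>J. wave \<sigma> (\<Delta> j t) A t x) ^ 4"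
        by (simp only: wave_sum)
      also have "\<dots> \<le> (\<Sum>j\<le>J. norm (wave \<sigma> (\<Delta> j t) A t x)) ^ 4" by (intro power_mono norm_sum) auto
      also have "\<dots> \<le> 8 * (\<Sum>j\<le>J. 8 ^ j * norm (wave \<sigma> (\<Delta> j t) A t x) ^ 4)" by (rule power4_sum_le)
      also have "\<dots> = (\<Sum>j\<le>J. (8 * 8 ^ j) * norm (wave \<sigma> (\<Delta> j t) A t x) ^ 4)"
        by (simp add: sum_distrib_left mult.assoc)
      finally have "ennreal (norm (wave \<sigma> (Y J t) A t x) ^ 4) \<le> ennreal \<dots>" by (rule ennreal_leI)
      also have "\<dots> = (\<Sum>j\<le>J. ennreal (8 * 8 ^ j) * ennreal (norm (wave \<sigma> (\<Delta> j t) A t x) ^ 4))"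
        by (subst sum_ennreal[symmetric]) (auto simp: ennreal_mult)
      finally show ?thesis .
    qed
    have "(\<integral>\<^sup>+t. \<integral>\<^sup>+x. ennreal (norm (wave \<sigma> (Y J t) A t x) ^ 4) \<partial>torus \<partial>segm \<alpha> \<beta>)
      \<le> (\<integral>\<^sup>+t. \<integral>\<^sup>+x. (\<Sum>j\<le>J. ennreal (8 * 8 ^ j) * ennreal (norm (wave \<sigma> (\<Delta> j t) A t x) ^ 4)) \<partial>torus \<partial>segm \<alpha> \<beta>)"
      by (intro nn_integral_mono pw)
    also have "\<dots> = (\<integral>\<^sup>+t. (\<Sum>j\<le>J. ennreal (8 * 8 ^ j) * (\<integral>\<^sup>+x. ennreal (norm (wave \<sigma> (\<Delta> j t) A t x) ^ 4) \<partial>torus)) \<partial>segm \<alpha> \<beta>)"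
    proof (rule nn_integral_cong)
      fix t
      have [measurable]: "wave \<sigma> (\<Delta> j t) A t \<in> borel_measurable borel" for j by (rule wave_measurable1)
      show "(\<integral>\<^sup>+x. (\<Sum>j\<le>J. ennreal (8 * 8 ^ j) * ennreal (norm (wave \<sigma> (\<Delta> j t) A t x) ^ 4)) \<partial>torus)
        = (\<Sum>j\<le>J. ennreal (8 * 8 ^ j) * (\<integral>\<^sup>+x. ennreal (norm (wave \<sigma> (\<Delta> j t) A t x) ^ 4) \<partial>torus))"
        by (subst nn_integral_sum) (auto simp: nn_integral_cmult)
    qed
    also have "\<dots> = (\<Sum>j\<le>J. ennreal (8 * 8 ^ j) * (\<integral>\<^sup>+t. \<integral>\<^sup>+x. ennreal (norm (wave \<sigma> (\<Delta> j t) A t x) ^ 4) \<partial>torus \<partial>segm \<alpha> \<beta>))"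
      by (subst nn_integral_sum, measurable, subst nn_integral_cmult, measurable)
    also have "\<dots> \<le> (\<Sum>j\<le>J. ennreal (8 * 8 ^ j) * ennreal (K * (1 / 256) ^ j))"
      by (intro sum_mono mult_left_mono \<Delta>bound) auto
    also have "\<dots> = ennreal (\<Sum>j\<le>J. 8 * K * (1 / 32) ^ j)"
    proof -
      have eq: "8 * K * (1 / 32) ^ j = (8::real) * 8 ^ j * (K * (1 / 256) ^ j)" for j
        by (simp add: power_divide field_simps flip: power_mult_distrib)
      show ?thesis unfolding eq using K0 by (simp flip: ennreal_mult)
    qed
    also have "\<dots> \<le> ennreal (2 ^ 20 * pi\<^sup>2 * D)"
    proof (rule ennreal_leI)
      have "(\<Sum>j\<le>J. (1 / 32 :: real) ^ j) \<le> 2"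
      proof -
        define q :: real where "q = (1 / 32) ^ Suc J"
        have "0 \<le> q" by (simp add: q_def)
        moreover have "(\<Sum>j\<le>J. (1 / 32 :: real) ^ j) = (1 - q) / (1 - 1 / 32)"
          unfolding q_def by (subst sum_gp0) simp
        ultimately show ?thesis by simp
      qed
      then have "8 * K * (\<Sum>j\<le>J. (1 / 32 :: real) ^ j) \<le> 8 * K * 2" using K0 by (intro mult_left_mono) auto
      also have "8 * K * 2 \<le> 2 ^ 20 * pi\<^sup>2 * D" using D by (simp add: K_def mult_right_mono)
      finally show "(\<Sum>j\<le>J. 8 * K * (1 / 32) ^ j) \<le> 2 ^ 20 * pi\<^sup>2 * D" by (simp add: sum_distrib_left)
    qed
    finally show ?thesis .
  qed
  have conv: "(\<lambda>j. Y j t n) \<longlonglongrightarrow> y n t" if t: "t \<in> {\<alpha>..\<beta>}" and n: "n \<in> A" for t n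
  proof -
    have le: "norm (Y j t n - y n t) ^ 4 \<le> D * (1 / 4096) ^ j" for j
    proof -
      have "norm (Y j t n - y n t) ^ 4 = ((norm (z (h t) n - z (of_int (\<iota> j t) / 16 ^ j) n))\<^sup>2)\<^sup>2"
        using zy[OF t n] by (simp add: Y_def w_def norm_minus_commute)
      also have "\<dots> \<le> (\<Sum>n\<in>A. (norm (z (h t) n - z (of_int (\<iota> j t) / 16 ^ j) n))\<^sup>2)\<^sup>2"
        using A n by (intro power_mono member_le_sum[where f = "\<lambda>n. (norm (z (h t) n - z (of_int (\<iota> j t) / 16 ^ j) n))\<^sup>2"]) auto
      also have "\<dots> \<le> D * (h t - of_int (\<iota> j t) / 16 ^ j) ^ 3"
        using \<iota>r[OF t, of j] h01[OF t] by (intro zinc) auto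
      also have "\<dots> \<le> D * (1 / 16 ^ j) ^ 3"
        using \<iota>r[OF t, of j] D by (intro mult_left_mono power_mono) (auto simp: add_divide_distrib)
      also have "(1 / 16 ^ j) ^ 3 = (1 / 4096 :: real) ^ j"
        by (simp add: power_divide flip: power_mult) (simp add: power_mult mult.commute[of j 3])
      finally show ?thesis .
    qed
    have "(\<lambda>j. D * (1 / 4096) ^ j) \<longlonglongrightarrow> D * 0"
      by (intro tendsto_intros LIMSEQ_power_zero) simp
    then show ?thesis by (intro tendsto_power4_le[OF le]) simp
  qed
  have "(\<integral>\<^sup>+t. \<integral>\<^sup>+x. ennreal (norm (wave \<sigma> (\<lambda>n. y n t) A t x) ^ 4) \<partial>torus \<partial>segm \<alpha> \<beta>)
    \<le> (\<integral>\<^sup>+t. liminf (\<lambda>J. \<integral>\<^sup>+x. ennreal (norm (wave \<sigma> (Y J t) A t x) ^ 4) \<partial>torus) \<partial>segm \<alpha> \<beta>)"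
  proof (rule nn_integral_mono_AE, unfold AE_segm, rule AE_I2, rule impI)
    fix t assume t: "t \<in> {\<alpha>..\<beta>}"
    have "(\<integral>\<^sup>+x. ennreal (norm (wave \<sigma> (\<lambda>n. y n t) A t x) ^ 4) \<partial>torus)
      = (\<integral>\<^sup>+x. liminf (\<lambda>J. ennreal (norm (wave \<sigma> (Y J t) A t x) ^ 4)) \<partial>torus)"
    proof (rule nn_integral_cong)
      fix x
      have "(\<lambda>J. ennreal (norm (wave \<sigma> (Y J t) A t x) ^ 4)) \<longlonglongrightarrow> ennreal (norm (wave \<sigma> (\<lambda>n. y n t) A t x) ^ 4)"
        unfolding wave_def by (intro tendsto_intros tendsto_ennrealI conv t)
      from lim_imp_Liminf[OF _ this] show "ennreal (norm (wave \<sigma> (\<lambda>n. y n t) A t x) ^ 4) =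
         liminf (\<lambda>J. ennreal (norm (wave \<sigma> (Y J t) A t x) ^ 4))" by simp
    qed
    also have "\<dots> \<le> liminf (\<lambda>J. \<integral>\<^sup>+x. ennreal (norm (wave \<sigma> (Y J t) A t x) ^ 4) \<partial>torus)"
    proof (rule nn_integral_liminf)
      fix J
      have [measurable]: "wave \<sigma> (Y J t) A t \<in> borel_measurable borel" by (rule wave_measurable1)
      show "(\<lambda>x. ennreal (norm (wave \<sigma> (Y J t) A t x) ^ 4)) \<in> borel_measurable torus" by measurable
    qed
    finally show "(\<integral>\<^sup>+x. ennreal (norm (wave \<sigma> (\<lambda>n. y n t) A t x) ^ 4) \<partial>torus)
      \<le> liminf (\<lambda>J. \<integral>\<^sup>+x. ennreal (norm (wave \<sigma> (Y J t) A t x) ^ 4) \<partial>torus)" .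
  qed
  also have "\<dots> \<le> liminf (\<lambda>J. \<integral>\<^sup>+t. \<integral>\<^sup>+x. ennreal (norm (wave \<sigma> (Y J t) A t x) ^ 4) \<partial>torus \<partial>segm \<alpha> \<beta>)"
    by (rule nn_integral_liminf) measurable
  also have "\<dots> \<le> liminf (\<lambda>J::nat. ennreal (2 ^ 20 * pi\<^sup>2 * D))"
    by (intro Liminf_mono always_eventually allI Jbound)
  also have "\<dots> = ennreal (2 ^ 20 * pi\<^sup>2 * D)" by (simp add: Liminf_const)
  finally show ?thesis .
qed

section \<open>The cubic term on absolutely summable sequences\<close>

abbreviation ints :: "int measure" where "ints \<equiv> count_space UNIV"
abbreviation int_pairs :: "(int \<times> int) measure" where "int_pairs \<equiv> count_space UNIV"

lemma ennreal_norm_integral_le: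
  fixes f :: "'a \<Rightarrow> 'b::{banach, second_countable_topology}"
  shows "ennreal (norm (integral\<^sup>L M f)) \<le> (\<integral>\<^sup>+x. ennreal (norm (f x)) \<partial>M)"
  by (cases "integrable M f") (auto simp: integral_norm_bound_ennreal not_integrable_integral_eq)

lemma integral_count_space_swap:
  fixes f :: "'i::countable \<Rightarrow> 'a \<Rightarrow> 'b::{banach, second_countable_topology}"
  assumes M: "sigma_finite_measure M" and [measurable]: "\<And>i. f i \<in> borel_measurable M"
    and fin: "(\<integral>\<^sup>+i. \<integral>\<^sup>+x. ennreal (norm (f i x)) \<partial>M \<partial>count_space UNIV) < \<infinity>"
  shows "(LINT x|M. LINT i|count_space UNIV. f i x) = (LINT i|count_space UNIV. LINT x|M. f i x)"
    and "integrable M (\<lambda>x. LINT i|count_space UNIV. f i x)"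
    and "integrable (count_space UNIV) (\<lambda>i. LINT x|M. f i x)"
proof -
  interpret M: sigma_finite_measure M by fact
  interpret C: sigma_finite_measure "count_space (UNIV :: 'i set)" by (rule sigma_finite_measure_count_space)
  interpret P: pair_sigma_finite "count_space (UNIV :: 'i set)" M ..
  have m [measurable]: "(\<lambda>(i, x). f i x) \<in> borel_measurable (count_space UNIV \<Otimes>\<^sub>M M)"
    by (rule measurable_pair_measure_countable1) auto
  have I: "integrable (count_space UNIV \<Otimes>\<^sub>M M) (\<lambda>(i, x). f i x)"
  proof (rule integrableI_bounded)
    show "(\<integral>\<^sup>+z. ennreal (norm (case z of (i, x) \<Rightarrow> f i x)) \<partial>(count_space UNIV \<Otimes>\<^sub>M M)) < \<infinity>"
      using fin by (subst M.nn_integral_fst[symmetric]) auto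
  qed fact
  show "(LINT x|M. LINT i|count_space UNIV. f i x) = (LINT i|count_space UNIV. LINT x|M. f i x)"
    by (rule P.Fubini_integral[OF I])
  show "integrable M (\<lambda>x. LINT i|count_space UNIV. f i x)" by (rule P.integrable_snd[OF I])
  show "integrable (count_space UNIV) (\<lambda>i. LINT x|M. f i x)" by (rule P.integrable_fst[OF I])
qed

lemma borel_measurable_count_space_swap:
  fixes f :: "'i::countable \<Rightarrow> 'a \<Rightarrow> 'b::topological_space"
  assumes "\<And>i. f i \<in> borel_measurable M"
  shows "(\<lambda>(x, i). f i x) \<in> borel_measurable (M \<Otimes>\<^sub>M count_space UNIV)"
proof -
  have "(\<lambda>(i, x). f i x) \<in> borel_measurable (count_space UNIV \<Otimes>\<^sub>M M)"
    by (rule measurable_pair_measure_countable1) (use assms in auto)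
  then show ?thesis
    by (subst measurable_pair_swap_iff) (simp add: case_prod_unfold)
qed

lemma borel_measurable_integral_count_space:
  fixes f :: "'i::countable \<Rightarrow> 'a \<Rightarrow> 'b::{banach, second_countable_topology}"
  assumes "\<And>i. f i \<in> borel_measurable M"
  shows "(\<lambda>x. LINT i|count_space UNIV. f i x) \<in> borel_measurable M"
  by (intro sigma_finite_measure.borel_measurable_lebesgue_integral sigma_finite_measure_count_space
      borel_measurable_count_space_swap assms)

lemma borel_measurable_nn_integral_count_space:
  fixes f :: "'i::countable \<Rightarrow> 'a \<Rightarrow> ennreal"
  assumes "\<And>i. f i \<in> borel_measurable M"
  shows "(\<lambda>x. \<integral>\<^sup>+i. f i x \<partial>count_space UNIV) \<in> borel_measurable M"
  by (intro sigma_finite_measure.borel_measurable_nn_integral sigma_finite_measure_count_space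
      borel_measurable_count_space_swap assms)

lemma nn_integral_ints_le:
  fixes f :: "int \<Rightarrow> ennreal"
  assumes "\<And>A. finite A \<Longrightarrow> sum f A \<le> C"
  shows "(\<integral>\<^sup>+n. f n \<partial>ints) \<le> C"
proof -
  have "(\<integral>\<^sup>+n. f n \<partial>ints) = (\<integral>\<^sup>+k. f (int_decode k) \<partial>count_space UNIV)"
    by (rule nn_integral_bij_count_space[symmetric, OF bij_int_decode])
  also have "\<dots> = (\<Sum>k. f (int_decode k))" by (rule nn_integral_count_space_nat)
  also have "\<dots> = (SUP k. \<Sum>i<k. f (int_decode i))" by (rule suminf_eq_SUP)
  also have "\<dots> \<le> C"
  proof (rule SUP_least)
    fix k
    have "(\<Sum>i<k. f (int_decode i)) = sum f (int_decode ` {..<k})"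
      by (subst sum.reindex) (use bij_int_decode in \<open>auto simp: bij_def intro: inj_on_subset\<close>)
    then show "(\<Sum>i<k. f (int_decode i)) \<le> C" using assms[of "int_decode ` {..<k}"] by simp
  qed
  finally show ?thesis .
qed

lemma sum_le_nn_integral_count_space:
  "finite A \<Longrightarrow> sum f A \<le> (\<integral>\<^sup>+n. f n \<partial>count_space UNIV)" for f :: "'a \<Rightarrow> ennreal"
proof -
  assume A: "finite A"
  have "sum f A = (\<integral>\<^sup>+n. f n * indicator A n \<partial>count_space UNIV)"
    using A by (subst nn_integral_count_space'[of A]) (auto intro!: sum.cong)
  also have "\<dots> \<le> (\<integral>\<^sup>+n. f n \<partial>count_space UNIV)"
    by (intro nn_integral_mono) (auto split: split_indicator)
  finally show ?thesis .
qed

text \<open>Extended-valued and an integral over counting measure: Tonelli is then available, and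
  the norm makes sense before anything is known to be summable.\<close>

definition ell1 :: "(int \<Rightarrow> complex) \<Rightarrow> ennreal" where
  "ell1 a = (\<integral>\<^sup>+n. ennreal (norm (a n)) \<partial>ints)"

lemma ell1_leI:
  assumes "\<And>A. finite A \<Longrightarrow> (\<Sum>n\<in>A. norm (a n)) \<le> L"
  shows "ell1 a \<le> ennreal L"
  unfolding ell1_def by (rule nn_integral_ints_le) (simp add: sum_ennreal ennreal_leI assms)

lemma ell1_leD:
  assumes "ell1 a \<le> ennreal L" "L \<ge> 0" "finite A"
  shows "(\<Sum>n\<in>A. norm (a n)) \<le> L"
proof -
  have "ennreal (\<Sum>n\<in>A. norm (a n)) = (\<Sum>n\<in>A. ennreal (norm (a n)))" by (simp add: sum_ennreal)
  also have "\<dots> \<le> ell1 a" unfolding ell1_def by (rule sum_le_nn_integral_count_space[OF assms(3)])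
  also have "\<dots> \<le> ennreal L" by fact
  finally show ?thesis using assms by (simp add: ennreal_le_iff)
qed

lemma ell1_le_norm:
  assumes "ell1 a \<le> ennreal L" "L \<ge> 0" shows "norm (a n) \<le> L"
  using ell1_leD[OF assms, of "{n}"] by simp

lemma FL1_norm_eq: "FL1_norm f = ell1 (fourier_coeff f)"
proof (rule antisym)
  have eq: "FL1_norm f = (SUP A\<in>{A. finite A \<and> A \<subseteq> UNIV}. \<Sum>n\<in>A. ennreal (norm (fourier_coeff f n)))"
    unfolding FL1_norm_def by (rule nonneg_infsum_complete) simp
  show "FL1_norm f \<le> ell1 (fourier_coeff f)"
    unfolding eq ell1_def by (rule SUP_least) (auto intro: sum_le_nn_integral_count_space simp del: sum_ennreal)
  show "ell1 (fourier_coeff f) \<le> FL1_norm f"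
    unfolding eq ell1_def by (rule nn_integral_ints_le) (auto intro!: SUP_upper simp del: sum_ennreal)
qed

lemma nn_integral_ints_shift:
  "(\<integral>\<^sup>+p. f (n - p) \<partial>ints) = (\<integral>\<^sup>+p. f p \<partial>ints)"
  by (rule nn_integral_bij_count_space) (rule bij_betwI[of _ _ _ "\<lambda>p. n - p"], auto)

lemma nn_integral_pairs:
  "(\<integral>\<^sup>+z. f z \<partial>int_pairs) = (\<integral>\<^sup>+p. \<integral>\<^sup>+q. f (p, q) \<partial>ints \<partial>ints)"
  by (rule nn_integral_fst_count_space[symmetric])

text \<open>The map \<open>(n, p, q) \<mapsto> (n - p, n - p - q, n - q)\<close> is a bijection of
  the integer triples, so the triple sum factorises. This is the algebra property of
  \<open>\<ell>\<^sup>1\<close> in the coordinates of the cubic term.\<close>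

lemma nn_integral_convolution3:
  fixes \<alpha> \<beta> \<gamma> :: "int \<Rightarrow> ennreal"
  shows "(\<integral>\<^sup>+n. \<integral>\<^sup>+(p, q). \<alpha> (n - p) * \<beta> (n - p - q) * \<gamma> (n - q) \<partial>int_pairs \<partial>ints)
    = (\<integral>\<^sup>+n. \<alpha> n \<partial>ints) * (\<integral>\<^sup>+n. \<beta> n \<partial>ints) * (\<integral>\<^sup>+n. \<gamma> n \<partial>ints)"
proof -
  let ?g = "\<lambda>(n::int, p::int, q::int). (n - p, n - p - q, n - q)"
  have bij: "bij_betw ?g UNIV UNIV"
    by (rule bij_betwI[of _ _ _ "\<lambda>(i, j, k). (i + k - j, k - j, i - j)"]) auto
  have "(\<integral>\<^sup>+n. \<integral>\<^sup>+(p, q). \<alpha> (n - p) * \<beta> (n - p - q) * \<gamma> (n - q) \<partial>int_pairs \<partial>ints)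
    = (\<integral>\<^sup>+z. (case ?g z of (i, j, k) \<Rightarrow> \<alpha> i * \<beta> j * \<gamma> k) \<partial>count_space UNIV)"
    by (subst nn_integral_fst_count_space[symmetric]) (simp add: case_prod_unfold)
  also have "\<dots> = (\<integral>\<^sup>+(i, j, k). \<alpha> i * \<beta> j * \<gamma> k \<partial>count_space UNIV)"
    by (rule nn_integral_bij_count_space[OF bij])
  also have "\<dots> = (\<integral>\<^sup>+i. \<integral>\<^sup>+j. \<integral>\<^sup>+k. \<alpha> i * \<beta> j * \<gamma> k \<partial>ints \<partial>ints \<partial>ints)"
    by (subst nn_integral_fst_count_space[symmetric], subst nn_integral_fst_count_space[symmetric]) simp
  also have "\<dots> = (\<integral>\<^sup>+n. \<alpha> n \<partial>ints) * (\<integral>\<^sup>+n. \<beta> n \<partial>ints) * (\<integral>\<^sup>+n. \<gamma> n \<partial>ints)"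
    by (simp add: nn_integral_cmult nn_integral_multc mult.assoc)
  finally show ?thesis .
qed

lemma nn_integral_ints_mono_point:
  "f n \<le> (\<integral>\<^sup>+n. f n \<partial>ints)" for f :: "int \<Rightarrow> ennreal"
  using sum_le_nn_integral_count_space[of "{n}" f] by simp

section \<open>Absolutely convergent Fourier series\<close>

definition synth :: "(int \<Rightarrow> complex) \<Rightarrow> real \<Rightarrow> complex" where
  "synth a x = (LINT n|ints. a n * chr n x)"

lemma synth_measurable [measurable]: "synth a \<in> borel_measurable borel"
  unfolding synth_def by (rule borel_measurable_integral_count_space) simp

lemma norm_synth_le:
  assumes "ell1 a \<le> ennreal L" "L \<ge> 0" shows "norm (synth a x) \<le> L"
proof -
  have "ennreal (norm (synth a x)) \<le> (\<integral>\<^sup>+n. ennreal (norm (a n * chr n x)) \<partial>ints)"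
    unfolding synth_def by (rule ennreal_norm_integral_le)
  also have "\<dots> = ell1 a" by (simp add: ell1_def norm_mult)
  finally show ?thesis using assms order_trans ennreal_le_iff by blast
qed

text \<open>Each mode of the series shifts the coefficients of \<open>g\<close>; boundedness of
  \<open>g\<close> and summability of \<open>a\<close> justify the interchange. With
  \<open>g = 1\<close> this recovers the coefficients of \<open>synth a\<close>, and applied twice
  it expands the cubic nonlinearity.\<close>

lemma fourier_coeff_mult_synth:
  assumes g: "g \<in> borel_measurable borel" "\<And>x. norm (g x) \<le> B" and a: "ell1 a < \<infinity>"
  shows "fourier_coeff (\<lambda>x. g x * synth a x) n = (LINT k|ints. a k * fourier_coeff g (n - k))"
proof -
  note [measurable] = g(1)
  have B: "B \<ge> 0" using g(2)[of 0] norm_ge_zero order_trans by blast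
  have ptw: "g x * synth a x * chr (-n) x = (LINT k|ints. a k * (g x * chr (-(n - k)) x))" for x
  proof -
    have "g x * synth a x * chr (-n) x = (g x * chr (-n) x) * (LINT k|ints. a k * chr k x)"
      by (simp add: synth_def mult_ac)
    also have "\<dots> = (LINT k|ints. (g x * chr (-n) x) * (a k * chr k x))" by simp
    also have "\<dots> = (LINT k|ints. a k * (g x * chr (-(n - k)) x))"
    proof (rule Bochner_Integration.integral_cong[OF refl])
      fix k
      have "chr (-(n - k)) x = chr (-n) x * chr k x" by (simp flip: chr_add)
      then show "(g x * chr (-n) x) * (a k * chr k x) = a k * (g x * chr (-(n - k)) x)" by (simp add: mult_ac)
    qed
    finally show ?thesis .
  qed
  have "(LINT x|torus. LINT k|ints. a k * (g x * chr (-(n - k)) x)) = (LINT k|ints. LINT x|torus. a k * (g x * chr (-(n - k)) x))"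
  proof (rule integral_count_space_swap(1))
    show "sigma_finite_measure torus" by (rule finite_measure.axioms(1)[OF finite_measure_segm])
    have "(\<integral>\<^sup>+k. \<integral>\<^sup>+x. ennreal (norm (a k * (g x * chr (-(n - k)) x))) \<partial>torus \<partial>ints)
      \<le> (\<integral>\<^sup>+k. \<integral>\<^sup>+x. ennreal (norm (a k) * B) \<partial>torus \<partial>ints)"
      using g(2) by (intro nn_integral_mono ennreal_leI) (auto simp: norm_mult intro!: mult_left_mono)
    also have "\<dots> = (\<integral>\<^sup>+k. ennreal (norm (a k)) * (ennreal B * ennreal (2 * pi)) \<partial>ints)"
      using B by (simp add: emeasure_segm ennreal_mult mult.assoc)
    also have "\<dots> = ell1 a * (ennreal B * ennreal (2 * pi))" by (simp add: nn_integral_multc ell1_def)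
    also have "\<dots> < \<infinity>" using a by (simp add: ennreal_mult_less_top)
    finally show "(\<integral>\<^sup>+k. \<integral>\<^sup>+x. ennreal (norm (a k * (g x * chr (-(n - k)) x))) \<partial>torus \<partial>ints) < \<infinity>" .
  qed measurable
  then have "fourier_coeff (\<lambda>x. g x * synth a x) n = (LINT k|ints. a k * (LINT x|torus. g x * chr (-(n - k)) x)) / (2 * pi)"
    by (subst fourier_coeff_eq) (simp_all only: ptw integral_mult_right_zero, measurable)
  also have "\<dots> = (LINT k|ints. a k * fourier_coeff g (n - k))"
    by (simp add: fourier_coeff_eq)
  finally show ?thesis .
qed

lemma fourier_coeff_const: "fourier_coeff (\<lambda>x. 1) n = (if n = 0 then 1 else 0)"
  using fourier_coeff_trig_sum[of "{0}" "\<lambda>_. 1" n] by simp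

lemma integral_ints_delta: "(LINT k|ints. f k * (if n = k then 1 else 0)) = f n" for f :: "int \<Rightarrow> complex"
proof -
  have "(LINT k|ints. f k * (if n = k then 1 else 0)) = (\<Sum>k | k \<in> UNIV \<and> f k * (if n = k then 1 else 0) \<noteq> 0. f k * (if n = k then 1 else 0))"
    by (rule lebesgue_integral_count_space_finite_support) (rule finite_subset[of _ "{n}"], auto)
  also have "\<dots> = (\<Sum>k\<in>{n}. f k * (if n = k then 1 else 0))" by (rule sum.mono_neutral_left) auto
  finally show ?thesis by simp
qed

lemma fourier_coeff_synth:
  assumes "ell1 a < \<infinity>" shows "fourier_coeff (synth a) n = a n"
  using fourier_coeff_mult_synth[of "\<lambda>_. 1" 1 a n] assms
  by (simp add: fourier_coeff_const eq_iff_diff_eq_0[of n, symmetric] integral_ints_delta)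

lemma fourier_coeff_cnj:
  assumes [measurable]: "f \<in> borel_measurable borel"
  shows "fourier_coeff (\<lambda>x. cnj (f x)) n = cnj (fourier_coeff f (- n))"
proof -
  have "(LINT x|torus. cnj (f x) * chr (-n) x) = (LINT x|torus. cnj (f x * chr n x))" by (simp add: cnj_chr)
  also have "\<dots> = cnj (LINT x|torus. f x * chr n x)" by (rule Bochner_Integration.integral_cnj)
  finally show ?thesis by (simp add: fourier_coeff_eq)
qed

text \<open>
  In the interaction picture the cubic term is indexed by \<open>p = n - n\<^sub>1\<close> and \<open>q = n - n\<^sub>3\<close>: the phase
  \<open>n\<^sup>2 - n\<^sub>1\<^sup>2 + n\<^sub>2\<^sup>2 - n\<^sub>3\<^sup>2\<close> becomes \<open>2 p q\<close>, and the resonant terms are those with \<open>p q = 0\<close>.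
\<close>
definition cubic_term :: "int \<Rightarrow> real \<Rightarrow> (int \<Rightarrow> complex) \<Rightarrow> int \<Rightarrow> int \<times> int \<Rightarrow> complex" where
  "cubic_term \<sigma> r b n z = (case z of (p, q) \<Rightarrow>
     b (n - p) * cnj (b (n - p - q)) * b (n - q) * chr (2 * \<sigma> * p * q) r)"

definition cubic :: "int \<Rightarrow> real \<Rightarrow> (int \<Rightarrow> complex) \<Rightarrow> int \<Rightarrow> complex" where
  "cubic \<sigma> r b n = (LINT z|int_pairs. cubic_term \<sigma> r b n z)"

lemma nn_integral_cubic_term:
  "(\<integral>\<^sup>+n. \<integral>\<^sup>+z. ennreal (norm (cubic_term \<sigma> r b n z)) \<partial>int_pairs \<partial>ints) = ell1 b ^ 3"
proof -
  have "(\<integral>\<^sup>+n. \<integral>\<^sup>+z. ennreal (norm (cubic_term \<sigma> r b n z)) \<partial>int_pairs \<partial>ints)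
    = (\<integral>\<^sup>+n. \<integral>\<^sup>+(p, q). ennreal (norm (b (n - p))) * ennreal (norm (b (n - p - q))) * ennreal (norm (b (n - q))) \<partial>int_pairs \<partial>ints)"
    by (simp add: cubic_term_def case_prod_unfold norm_mult ennreal_mult)
  also have "\<dots> = ell1 b ^ 3"
    unfolding nn_integral_convolution3[of "\<lambda>k. ennreal (norm (b k))" "\<lambda>k. ennreal (norm (b k))" "\<lambda>k. ennreal (norm (b k))"]
    by (simp add: ell1_def power3_eq_cube mult.assoc)
  finally show ?thesis .
qed

lemma integrable_cubic_term:
  assumes "ell1 b < \<infinity>" shows "integrable int_pairs (cubic_term \<sigma> r b n)"
proof -
  have "(\<integral>\<^sup>+z. ennreal (norm (cubic_term \<sigma> r b n z)) \<partial>int_pairs) \<le> ell1 b ^ 3"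
    using nn_integral_ints_mono_point[of "\<lambda>n. \<integral>\<^sup>+z. ennreal (norm (cubic_term \<sigma> r b n z)) \<partial>int_pairs" n]
    unfolding nn_integral_cubic_term .
  also have "\<dots> < \<infinity>" using assms by (simp add: power_less_top_ennreal)
  finally show ?thesis by (simp add: integrable_iff_bounded)
qed

lemma ell1_cubic_le: "ell1 (cubic \<sigma> r b) \<le> ell1 b ^ 3"
proof -
  have "ell1 (cubic \<sigma> r b) \<le> (\<integral>\<^sup>+n. \<integral>\<^sup>+z. ennreal (norm (cubic_term \<sigma> r b n z)) \<partial>int_pairs \<partial>ints)"
    unfolding ell1_def cubic_def by (intro nn_integral_mono ennreal_norm_integral_le)
  then show ?thesis unfolding nn_integral_cubic_term .
qed

text \<open>Exchanging \<open>b\<close> for \<open>b'\<close> one factor at a time leaves three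
  trilinear terms, each with a single difference factor.\<close>

lemma ell1_cubic_diff_le:
  assumes b: "ell1 b \<le> ennreal L" "ell1 b' \<le> ennreal L" "ell1 (\<lambda>n. b n - b' n) \<le> ennreal D" and L: "L \<ge> 0" "D \<ge> 0"
  shows "ell1 (\<lambda>n. cubic \<sigma> r b n - cubic \<sigma> r b' n) \<le> ennreal (3 * L\<^sup>2 * D)"
proof -
  define d where "d = (\<lambda>n. ennreal (norm (b n - b' n)))"
  define \<beta> where "\<beta> = (\<lambda>n. ennreal (norm (b n)))"
  define \<beta>' where "\<beta>' = (\<lambda>n. ennreal (norm (b' n)))"
  have fin: "ell1 b < \<infinity>" "ell1 b' < \<infinity>" using b by (auto intro: le_less_trans)
  have ptw: "ennreal (norm (cubic_term \<sigma> r b n z - cubic_term \<sigma> r b' n z)) \<le>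
     (case z of (p, q) \<Rightarrow> d (n - p) * \<beta> (n - p - q) * \<beta> (n - q))
     + ((case z of (p, q) \<Rightarrow> \<beta>' (n - p) * d (n - p - q) * \<beta> (n - q))
     + (case z of (p, q) \<Rightarrow> \<beta>' (n - p) * \<beta>' (n - p - q) * d (n - q)))" for n z
  proof (cases z)
    case (Pair p q)
    define x y w where "x = b (n - p)" "y = b (n - p - q)" "w = b (n - q)"
    define x' y' w' where "x' = b' (n - p)" "y' = b' (n - p - q)" "w' = b' (n - q)"
    note xyw = x_y_w_def x'_y'_w'_def
    have "cubic_term \<sigma> r b n z - cubic_term \<sigma> r b' n z = ((x - x') * cnj y * w + (x' * cnj (y - y') * w + x' * cnj y' * (w - w'))) * chr (2 * \<sigma> * p * q) r"
      by (simp add: cubic_term_def Pair xyw algebra_simps)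
    then have "norm (cubic_term \<sigma> r b n z - cubic_term \<sigma> r b' n z) = norm ((x - x') * cnj y * w + (x' * cnj (y - y') * w + x' * cnj y' * (w - w')))"
      by (simp add: norm_mult)
    also have "\<dots> \<le> norm (x - x') * norm y * norm w + (norm x' * norm (y - y') * norm w + norm x' * norm y' * norm (w - w'))"
    proof -
      have "norm ((x - x') * cnj y * w + (x' * cnj (y - y') * w + x' * cnj y' * (w - w')))
        \<le> norm ((x - x') * cnj y * w) + (norm (x' * cnj (y - y') * w) + norm (x' * cnj y' * (w - w')))"
        by (meson add_left_mono norm_triangle_ineq order_trans)
      then show ?thesis by (simp only: norm_mult complex_mod_cnj)
    qed
    finally have "ennreal (norm (cubic_term \<sigma> r b n z - cubic_term \<sigma> r b' n z)) \<le> ennreal \<dots>" by (rule ennreal_leI)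
    then show ?thesis
      by (simp add: Pair d_def \<beta>_def \<beta>'_def xyw ennreal_mult)
  qed
  have "ell1 (\<lambda>n. cubic \<sigma> r b n - cubic \<sigma> r b' n)
    \<le> (\<integral>\<^sup>+n. \<integral>\<^sup>+z. ennreal (norm (cubic_term \<sigma> r b n z - cubic_term \<sigma> r b' n z)) \<partial>int_pairs \<partial>ints)"
    unfolding ell1_def
  proof (rule nn_integral_mono)
    fix n
    have "cubic \<sigma> r b n - cubic \<sigma> r b' n = (LINT z|int_pairs. cubic_term \<sigma> r b n z - cubic_term \<sigma> r b' n z)"
      unfolding cubic_def using integrable_cubic_term[OF fin(1)] integrable_cubic_term[OF fin(2)] by simp
    then show "ennreal (norm (cubic \<sigma> r b n - cubic \<sigma> r b' n)) \<le> (\<integral>\<^sup>+z. ennreal (norm (cubic_term \<sigma> r b n z - cubic_term \<sigma> r b' n z)) \<partial>int_pairs)"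
      using ennreal_norm_integral_le by metis
  qed
  also have "\<dots> \<le> (\<integral>\<^sup>+n. \<integral>\<^sup>+z. (case z of (p, q) \<Rightarrow> d (n - p) * \<beta> (n - p - q) * \<beta> (n - q))
     + ((case z of (p, q) \<Rightarrow> \<beta>' (n - p) * d (n - p - q) * \<beta> (n - q))
     + (case z of (p, q) \<Rightarrow> \<beta>' (n - p) * \<beta>' (n - p - q) * d (n - q))) \<partial>int_pairs \<partial>ints)"
    by (intro nn_integral_mono ptw)
  also have "\<dots> = (\<integral>\<^sup>+n. d n \<partial>ints) * ell1 b * ell1 b + (ell1 b' * (\<integral>\<^sup>+n. d n \<partial>ints) * ell1 b + ell1 b' * ell1 b' * (\<integral>\<^sup>+n. d n \<partial>ints))"
    by (simp add: nn_integral_add nn_integral_convolution3) (simp add: ell1_def \<beta>_def \<beta>'_def)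
  also have "\<dots> \<le> ennreal D * ennreal L * ennreal L + (ennreal L * ennreal D * ennreal L + ennreal L * ennreal L * ennreal D)"
    using b unfolding d_def ell1_def[of "\<lambda>n. b n - b' n", symmetric] by (intro add_mono mult_mono) auto
  also have "\<dots> = ennreal (3 * L\<^sup>2 * D)"
    using L by (simp add: power2_eq_square mult_ac flip: ennreal_mult ennreal_plus)
  finally show ?thesis .
qed

lemma cubic_measurable:
  assumes [measurable]: "\<And>n. (\<lambda>r. b r n) \<in> borel_measurable borel"
  shows "(\<lambda>r. cubic \<sigma> r (b r) n) \<in> borel_measurable borel"
  unfolding cubic_def
  by (rule borel_measurable_integral_count_space) (simp add: cubic_term_def split: prod.split)

text \<open>Summability of \<open>b\<close> is what allows the coefficient of the nonlinearity to be
  written as a sum over pairs: two product expansions, reflections of the summation variables about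
  \<open>n\<close>, and Fubini. The free phases combine through \<open>n\<^sup>2 - (n - p)\<^sup>2 +
  (n - p - q)\<^sup>2 - (n - q)\<^sup>2 = 2 p q\<close>.\<close>

lemma fourier_coeff_cubic:
  assumes b: "ell1 b < \<infinity>" and a: "\<And>n. a n = chr (- \<sigma> * n\<^sup>2) r * b n"
  shows "chr (\<sigma> * n\<^sup>2) r * fourier_coeff (\<lambda>x. of_real ((norm (synth a x))\<^sup>2) * synth a x) n = cubic \<sigma> r b n"
proof -
  have ea: "ell1 a = ell1 b" by (simp add: ell1_def a norm_mult)
  with b have fa: "ell1 a < \<infinity>" by simp
  then obtain L where L: "ell1 a = ennreal L" "L \<ge> 0" by (cases "ell1 a") auto
  have bd: "norm (synth a x) \<le> L" for x using norm_synth_le[of a L x] L by simp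
  have fc: "fourier_coeff (\<lambda>x. cnj (synth a x) * synth a x) m = (LINT i|ints. a i * cnj (a (i - m)))" for m
  proof -
    have "fourier_coeff (\<lambda>x. cnj (synth a x) * synth a x) m = (LINT i|ints. a i * fourier_coeff (\<lambda>x. cnj (synth a x)) (m - i))"
      by (rule fourier_coeff_mult_synth[where B = L]) (use bd fa in auto)
    then show ?thesis by (simp add: fourier_coeff_cnj fourier_coeff_synth[OF fa])
  qed
  have "fourier_coeff (\<lambda>x. of_real ((norm (synth a x))\<^sup>2) * synth a x) n
     = fourier_coeff (\<lambda>x. (cnj (synth a x) * synth a x) * synth a x) n"
    by (simp add: complex_norm_square mult.commute del: of_real_power)
  also have "\<dots> = (LINT k|ints. a k * fourier_coeff (\<lambda>x. cnj (synth a x) * synth a x) (n - k))"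
    by (rule fourier_coeff_mult_synth[where B = "L * L"]) (use bd fa L in \<open>auto simp: norm_mult intro!: mult_mono\<close>)
  also have "\<dots> = (LINT k|ints. a k * (LINT i|ints. a i * cnj (a (i - (n - k)))))" by (simp add: fc)
  also have "\<dots> = (LINT q|ints. a (n - q) * (LINT i|ints. a i * cnj (a (i - q))))"
    by (subst integral_bij_count_space[symmetric, of "\<lambda>q. n - q" UNIV])
       (auto intro!: bij_betwI[of _ _ _ "\<lambda>q. n - q"])
  also have "\<dots> = (LINT q|ints. a (n - q) * (LINT p|ints. a (n - p) * cnj (a (n - p - q))))"
    by (subst (2) integral_bij_count_space[symmetric, of "\<lambda>q. n - q" UNIV])
       (auto intro!: bij_betwI[of _ _ _ "\<lambda>q. n - q"])
  finally have "chr (\<sigma> * n\<^sup>2) r * fourier_coeff (\<lambda>x. of_real ((norm (synth a x))\<^sup>2) * synth a x) n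
    = (LINT q|ints. LINT p|ints. chr (\<sigma> * n\<^sup>2) r * (a (n - q) * (a (n - p) * cnj (a (n - p - q)))))"
    by simp
  also have "\<dots> = (LINT q|ints. LINT p|ints. cubic_term \<sigma> r b n (p, q))"
  proof (intro Bochner_Integration.integral_cong refl)
    fix p q
    have "2 * \<sigma> * p * q = \<sigma> * n\<^sup>2 + (- \<sigma> * (n - p)\<^sup>2 + (\<sigma> * (n - p - q)\<^sup>2 + - \<sigma> * (n - q)\<^sup>2))"
      by (simp add: power2_eq_square algebra_simps)
    then have "chr (2 * \<sigma> * p * q) r = chr (\<sigma> * n\<^sup>2) r * (chr (- \<sigma> * (n - p)\<^sup>2) r * (chr (\<sigma> * (n - p - q)\<^sup>2) r * chr (- \<sigma> * (n - q)\<^sup>2) r))"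
      by (simp only: chr_add)
    then show "chr (\<sigma> * n\<^sup>2) r * (a (n - q) * (a (n - p) * cnj (a (n - p - q)))) = cubic_term \<sigma> r b n (p, q)"
      by (simp add: cubic_term_def a cnj_chr mult_ac)
  qed
  also have "\<dots> = cubic \<sigma> r b n"
  proof -
    interpret C: sigma_finite_measure ints by (rule sigma_finite_measure_count_space)
    interpret P: pair_sigma_finite ints ints ..
    have eq: "ints \<Otimes>\<^sub>M ints = int_pairs" by (subst pair_measure_countable) auto
    show ?thesis unfolding cubic_def
      using P.integral_snd[of "\<lambda>p q. cubic_term \<sigma> r b n (p, q)"] integrable_cubic_term[OF b] by (simp add: eq)
  qed
  finally show ?thesis .
qed

lemma nn_integral_pairs_delta:
  fixes h :: "int \<Rightarrow> ennreal"
  shows "(\<integral>\<^sup>+z. (case z of (p, q) \<Rightarrow> if p = 0 then h q else 0) \<partial>int_pairs) = (\<integral>\<^sup>+q. h q \<partial>ints)"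
    and "(\<integral>\<^sup>+z. (case z of (p, q) \<Rightarrow> if q = 0 then h p else 0) \<partial>int_pairs) = (\<integral>\<^sup>+q. h q \<partial>ints)"
proof -
  have d: "(\<integral>\<^sup>+p. (if p = 0 then c else 0) \<partial>ints) = c" for c :: ennreal
    by (subst nn_integral_count_space'[of "{0}"]) auto
  have "(\<integral>\<^sup>+z. (case z of (p, q) \<Rightarrow> if p = 0 then h q else 0) \<partial>int_pairs)
    = (\<integral>\<^sup>+p. (if p = 0 then (\<integral>\<^sup>+q. h q \<partial>ints) else 0) \<partial>ints)"
    unfolding nn_integral_pairs by (intro nn_integral_cong) auto
  then show "(\<integral>\<^sup>+z. (case z of (p, q) \<Rightarrow> if p = 0 then h q else 0) \<partial>int_pairs) = (\<integral>\<^sup>+q. h q \<partial>ints)"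
    unfolding d .
  show "(\<integral>\<^sup>+z. (case z of (p, q) \<Rightarrow> if q = 0 then h p else 0) \<partial>int_pairs) = (\<integral>\<^sup>+q. h q \<partial>ints)"
    unfolding nn_integral_pairs by (simp add: d)
qed

lemma nn_integral_norm_squared_le:
  assumes "ell1 b \<le> ennreal L" "L \<ge> 0"
  shows "(\<integral>\<^sup>+n. ennreal ((norm (b n))\<^sup>2) \<partial>ints) \<le> ennreal (L\<^sup>2)"
proof -
  have "(\<integral>\<^sup>+n. ennreal ((norm (b n))\<^sup>2) \<partial>ints) \<le> (\<integral>\<^sup>+n. ennreal L * ennreal (norm (b n)) \<partial>ints)"
    using ell1_le_norm[OF assms] assms(2)
    by (intro nn_integral_mono) (simp add: power2_eq_square mult_right_mono ennreal_leI flip: ennreal_mult)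
  also have "\<dots> = ennreal L * ell1 b" by (simp add: nn_integral_cmult ell1_def)
  also have "\<dots> \<le> ennreal L * ennreal L" by (intro mult_left_mono assms) auto
  finally show ?thesis using assms(2) by (simp add: power2_eq_square ennreal_mult)
qed

text \<open>The linearised rotation \<open>1 - \<i> y\<close> lengthens a vector only to second
  order. This square is one source of the factor \<open>(t - s)\<^sup>2\<close> in the growth
  estimates.\<close>

lemma norm_one_minus_i_le: "norm (1 - \<i> * complex_of_real y) \<le> 1 + y\<^sup>2 / 2"
proof -
  have "norm (1 - \<i> * complex_of_real y) = sqrt (1 + y\<^sup>2)" by (simp add: cmod_def)
  also have "\<dots> \<le> sqrt ((1 + y\<^sup>2 / 2)\<^sup>2)"
    by (intro real_sqrt_le_mono) (simp add: power2_sum)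
  finally show ?thesis by simp
qed

section \<open>Long-time control of the norm\<close>

text \<open>
  Freezing the coefficients over a time step: the resonant part only rotates each mode, up to
  second order, and each nonresonant term oscillates with integer frequency and stays bounded.
\<close>
lemma frozen_step:
  fixes \<kappa> :: real
  assumes b: "ell1 b \<le> ennreal L" and L: "L \<ge> 0" and \<sigma>: "\<sigma> \<noteq> 0" and st: "s \<le> t"
  shows "ell1 (\<lambda>n. b n - \<i> * of_real \<kappa> * (LINT r|segm s t. cubic \<sigma> r b n))
    \<le> ell1 b * ennreal (1 + (\<kappa> * (t - s) * (2 * L\<^sup>2))\<^sup>2 / 2) + ennreal (\<bar>\<kappa>\<bar> * L ^ 3)"
proof -
  have fin: "ell1 b < \<infinity>" using b by (auto intro: le_less_trans)
  define c where "c = 1 + (\<kappa> * (t - s) * (2 * L\<^sup>2))\<^sup>2 / 2"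
  have ptw: "ennreal (norm (b n - \<i> * of_real \<kappa> * (LINT r|segm s t. cubic \<sigma> r b n)))
    \<le> ennreal (norm (b n)) * ennreal c + ennreal \<bar>\<kappa>\<bar> * (\<integral>\<^sup>+z. ennreal (norm (cubic_term \<sigma> 0 b n z)) \<partial>int_pairs)" for n
  proof -
    define f where "f = cubic_term \<sigma> 0 b n"
    define J where "J = (\<lambda>(p, q). LINT r|segm s t. chr (2 * \<sigma> * p * q) r)"
    \<comment> \<open>On the resonant set the term is \<open>b n\<close> times a squared modulus.
      The resonant part thus multiplies mode \<open>n\<close> by the real number
      \<open>(t - s) * \<theta>\<close>, and the factor \<open>- \<i>\<close> in front makes it a
      linearised rotation.\<close>
    define g where "g = (\<lambda>(p, q). if p * q = 0 then (norm (b (n - p - q)))\<^sup>2 else 0)"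
    define \<theta> where "\<theta> = (LINT z|int_pairs. g z)"
    define R where "R = (LINT z|int_pairs. (if fst z * snd z = 0 then 0 else f z * J z))"
    have intf: "integrable int_pairs f" unfolding f_def by (rule integrable_cubic_term[OF fin])
    have ct: "cubic_term \<sigma> r b n z = f z * chr (2 * \<sigma> * fst z * snd z) r" for r z
      by (simp add: cubic_term_def f_def case_prod_unfold)
    have J0: "J z = of_real (t - s)" if "fst z * snd z = 0" for z
    proof -
      have "chr 0 = (\<lambda>_. 1)" by auto
      then show ?thesis using that st by (auto simp: J_def case_prod_unfold measure_segm of_real_def)
    qed
    \<comment> \<open>A nonzero frequency \<open>2 \<sigma> p q\<close> has modulus at least 2, so
      the integral of its oscillation is at most 2 / 2, whatever the length of the interval.\<close>
    have J1: "norm (J z) \<le> 1" if nz: "fst z * snd z \<noteq> 0" for z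
    proof -
      define m where "m = 2 * \<sigma> * fst z * snd z"
      have m: "m \<noteq> 0" "\<bar>m\<bar> \<ge> 2" using nz \<sigma> by (auto simp: m_def abs_mult)
         (smt (verit) mult_eq_0_iff mult_less_cancel_left_pos zero_less_abs_iff abs_mult int_one_le_iff_zero_less mult_le_cancel_left1)
      have "J z = (chr m t - chr m s) / (\<i> * of_int m)"
        unfolding J_def case_prod_unfold m_def[symmetric] by (rule integral_chr[OF m(1) st])
      then have "norm (J z) = norm (chr m t - chr m s) / \<bar>of_int m\<bar>" by (simp add: norm_divide norm_mult)
      also have "\<dots> \<le> 2 / 2"
      proof (rule frac_le)
        show "norm (chr m t - chr m s) \<le> 2" using norm_triangle_ineq4[of "chr m t" "chr m s"] by simp
        show "2 \<le> \<bar>real_of_int m\<bar>" using m(2) by linarith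
      qed auto
      finally show ?thesis by simp
    qed
    have swap: "(LINT r|segm s t. cubic \<sigma> r b n) = (LINT z|int_pairs. f z * J z)"
    proof -
      have "(LINT r|segm s t. LINT z|int_pairs. cubic_term \<sigma> r b n z) = (LINT z|int_pairs. LINT r|segm s t. cubic_term \<sigma> r b n z)"
      proof (rule integral_count_space_swap(1))
        show "sigma_finite_measure (segm s t)" by (rule finite_measure.axioms(1)[OF finite_measure_segm])
        have "(\<integral>\<^sup>+z. \<integral>\<^sup>+r. ennreal (norm (cubic_term \<sigma> r b n z)) \<partial>segm s t \<partial>int_pairs)
          = (\<integral>\<^sup>+z. ennreal (norm (f z)) * ennreal (t - s) \<partial>int_pairs)"
          by (simp add: ct norm_mult emeasure_segm)
        also have "\<dots> = (\<integral>\<^sup>+z. ennreal (norm (f z)) \<partial>int_pairs) * ennreal (t - s)" by (simp add: nn_integral_multc)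
        also have "\<dots> < \<infinity>" using intf by (simp add: integrable_iff_bounded ennreal_mult_less_top)
        finally show "(\<integral>\<^sup>+z. \<integral>\<^sup>+r. ennreal (norm (cubic_term \<sigma> r b n z)) \<partial>segm s t \<partial>int_pairs) < \<infinity>" .
        show "(\<lambda>r. cubic_term \<sigma> r b n z) \<in> borel_measurable (segm s t)" for z unfolding ct by measurable
      qed
      then show ?thesis by (simp add: cubic_def ct J_def case_prod_unfold)
    qed
    have I1: "integrable int_pairs (\<lambda>z. if fst z * snd z = 0 then f z * of_real (t - s) else 0)"
      by (rule Bochner_Integration.integrable_bound[OF integrable_mult_left[OF intf, of "of_real (t - s)"]]) auto
    have I2: "integrable int_pairs (\<lambda>z. if fst z * snd z = 0 then 0 else f z * J z)"
      by (rule Bochner_Integration.integrable_bound[OF intf]) (use J1 in \<open>auto simp: norm_mult intro!: mult_left_le\<close>)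
    have "(LINT z|int_pairs. f z * J z) = (LINT z|int_pairs. (if fst z * snd z = 0 then f z * of_real (t - s) else 0)
        + (if fst z * snd z = 0 then 0 else f z * J z))"
      by (intro Bochner_Integration.integral_cong refl) (auto simp: J0)
    also have "\<dots> = (LINT z|int_pairs. (if fst z * snd z = 0 then f z * of_real (t - s) else 0)) + R"
      unfolding R_def by (rule Bochner_Integration.integral_add[OF I1 I2])
    also have "(LINT z|int_pairs. (if fst z * snd z = 0 then f z * of_real (t - s) else 0)) = (LINT z|int_pairs. (b n * of_real (t - s)) * of_real (g z))"
    proof (intro Bochner_Integration.integral_cong refl)
      fix z :: "int \<times> int"
      show "(if fst z * snd z = 0 then f z * of_real (t - s) else 0) = (b n * of_real (t - s)) * of_real (g z)"
        by (cases z) (auto simp: f_def g_def cubic_term_def complex_norm_square mult_ac simp del: of_real_power)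
    qed
    also have "\<dots> = b n * of_real ((t - s) * \<theta>)"
      by (simp only: integral_mult_right_zero integral_complex_of_real \<theta>_def of_real_mult mult.assoc)
    finally have split: "(LINT r|segm s t. cubic \<sigma> r b n) = b n * of_real ((t - s) * \<theta>) + R" unfolding swap .
    have R: "ennreal (norm R) \<le> (\<integral>\<^sup>+z. ennreal (norm (f z)) \<partial>int_pairs)"
      unfolding R_def
    proof (rule order_trans[OF ennreal_norm_integral_le nn_integral_mono])
      fix z :: "int \<times> int"
      show "ennreal (norm (if fst z * snd z = 0 then 0 else f z * J z)) \<le> ennreal (norm (f z))"
        using J1[of z] by (auto simp: norm_mult intro!: ennreal_leI mult_left_le)
    qed
    have \<theta>0: "\<theta> \<ge> 0" unfolding \<theta>_def by (rule integral_nonneg_AE) (auto simp: g_def)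
    have "ennreal \<theta> = ennreal (norm \<theta>)" using \<theta>0 by simp
    also have "\<dots> \<le> (\<integral>\<^sup>+z. ennreal (norm (g z)) \<partial>int_pairs)" unfolding \<theta>_def by (rule ennreal_norm_integral_le)
    \<comment> \<open>Each of the axes \<open>p = 0\<close> and \<open>q = 0\<close> carries the
      full \<open>\<ell>\<^sup>2\<close> mass, hence the factor 2; the origin is counted twice,
      which is harmless in an upper bound.\<close>
    also have "\<dots> \<le> (\<integral>\<^sup>+z. (case z of (p, q) \<Rightarrow> if p = 0 then ennreal ((norm (b (n - q)))\<^sup>2) else 0)
        + (case z of (p, q) \<Rightarrow> if q = 0 then ennreal ((norm (b (n - p)))\<^sup>2) else 0) \<partial>int_pairs)"
      by (intro nn_integral_mono) (auto simp: g_def)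
    also have "\<dots> = (\<integral>\<^sup>+n. ennreal ((norm (b n))\<^sup>2) \<partial>ints) + (\<integral>\<^sup>+n. ennreal ((norm (b n))\<^sup>2) \<partial>ints)"
      by (subst nn_integral_add, simp, simp, unfold nn_integral_pairs_delta)
         (simp add: nn_integral_ints_shift[of "\<lambda>k. ennreal ((norm (b k))\<^sup>2)"])
    also have "\<dots> \<le> ennreal (L\<^sup>2) + ennreal (L\<^sup>2)"
      by (intro add_mono nn_integral_norm_squared_le b L)
    finally have \<theta>: "\<theta> \<le> 2 * L\<^sup>2" using \<theta>0 by (simp flip: ennreal_plus add: ennreal_le_iff)
    define y where "y = \<kappa> * (t - s) * \<theta>"
    have y: "y\<^sup>2 \<le> (\<kappa> * (t - s) * (2 * L\<^sup>2))\<^sup>2"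
      unfolding y_def power_mult_distrib[of _ \<theta>] power_mult_distrib[of _ "2 * L\<^sup>2"]
      using \<theta> \<theta>0 by (intro mult_left_mono power_mono) auto
    have "b n - \<i> * of_real \<kappa> * (LINT r|segm s t. cubic \<sigma> r b n) = b n * (1 - \<i> * of_real y) - \<i> * of_real \<kappa> * R"
      unfolding split y_def by (simp add: algebra_simps)
    then have "norm (b n - \<i> * of_real \<kappa> * (LINT r|segm s t. cubic \<sigma> r b n)) \<le> norm (b n) * norm (1 - \<i> * of_real y) + \<bar>\<kappa>\<bar> * norm R"
      by (metis norm_triangle_ineq4 norm_mult norm_ii mult_1 norm_of_real)
    also have "\<dots> \<le> norm (b n) * c + \<bar>\<kappa>\<bar> * norm R"
      using norm_one_minus_i_le[of y] y unfolding c_def by (intro add_right_mono mult_left_mono) auto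
    finally have "ennreal (norm (b n - \<i> * of_real \<kappa> * (LINT r|segm s t. cubic \<sigma> r b n))) \<le> ennreal (norm (b n) * c + \<bar>\<kappa>\<bar> * norm R)"
      by (rule ennreal_leI)
    also have "\<dots> = ennreal (norm (b n)) * ennreal c + ennreal \<bar>\<kappa>\<bar> * ennreal (norm R)"
      by (simp add: c_def ennreal_mult)
    also have "\<dots> \<le> ennreal (norm (b n)) * ennreal c + ennreal \<bar>\<kappa>\<bar> * (\<integral>\<^sup>+z. ennreal (norm (f z)) \<partial>int_pairs)"
      by (intro add_left_mono mult_left_mono R) auto
    finally show ?thesis by (simp add: f_def)
  qed
  have "ell1 (\<lambda>n. b n - \<i> * of_real \<kappa> * (LINT r|segm s t. cubic \<sigma> r b n))
    \<le> (\<integral>\<^sup>+n. ennreal (norm (b n)) * ennreal c + ennreal \<bar>\<kappa>\<bar> * (\<integral>\<^sup>+z. ennreal (norm (cubic_term \<sigma> 0 b n z)) \<partial>int_pairs) \<partial>ints)"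
    unfolding ell1_def by (intro nn_integral_mono ptw)
  also have "\<dots> = ell1 b * ennreal c + ennreal \<bar>\<kappa>\<bar> * ell1 b ^ 3"
    by (simp add: nn_integral_add nn_integral_multc nn_integral_cmult nn_integral_cubic_term ell1_def[symmetric])
  also have "\<dots> \<le> ell1 b * ennreal c + ennreal \<bar>\<kappa>\<bar> * ennreal L ^ 3"
    by (intro add_left_mono mult_left_mono power_mono b) auto
  also have "\<dots> = ell1 b * ennreal c + ennreal (\<bar>\<kappa>\<bar> * L ^ 3)"
    using L by (simp add: ennreal_mult ennreal_power)
  finally show ?thesis unfolding c_def .
qed

lemma ell1_add_le: "ell1 (\<lambda>n. a n + b n) \<le> ell1 a + ell1 b"
proof -
  have "ell1 (\<lambda>n. a n + b n) \<le> (\<integral>\<^sup>+n. ennreal (norm (a n)) + ennreal (norm (b n)) \<partial>ints)"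
    unfolding ell1_def by (intro nn_integral_mono) (simp add: norm_triangle_ineq flip: ennreal_plus)
  also have "\<dots> = ell1 a + ell1 b" by (simp add: ell1_def nn_integral_add)
  finally show ?thesis .
qed

lemma ell1_cmult: "ell1 (\<lambda>n. c * a n) = ennreal (norm c) * ell1 a"
  by (simp add: ell1_def norm_mult ennreal_mult nn_integral_cmult)

lemma ell1_integral_le:
  assumes m: "\<And>n. (\<lambda>r. G r n) \<in> borel_measurable borel"
    and K: "\<And>r. r \<in> {s..t} \<Longrightarrow> ell1 (G r) \<le> ennreal K" "K \<ge> 0" and st: "s \<le> t"
  shows "ell1 (\<lambda>n. LINT r|segm s t. G r n) \<le> ennreal (K * (t - s))"
proof -
  note [measurable] = m
  have "ell1 (\<lambda>n. LINT r|segm s t. G r n) \<le> (\<integral>\<^sup>+n. \<integral>\<^sup>+r. ennreal (norm (G r n)) \<partial>segm s t \<partial>ints)"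
    unfolding ell1_def by (intro nn_integral_mono ennreal_norm_integral_le)
  also have "\<dots> = (\<integral>\<^sup>+r. \<integral>\<^sup>+n. ennreal (norm (G r n)) \<partial>ints \<partial>segm s t)"
    by (rule nn_integral_count_space_nn_integral[symmetric]) auto
  also have "\<dots> \<le> (\<integral>\<^sup>+r. ennreal K \<partial>segm s t)"
    by (rule nn_integral_mono_AE) (use K(1) in \<open>auto simp: AE_segm ell1_def\<close>)
  also have "\<dots> = ennreal (K * (t - s))" using K st by (simp add: emeasure_segm ennreal_mult)
  finally show ?thesis .
qed

text \<open>
  The interaction picture: \<open>osc\<close> undoes the free flow, and \<open>\<sigma> = -1\<close> with \<open>\<kappa> < 0\<close> is the equation run
  backwards in time.
\<close>
locale nls_path =
  fixes v :: "real \<Rightarrow> real \<Rightarrow> complex" and \<sigma> :: int and \<kappa> T :: real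
  assumes \<sigma>: "\<sigma> \<noteq> 0" and T: "T \<ge> 0"
    and v_meas [measurable]: "(\<lambda>(t, x). v t x) \<in> borel_measurable (borel \<Otimes>\<^sub>M borel)"
    and v_L2: "\<And>t. L2 (v t)"
    and v_L4: "(\<integral>\<^sup>+t. \<integral>\<^sup>+x. ennreal (norm (v t x) ^ 4) \<partial>torus \<partial>segm 0 T) < \<infinity>"
    and duhamel: "\<And>s t n. 0 \<le> s \<Longrightarrow> s \<le> t \<Longrightarrow> t \<le> T \<Longrightarrow>
      chr (\<sigma> * n\<^sup>2) t * fourier_coeff (v t) n - chr (\<sigma> * n\<^sup>2) s * fourier_coeff (v s) n =
      - \<i> * of_real \<kappa> * (LINT r|segm s t. chr (\<sigma> * n\<^sup>2) r * fourier_coeff (\<lambda>x. of_real ((norm (v r x))\<^sup>2) * v r x) n)"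
begin

definition osc :: "real \<Rightarrow> int \<Rightarrow> complex" where
  "osc t n = chr (\<sigma> * n\<^sup>2) t * fourier_coeff (v t) n"

lemma v_meas1 [measurable]: "v t \<in> borel_measurable borel"
  using v_L2 by (rule L2_measurable)

lemma ell1_osc: "ell1 (osc t) = ell1 (fourier_coeff (v t))"
  by (simp add: ell1_def osc_def norm_mult)

lemma osc_measurable [measurable]: "(\<lambda>t. osc t n) \<in> borel_measurable borel"
  unfolding osc_def fourier_coeff_eq[OF v_meas1] by measurable

lemma fourier_coeff_osc: "fourier_coeff (v t) n = chr (- \<sigma> * n\<^sup>2) t * osc t n"
  by (simp add: osc_def mult.assoc[symmetric])

text \<open>While the coefficients are summable, \<open>v r\<close> agrees almost everywhere with
  its absolutely convergent series, so the nonlinearity in the Duhamel formula can be expanded by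
  \<open>fourier_coeff_cubic\<close>.\<close>

lemma osc_diff_cubic:
  assumes st: "0 \<le> s" "s \<le> t" "t \<le> T" and fin: "\<And>r. r \<in> {s..t} \<Longrightarrow> ell1 (osc r) < \<infinity>"
  shows "osc t n - osc s n = - \<i> * of_real \<kappa> * (LINT r|segm s t. cubic \<sigma> r (osc r) n)"
proof -
  have eq: "chr (\<sigma> * n\<^sup>2) r * fourier_coeff (\<lambda>x. of_real ((norm (v r x))\<^sup>2) * v r x) n = cubic \<sigma> r (osc r) n"
    if r: "r \<in> {s..t}" for r
  proof -
    define a where "a = fourier_coeff (v r)"
    have fa: "ell1 a < \<infinity>" using fin[OF r] by (simp add: a_def ell1_osc)
    then obtain L where L: "ell1 a \<le> ennreal L" "L \<ge> 0" by (cases "ell1 a") auto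
    have "L2 (synth a)" by (rule L2_bounded[where B = L]) (use norm_synth_le[OF L] in auto)
    then have ae: "AE x in torus. v r x = synth a x"
      by (rule L2_fourier_coeff_eq_imp_AE_eq[OF v_L2]) (subst fourier_coeff_synth[OF fa], simp add: a_def)
    have "fourier_coeff (\<lambda>x. of_real ((norm (v r x))\<^sup>2) * v r x) n = fourier_coeff (\<lambda>x. of_real ((norm (synth a x))\<^sup>2) * synth a x) n"
      by (subst (1 2) fourier_coeff_eq, measurable)
         (intro arg_cong2[where f = "(/)"] refl integral_cong_AE, use ae in \<open>auto elim: eventually_mono\<close>)
    then show ?thesis
      using fourier_coeff_cubic[OF fin[OF r], of a \<sigma> r n] by (simp add: a_def fourier_coeff_osc)
  qed
  have m: "(\<lambda>r. fourier_coeff (\<lambda>x. of_real ((norm (v r x))\<^sup>2) * v r x) n) \<in> borel_measurable borel"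
    by (subst fourier_coeff_eq) measurable
  have "(LINT r|segm s t. chr (\<sigma> * n\<^sup>2) r * fourier_coeff (\<lambda>x. of_real ((norm (v r x))\<^sup>2) * v r x) n)
    = (LINT r|segm s t. cubic \<sigma> r (osc r) n)"
    by (rule integral_cong_AE) (use m cubic_measurable[OF osc_measurable] eq in \<open>auto simp: AE_segm\<close>)
  then show ?thesis using duhamel[OF st, of n] by (simp add: osc_def)
qed

lemma osc_diff_ell1:
  assumes st: "0 \<le> s" "s \<le> t" "t \<le> T" and L: "\<And>r. r \<in> {s..t} \<Longrightarrow> ell1 (osc r) \<le> ennreal L" "L \<ge> 0"
  shows "ell1 (\<lambda>n. osc t n - osc s n) \<le> ennreal (\<bar>\<kappa>\<bar> * (t - s) * L ^ 3)"
proof -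
  have fin: "ell1 (osc r) < \<infinity>" if "r \<in> {s..t}" for r using L(1)[OF that] by (auto intro: le_less_trans)
  have "ell1 (\<lambda>n. osc t n - osc s n) = ennreal (norm (- \<i> * of_real \<kappa>)) * ell1 (\<lambda>n. LINT r|segm s t. cubic \<sigma> r (osc r) n)"
  proof -
    have "osc t n - osc s n = - \<i> * of_real \<kappa> * (LINT r|segm s t. cubic \<sigma> r (osc r) n)" for n
      by (rule osc_diff_cubic) (use st fin in auto)
    then show ?thesis by (simp only: ell1_cmult)
  qed
  also have "\<dots> \<le> ennreal (norm (- \<i> * of_real \<kappa>)) * ennreal (L ^ 3 * (t - s))"
  proof (intro mult_left_mono ell1_integral_le cubic_measurable osc_measurable)
    fix r assume r: "r \<in> {s..t}"
    have "ell1 (cubic \<sigma> r (osc r)) \<le> ell1 (osc r) ^ 3" by (rule ell1_cubic_le)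
    also have "\<dots> \<le> ennreal L ^ 3" by (intro power_mono L r) auto
    finally show "ell1 (cubic \<sigma> r (osc r)) \<le> ennreal (L ^ 3)" using L by (simp add: ennreal_power)
  qed (use L st in auto)
  also have "\<dots> = ennreal (\<bar>\<kappa>\<bar> * (t - s) * L ^ 3)"
    using L st by (simp add: norm_mult mult_ac flip: ennreal_mult)
  finally show ?thesis .
qed

text \<open>\<open>P\<close> is the step with coefficients frozen at \<open>s\<close>, and
  \<open>Q\<close> integrates the error of freezing. The constant is 5 = 2 + 3: 2 from the
  second-order lengthening in \<open>frozen_step\<close>, 3 from the trilinear difference bound
  applied to a drift of at most \<open>\<bar>\<kappa>\<bar> * (t - s) * L ^ 3\<close>.\<close>

lemma path_step:
  assumes st: "0 \<le> s" "s \<le> t" "t \<le> T" and L: "\<And>r. r \<in> {s..t} \<Longrightarrow> ell1 (osc r) \<le> ennreal L" "L \<ge> 0"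
  shows "ell1 (osc t) \<le> ell1 (osc s) + ennreal (\<bar>\<kappa>\<bar> * L ^ 3 + 5 * \<kappa>\<^sup>2 * (t - s)\<^sup>2 * L ^ 5)"
proof -
  have fin: "ell1 (osc r) < \<infinity>" if "r \<in> {s..t}" for r using L(1)[OF that] by (auto intro: le_less_trans)
  note [measurable] = cubic_measurable[OF osc_measurable]
  have [measurable]: "(\<lambda>r. cubic \<sigma> r (osc s) n) \<in> borel_measurable borel" for n
    by (rule cubic_measurable) simp
  define P where "P = (\<lambda>n. osc s n - \<i> * of_real \<kappa> * (LINT r|segm s t. cubic \<sigma> r (osc s) n))"
  define Q where "Q = (\<lambda>n. LINT r|segm s t. cubic \<sigma> r (osc r) n - cubic \<sigma> r (osc s) n)"
  have bd: "ell1 (cubic \<sigma> r a) \<le> ennreal (L ^ 3)" if "ell1 a \<le> ennreal L" for a r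
  proof -
    have "ell1 (cubic \<sigma> r a) \<le> ell1 a ^ 3" by (rule ell1_cubic_le)
    also have "\<dots> \<le> ennreal L ^ 3" by (intro power_mono that) auto
    finally show ?thesis using L by (simp add: ennreal_power)
  qed
  have int: "integrable (segm s t) (\<lambda>r. cubic \<sigma> r (osc r) n)" "integrable (segm s t) (\<lambda>r. cubic \<sigma> r (osc s) n)" for n
    using L st ell1_le_norm[OF bd, of "osc _" _ n]
    by (auto intro!: integrable_segm_bounded[where B = "L ^ 3"])
  have eq: "osc t n = P n + (- \<i> * of_real \<kappa>) * Q n" for n
  proof -
    have "osc t n - osc s n = - \<i> * of_real \<kappa> * (LINT r|segm s t. cubic \<sigma> r (osc r) n)"
      by (rule osc_diff_cubic) (use st fin in auto)
    then show ?thesis using int[of n] by (simp add: P_def Q_def algebra_simps)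
  qed
  have "ell1 (osc t) \<le> ell1 P + ell1 (\<lambda>n. (- \<i> * of_real \<kappa>) * Q n)"
    unfolding eq by (rule ell1_add_le)
  also have "\<dots> = ell1 P + ennreal \<bar>\<kappa>\<bar> * ell1 Q"
    by (subst ell1_cmult) (simp add: norm_mult)
  also have "\<dots> \<le> (ell1 (osc s) * ennreal (1 + (\<kappa> * (t - s) * (2 * L\<^sup>2))\<^sup>2 / 2) + ennreal (\<bar>\<kappa>\<bar> * L ^ 3))
      + ennreal \<bar>\<kappa>\<bar> * ennreal ((3 * L\<^sup>2 * (\<bar>\<kappa>\<bar> * (t - s) * L ^ 3)) * (t - s))"
  proof (intro add_mono mult_left_mono)
    show "ell1 P \<le> ell1 (osc s) * ennreal (1 + (\<kappa> * (t - s) * (2 * L\<^sup>2))\<^sup>2 / 2) + ennreal (\<bar>\<kappa>\<bar> * L ^ 3)"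
      unfolding P_def by (rule frozen_step[OF L(1) L(2) \<sigma> st(2)]) (use st in auto)
    show "ell1 Q \<le> ennreal ((3 * L\<^sup>2 * (\<bar>\<kappa>\<bar> * (t - s) * L ^ 3)) * (t - s))"
      unfolding Q_def
    proof (rule ell1_integral_le)
      fix r assume r: "r \<in> {s..t}"
      show "ell1 (\<lambda>n. cubic \<sigma> r (osc r) n - cubic \<sigma> r (osc s) n) \<le> ennreal (3 * L\<^sup>2 * (\<bar>\<kappa>\<bar> * (t - s) * L ^ 3))"
      proof (rule ell1_cubic_diff_le[OF L(1)[OF r] L(1)])
        have "ell1 (\<lambda>n. osc r n - osc s n) \<le> ennreal (\<bar>\<kappa>\<bar> * (r - s) * L ^ 3)"
          by (rule osc_diff_ell1) (use st r L in auto)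
        also have "\<dots> \<le> ennreal (\<bar>\<kappa>\<bar> * (t - s) * L ^ 3)"
          using r L by (intro ennreal_leI mult_right_mono mult_left_mono) auto
        finally show "ell1 (\<lambda>n. osc r n - osc s n) \<le> ennreal (\<bar>\<kappa>\<bar> * (t - s) * L ^ 3)" .
      qed (use st L in auto)
    qed (use st L in auto)
  qed auto
  also have "ell1 (osc s) * ennreal (1 + (\<kappa> * (t - s) * (2 * L\<^sup>2))\<^sup>2 / 2) \<le> ell1 (osc s) + ennreal (2 * \<kappa>\<^sup>2 * (t - s)\<^sup>2 * L ^ 5)"
  proof -
    have "ell1 (osc s) * ennreal (1 + (\<kappa> * (t - s) * (2 * L\<^sup>2))\<^sup>2 / 2) = ell1 (osc s) + ell1 (osc s) * ennreal ((\<kappa> * (t - s) * (2 * L\<^sup>2))\<^sup>2 / 2)"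
      by (subst ennreal_plus) (auto simp: distrib_left)
    also have "\<dots> \<le> ell1 (osc s) + ennreal L * ennreal ((\<kappa> * (t - s) * (2 * L\<^sup>2))\<^sup>2 / 2)"
      by (intro add_left_mono mult_right_mono L) (use st in auto)
    also have "ennreal L * ennreal ((\<kappa> * (t - s) * (2 * L\<^sup>2))\<^sup>2 / 2) = ennreal (2 * \<kappa>\<^sup>2 * (t - s)\<^sup>2 * L ^ 5)"
    proof -
      have "L * ((\<kappa> * d * (2 * L\<^sup>2))\<^sup>2 / 2) = 2 * \<kappa>\<^sup>2 * d\<^sup>2 * L ^ 5" for d
        by (simp add: power_mult_distrib eval_nat_numeral mult_ac)
      then show ?thesis using L by (simp only: ennreal_mult[symmetric] zero_le_power2 divide_nonneg_pos zero_less_numeral)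
    qed
    finally show ?thesis .
  qed
  also have "ennreal \<bar>\<kappa>\<bar> * ennreal ((3 * L\<^sup>2 * (\<bar>\<kappa>\<bar> * (t - s) * L ^ 3)) * (t - s)) = ennreal (3 * \<kappa>\<^sup>2 * (t - s)\<^sup>2 * L ^ 5)"
  proof -
    have "\<bar>\<kappa>\<bar> * ((3 * L\<^sup>2 * (\<bar>\<kappa>\<bar> * (t - s) * L ^ 3)) * (t - s)) = 3 * \<bar>\<kappa>\<bar>\<^sup>2 * (t - s)\<^sup>2 * L ^ 5"
      by (simp add: eval_nat_numeral mult_ac del: abs_mult_self_eq)
    then show ?thesis using L st by (simp add: ennreal_mult[symmetric])
  qed
  finally have "ell1 (osc t) \<le> ell1 (osc s) + (ennreal (2 * \<kappa>\<^sup>2 * (t - s)\<^sup>2 * L ^ 5) + ennreal (\<bar>\<kappa>\<bar> * L ^ 3) + ennreal (3 * \<kappa>\<^sup>2 * (t - s)\<^sup>2 * L ^ 5))"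
    by (simp add: add.assoc)
  also have "(ennreal (2 * \<kappa>\<^sup>2 * (t - s)\<^sup>2 * L ^ 5) + ennreal (\<bar>\<kappa>\<bar> * L ^ 3) + ennreal (3 * \<kappa>\<^sup>2 * (t - s)\<^sup>2 * L ^ 5))
    = ennreal (\<bar>\<kappa>\<bar> * L ^ 3 + 5 * \<kappa>\<^sup>2 * (t - s)\<^sup>2 * L ^ 5)"
    using L by (simp flip: ennreal_plus add: algebra_simps)
  finally show ?thesis .
qed

text \<open>Since \<open>L\<close> is assumed on the whole interval, the cost of a step depends only
  on \<open>L\<close>, and the costs of \<open>N\<close> equal steps add up without compounding. The
  assumption is discharged in \<open>path_bound\<close>.\<close>

lemma path_apriori:
  assumes t: "0 \<le> t" "t \<le> T" and L: "\<And>r. r \<in> {0..t} \<Longrightarrow> ell1 (osc r) \<le> ennreal L" "L \<ge> 0" and N: "N > 0"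
  shows "ell1 (osc t) \<le> ell1 (osc 0) + ennreal (real N * (\<bar>\<kappa>\<bar> * L ^ 3 + 5 * \<kappa>\<^sup>2 * (t / real N)\<^sup>2 * L ^ 5))"
proof -
  define \<eta> where "\<eta> = t / real N"
  define c where "c = \<bar>\<kappa>\<bar> * L ^ 3 + 5 * \<kappa>\<^sup>2 * \<eta>\<^sup>2 * L ^ 5"
  have c0: "c \<ge> 0" using L by (simp add: c_def)
  have \<eta>0: "\<eta> \<ge> 0" using t by (simp add: \<eta>_def)
  have "ell1 (osc (real j * \<eta>)) \<le> ell1 (osc 0) + ennreal (real j * c)" if "j \<le> N" for j
    using that
  proof (induction j)
    case (Suc j)
    have le: "real (Suc j) * \<eta> \<le> t"
    proof -
      have "real (Suc j) * \<eta> \<le> real N * \<eta>" using Suc.prems \<eta>0 by (intro mult_right_mono) auto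
      then show ?thesis using N by (simp add: \<eta>_def)
    qed
    have "ell1 (osc (real (Suc j) * \<eta>)) \<le> ell1 (osc (real j * \<eta>)) +
      ennreal (\<bar>\<kappa>\<bar> * L ^ 3 + 5 * \<kappa>\<^sup>2 * (real (Suc j) * \<eta> - real j * \<eta>)\<^sup>2 * L ^ 5)"
    proof (rule path_step)
      show "0 \<le> real j * \<eta>" "real j * \<eta> \<le> real (Suc j) * \<eta>" "real (Suc j) * \<eta> \<le> T"
        using \<eta>0 le t by (auto simp: algebra_simps)
      show "ell1 (osc r) \<le> ennreal L" if "r \<in> {real j * \<eta>..real (Suc j) * \<eta>}" for r
      proof (rule L(1))
        have "0 \<le> real j * \<eta>" using \<eta>0 by simp
        then show "r \<in> {0..t}" using that le by auto
      qed
    qed fact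
    also have "real (Suc j) * \<eta> - real j * \<eta> = \<eta>" by (simp add: algebra_simps)
    also have "ell1 (osc (real j * \<eta>)) + ennreal (\<bar>\<kappa>\<bar> * L ^ 3 + 5 * \<kappa>\<^sup>2 * \<eta>\<^sup>2 * L ^ 5) \<le> (ell1 (osc 0) + ennreal (real j * c)) + ennreal c"
      unfolding c_def[symmetric] using Suc by (intro add_right_mono) auto
    also have "\<dots> = ell1 (osc 0) + ennreal (real (Suc j) * c)"
      using c0 by (simp add: algebra_simps flip: ennreal_plus)
    finally show ?case .
  qed simp
  from this[of N] show ?thesis using N by (simp add: \<eta>_def c_def)
qed

end

section \<open>Persistence of absolute summability\<close>

lemma integral_segm_point: "integral\<^sup>L (segm s s) f = 0"
  for f :: "real \<Rightarrow> 'b::{banach, second_countable_topology}"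
proof (rule integral_eq_zero_AE, unfold AE_segm)
  show "AE x in lborel. x \<in> {s..s} \<longrightarrow> f x = 0"
    using AE_lborel_singleton[of s] by eventually_elim auto
qed

lemma integral_segm_split:
  fixes f :: "real \<Rightarrow> complex"
  assumes [measurable]: "f \<in> borel_measurable borel" and "s \<le> r" "r \<le> t" and int: "integrable (segm s t) f"
  shows "integral\<^sup>L (segm s t) f = integral\<^sup>L (segm s r) f + integral\<^sup>L (segm r t) f"
proof -
  have i: "set_integrable lborel {s..t} f" using int by (simp add: integrable_segm)
  have i1: "set_integrable lborel {s..r} f" "set_integrable lborel {r..t} f"
    using assms by (auto intro: set_integrable_subset[OF i])
  have "set_lebesgue_integral lborel {s..t} f = (LINT x|lborel. indicat_real {s..r} x *\<^sub>R f x + indicat_real {r..t} x *\<^sub>R f x)"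
    unfolding set_lebesgue_integral_def
  proof (rule integral_cong_AE)
    have "AE x in lborel. x \<noteq> r" by (rule AE_lborel_singleton)
    then show "AE x in lborel. indicat_real {s..t} x *\<^sub>R f x = indicat_real {s..r} x *\<^sub>R f x + indicat_real {r..t} x *\<^sub>R f x"
      by eventually_elim (use assms in \<open>auto split: split_indicator\<close>)
  qed auto
  also have "\<dots> = set_lebesgue_integral lborel {s..r} f + set_lebesgue_integral lborel {r..t} f"
    using i1 by (simp add: set_integrable_def set_lebesgue_integral_def)
  finally show ?thesis by (simp add: integral_segm)
qed

lemma borel_measurable_integral_segm_upper:
  fixes f :: "real \<Rightarrow> complex"
  assumes [measurable]: "f \<in> borel_measurable borel"
  shows "(\<lambda>t. integral\<^sup>L (segm s t) f) \<in> borel_measurable borel"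
proof -
  have "(\<lambda>t. LINT r|lborel. (if s \<le> r \<and> r \<le> t then f r else 0)) \<in> borel_measurable borel"
    by measurable
  moreover have "integral\<^sup>L (segm s t) f = (LINT r|lborel. (if s \<le> r \<and> r \<le> t then f r else 0))" for t
    unfolding integral_segm[OF assms] set_lebesgue_integral_def
    by (intro Bochner_Integration.integral_cong) auto
  ultimately show ?thesis by simp
qed

text \<open>The distribution function of a finite density: monotone, and continuous as an indefinite
  integral. It measures how space-time mass accumulates and supplies the clocks of the
  Christ--Kiselev argument. The density may be infinite on a null set, which \<open>enn2real\<close>
  removes.\<close>

lemma mass_clock:
  fixes f :: "real \<Rightarrow> ennreal"
  assumes f [measurable]: "f \<in> borel_measurable borel" and fin: "nn_integral (segm s t) f \<le> ennreal a" and a: "a \<ge> 0" and st: "s \<le> t"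
  obtains A :: "real \<Rightarrow> real" where "mono A" "continuous_on {s..t} A" "A s = 0" "A t \<le> a"
    "\<And>u w. s \<le> u \<Longrightarrow> u \<le> w \<Longrightarrow> w \<le> t \<Longrightarrow> nn_integral (segm u w) f = ennreal (A w - A u)"
proof -
  define g where "g = (\<lambda>r. indicat_real {s..t} r * enn2real (f r))"
  have [measurable]: "g \<in> borel_measurable borel" unfolding g_def by measurable
  have g0: "g r \<ge> 0" for r by (simp add: g_def)
  have ae: "AE r in lborel. r \<in> {s..t} \<longrightarrow> f r \<noteq> \<infinity>"
  proof -
    have "nn_integral (segm s t) f \<noteq> \<infinity>" using le_less_trans[OF fin ennreal_less_top] by auto
    from nn_integral_PInf_AE[OF _ this] show ?thesis by (simp add: AE_segm)
  qed
  have fg: "nn_integral (segm u w) f = (\<integral>\<^sup>+r. ennreal (g r) \<partial>segm u w)" if "s \<le> u" "w \<le> t" for u w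
  proof (rule nn_integral_cong_AE, unfold AE_segm)
    show "AE r in lborel. r \<in> {u..w} \<longrightarrow> f r = ennreal (g r)"
      using ae by eventually_elim (use that in \<open>auto simp: g_def less_top\<close>)
  qed
  have int: "integrable lborel g"
  proof (rule integrableI_bounded)
    have "(\<integral>\<^sup>+r. ennreal (norm (g r)) \<partial>lborel) = (\<integral>\<^sup>+r\<in>{s..t}. ennreal (g r) \<partial>lborel)"
      by (intro nn_integral_cong) (auto simp: g_def split: split_indicator)
    also have "\<dots> = nn_integral (segm s t) f" using fg[of s t] by (simp add: nn_integral_segm)
    also have "\<dots> < \<infinity>" using fin by (auto intro: le_less_trans)
    finally show "(\<integral>\<^sup>+r. ennreal (norm (g r)) \<partial>lborel) < \<infinity>" .
  qed measurable
  have ints: "set_integrable lborel {u..w} g" for u w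
    unfolding set_integrable_def by (rule integrable_mult_indicator[OF _ int]) simp
  define A where "A = (\<lambda>r. LINT x:{s..r}|lborel. g x)"
  have Adiff: "A w - A u = (LINT x:{u..w}|lborel. g x)" if "s \<le> u" "u \<le> w" for u w
  proof -
    have "A w = A u + (LINT x:{u..w}|lborel. g x)"
    proof -
      have "A w = (LINT x|lborel. indicat_real {s..u} x *\<^sub>R g x + indicat_real {u..w} x *\<^sub>R g x)"
        unfolding A_def set_lebesgue_integral_def
      proof (rule integral_cong_AE)
        have "AE x in lborel. x \<noteq> u" by (rule AE_lborel_singleton)
        then show "AE x in lborel. indicat_real {s..w} x *\<^sub>R g x = indicat_real {s..u} x *\<^sub>R g x + indicat_real {u..w} x *\<^sub>R g x"
          by eventually_elim (use that in \<open>auto split: split_indicator\<close>)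
      qed auto
      then show ?thesis using ints by (simp add: A_def set_integrable_def set_lebesgue_integral_def)
    qed
    then show ?thesis by simp
  qed
  have mass: "nn_integral (segm u w) f = ennreal (A w - A u)" if "s \<le> u" "u \<le> w" "w \<le> t" for u w
  proof -
    have "nn_integral (segm u w) f = (\<integral>\<^sup>+r. ennreal (g r) \<partial>segm u w)" using fg that by simp
    also have "\<dots> = ennreal (LINT r|segm u w. g r)"
      using ints g0 by (intro nn_integral_eq_integral) (auto simp: integrable_segm)
    also have "\<dots> = ennreal (A w - A u)" using that by (simp add: Adiff integral_segm)
    finally show ?thesis .
  qed
  have "mono A"
  proof (rule monoI)
    fix u w :: real assume uw: "u \<le> w"
    show "A u \<le> A w" unfolding A_def set_lebesgue_integral_def
      using ints[of s u] ints[of s w] uw g0 unfolding set_integrable_def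
      by (intro integral_mono) (auto split: split_indicator)
  qed
  moreover have "continuous_on {s..t} A"
  proof -
    have "g integrable_on {s..t}" by (rule set_borel_integral_eq_integral(1)[OF ints])
    moreover have "A = (\<lambda>r. integral {s..r} g)"
      unfolding A_def set_borel_integral_eq_integral(2)[OF ints] ..
    ultimately
    show ?thesis using indefinite_integral_continuous_1[of g s t] by simp
  qed
  moreover have "A s = 0"
    using integral_segm_point[of s g] by (simp add: A_def integral_segm)
  moreover have "A t \<le> a"
    using mass[of s t] fin st \<open>A s = 0\<close> a by (simp add: ennreal_le_iff)
  ultimately show ?thesis using that mass by blast
qed

lemma nn_integral_power4_finite_AE:
  assumes [measurable]: "(\<lambda>(r, x). f r x) \<in> borel_measurable (borel \<Otimes>\<^sub>M borel)"
    and fin: "(\<integral>\<^sup>+r. \<integral>\<^sup>+x. ennreal (norm (f r x) ^ 4) \<partial>torus \<partial>segm s t) < \<infinity>"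
  shows "AE r in segm s t. (\<integral>\<^sup>+x. ennreal (norm (f r x) ^ 4) \<partial>torus) < \<infinity>"
proof -
  have "AE r in segm s t. (\<integral>\<^sup>+x. ennreal (norm (f r x) ^ 4) \<partial>torus) \<noteq> \<infinity>"
    by (rule nn_integral_PInf_AE) (use fin in auto)
  then show ?thesis by eventually_elim (simp add: less_top)
qed

lemma power3_le_power4: "u \<ge> 0 \<Longrightarrow> u ^ 3 \<le> 1 + u ^ 4" for u :: real
proof (cases "u \<le> 1")
  case True
  assume u: "u \<ge> 0"
  with True have "u ^ 3 \<le> 1" by (simp add: power_le_one)
  then show ?thesis using u by (simp add: add_increasing2)
next
  case False
  then have "u ^ 3 \<le> u ^ 4" by (intro power_increasing) auto
  then show ?thesis by simp
qed

lemma norm_cubic_le: "norm (of_real ((norm z)\<^sup>2) * z * chr n x) \<le> 1 + norm z ^ 4"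
  using power3_le_power4[of "norm z"] by (simp add: norm_mult eval_nat_numeral mult_ac)

lemma integrable_power4_cubic:
  assumes [measurable]: "f \<in> borel_measurable borel" and fin: "(\<integral>\<^sup>+x. ennreal (norm (f x) ^ 4) \<partial>torus) < \<infinity>"
  shows "integrable torus (\<lambda>x. of_real ((norm (f x))\<^sup>2) * f x * chr n x)"
proof -
  have i4: "integrable torus (\<lambda>x. norm (f x) ^ 4)" using fin by (intro integrableI_bounded) auto
  have i1: "integrable torus (\<lambda>x. 1 + norm (f x) ^ 4)" using i4 by simp
  show ?thesis
    by (rule Bochner_Integration.integrable_bound[OF i1]) (measurable, rule AE_I2, rule order_trans[OF norm_cubic_le], simp)
qed

lemma integrable_fourier_coeff_cubic:
  assumes [measurable]: "(\<lambda>(r, x). v r x) \<in> borel_measurable (borel \<Otimes>\<^sub>M borel)"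
    and fin: "(\<integral>\<^sup>+r. \<integral>\<^sup>+x. ennreal (norm (v r x) ^ 4) \<partial>torus \<partial>segm u w) < \<infinity>"
  shows "integrable (segm u w) (\<lambda>r. chr m r * fourier_coeff (\<lambda>x. of_real ((norm (v r x))\<^sup>2) * v r x) n)"
    (is "integrable _ ?f")
proof (rule integrableI_bounded)
  have [measurable]: "v r \<in> borel_measurable borel" for r by measurable
  show "?f \<in> borel_measurable (segm u w)" by (subst fourier_coeff_eq) measurable
  have "(\<integral>\<^sup>+r. ennreal (norm (?f r)) \<partial>segm u w) \<le> (\<integral>\<^sup>+r. \<integral>\<^sup>+x. ennreal (1 + norm (v r x) ^ 4) \<partial>torus \<partial>segm u w)"
  proof (rule nn_integral_mono)
    fix r
    have "norm (?f r) \<le> norm (LINT x|torus. of_real ((norm (v r x))\<^sup>2) * v r x * chr (-n) x)"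
    proof -
      have "norm z / (2 * pi) \<le> norm z" for z :: complex
        using pi_ge_two mult_left_mono[of 1 "2 * pi" "norm z"] by (simp add: divide_le_eq)
      then show ?thesis by (subst fourier_coeff_eq) (simp_all add: norm_mult norm_divide)
    qed
    then have "ennreal (norm (?f r)) \<le> ennreal (norm (LINT x|torus. of_real ((norm (v r x))\<^sup>2) * v r x * chr (-n) x))"
      by (rule ennreal_leI)
    also have "\<dots> \<le> (\<integral>\<^sup>+x. ennreal (norm (of_real ((norm (v r x))\<^sup>2) * v r x * chr (-n) x)) \<partial>torus)"
      by (rule ennreal_norm_integral_le)
    also have "\<dots> \<le> (\<integral>\<^sup>+x. ennreal (1 + norm (v r x) ^ 4) \<partial>torus)"
      by (intro nn_integral_mono ennreal_leI norm_cubic_le)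
    finally show "ennreal (norm (?f r)) \<le> (\<integral>\<^sup>+x. ennreal (1 + norm (v r x) ^ 4) \<partial>torus)" .
  qed
  also have "\<dots> = (\<integral>\<^sup>+r. ennreal (2 * pi) \<partial>segm u w) + (\<integral>\<^sup>+r. \<integral>\<^sup>+x. ennreal (norm (v r x) ^ 4) \<partial>torus \<partial>segm u w)"
    by (simp add: nn_integral_add emeasure_segm)
  also have "\<dots> < \<infinity>" using fin by (simp add: emeasure_segm ennreal_mult_less_top)
  finally show "(\<integral>\<^sup>+r. ennreal (norm (?f r)) \<partial>segm u w) < \<infinity>" .
qed

text \<open>Puts the difference of two nonlinearities in the form potential times error, the
  factorised shape \<open>V * W\<close> required by \<open>dual_estimate\<close>.\<close>

lemma cubic_difference_le:
  fixes x y :: complex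
  shows "norm (of_real ((norm x)\<^sup>2) * x - of_real ((norm y)\<^sup>2) * y) \<le> (2 * ((norm x)\<^sup>2 + (norm y)\<^sup>2)) * norm (x - y)"
proof -
  define a b d where "a = norm x" "b = norm y" "d = norm (x - y)"
  have nn: "a \<ge> 0" "b \<ge> 0" "d \<ge> 0" by (simp_all add: a_b_d_def)
  have d: "\<bar>a - b\<bar> \<le> d" unfolding a_b_d_def by (rule norm_triangle_ineq3)
  have "of_real (a\<^sup>2) * x - of_real (b\<^sup>2) * y = of_real (a\<^sup>2) * (x - y) + of_real (a\<^sup>2 - b\<^sup>2) * y"
    by (simp add: algebra_simps)
  then have "norm (of_real (a\<^sup>2) * x - of_real (b\<^sup>2) * y) \<le> norm (of_real (a\<^sup>2) * (x - y)) + norm (of_real (a\<^sup>2 - b\<^sup>2) * y)"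
    by (metis norm_triangle_ineq)
  also have "\<dots> = a\<^sup>2 * d + \<bar>a\<^sup>2 - b\<^sup>2\<bar> * b" by (simp only: norm_mult norm_of_real abs_power2 a_b_d_def)
  also have "\<bar>a\<^sup>2 - b\<^sup>2\<bar> = \<bar>a - b\<bar> * (a + b)"
    using nn by (simp add: power2_eq_square square_diff_square_factored abs_mult)
  also have "a\<^sup>2 * d + \<bar>a - b\<bar> * (a + b) * b \<le> a\<^sup>2 * d + d * (a + b) * b"
    using nn d by (intro add_left_mono mult_right_mono) auto
  also have "\<dots> = (a\<^sup>2 + a * b + b\<^sup>2) * d" by (simp add: power2_eq_square algebra_simps)
  also have "\<dots> \<le> (2 * (a\<^sup>2 + b\<^sup>2)) * d"
  proof (rule mult_right_mono[OF _ nn(3)])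
    have "q + p + r \<le> 2 * (q + r)" if "2 * p \<le> q + r" "0 \<le> p" for p q r :: real using that by simp
    from this[of "a * b"] show "a\<^sup>2 + a * b + b\<^sup>2 \<le> 2 * (a\<^sup>2 + b\<^sup>2)"
      using sum_squares_bound[of a b] mult_nonneg_nonneg[OF nn(1,2)] by (simp add: mult.assoc)
  qed
  finally show ?thesis by (simp only: a_b_d_def)
qed

section \<open>Picard iteration from a summable datum\<close>

context nls_path
begin

text \<open>The iteration starts from zero, not from the free wave, so that the first error is the
  solution itself, controlled by its \<open>L\<^sup>4\<close> mass.\<close>

primrec iterate :: "real \<Rightarrow> nat \<Rightarrow> real \<Rightarrow> int \<Rightarrow> complex" where
  "iterate s 0 r n = 0"
| "iterate s (Suc k) r n = osc s n - \<i> * of_real \<kappa> * (LINT r'|segm s r. cubic \<sigma> r' (iterate s k r') n)"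

lemma iterate_measurable [measurable]: "(\<lambda>r. iterate s k r n) \<in> borel_measurable borel"
proof (induction k arbitrary: n)
  case (Suc k)
  have "(\<lambda>r. cubic \<sigma> r (iterate s k r) n) \<in> borel_measurable borel" for n
    by (rule cubic_measurable) (rule Suc)
  from borel_measurable_integral_segm_upper[OF this] show ?case by simp
qed simp

lemma cubic_iterate_measurable [measurable]: "(\<lambda>r. cubic \<sigma> r (iterate s k r) n) \<in> borel_measurable borel"
  by (rule cubic_measurable) measurable

text \<open>The ball of radius \<open>2 * R\<close> is invariant: to a datum of norm at most
  \<open>R\<close> is added a Duhamel term of at most
  \<open>\<bar>\<kappa>\<bar> * (t - s) * (2 * R) ^ 3\<close>, and the smallness condition, with 8
  the cube of 2, makes this at most \<open>R\<close>.\<close>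

lemma ell1_iterate_le:
  assumes R: "ell1 (osc s) \<le> ennreal R" "R \<ge> 0" and small: "\<bar>\<kappa>\<bar> * (t - s) * (8 * R\<^sup>2) \<le> 1" and r: "r \<in> {s..t}"
  shows "ell1 (iterate s k r) \<le> ennreal (2 * R)"
  using r
proof (induction k arbitrary: r)
  case (Suc k)
  have "ell1 (iterate s (Suc k) r) = ell1 (\<lambda>n. osc s n + (- \<i> * of_real \<kappa>) * (LINT r'|segm s r. cubic \<sigma> r' (iterate s k r') n))"
    by (simp add: ell1_def)
  also have "\<dots> \<le> ell1 (osc s) + ell1 (\<lambda>n. (- \<i> * of_real \<kappa>) * (LINT r'|segm s r. cubic \<sigma> r' (iterate s k r') n))"
    by (rule ell1_add_le)
  also have "\<dots> = ell1 (osc s) + ennreal \<bar>\<kappa>\<bar> * ell1 (\<lambda>n. LINT r'|segm s r. cubic \<sigma> r' (iterate s k r') n)"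
    by (subst ell1_cmult) (simp add: norm_mult)
  also have "\<dots> \<le> ennreal R + ennreal \<bar>\<kappa>\<bar> * ennreal ((2 * R) ^ 3 * (r - s))"
  proof (intro add_mono mult_left_mono ell1_integral_le R)
    fix r' assume r': "r' \<in> {s..r}"
    have "ell1 (cubic \<sigma> r' (iterate s k r')) \<le> ell1 (iterate s k r') ^ 3" by (rule ell1_cubic_le)
    also have "\<dots> \<le> ennreal (2 * R) ^ 3" using Suc r' by (intro power_mono Suc.IH) auto
    finally show "ell1 (cubic \<sigma> r' (iterate s k r')) \<le> ennreal ((2 * R) ^ 3)"
      using R by (simp add: ennreal_power)
  qed (use R Suc in auto)
  also have "\<dots> = ennreal (R + \<bar>\<kappa>\<bar> * ((2 * R) ^ 3 * (r - s)))"
    using R Suc by (simp add: ennreal_mult[symmetric] ennreal_plus[symmetric] del: ennreal_plus)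
  also have "\<dots> \<le> ennreal (2 * R)"
  proof (rule ennreal_leI)
    have "\<bar>\<kappa>\<bar> * ((2 * R) ^ 3 * (r - s)) = (\<bar>\<kappa>\<bar> * (r - s) * (8 * R\<^sup>2)) * R"
      by (simp add: power3_eq_cube power2_eq_square)
    also have "\<dots> \<le> (\<bar>\<kappa>\<bar> * (t - s) * (8 * R\<^sup>2)) * R"
      using Suc R by (intro mult_right_mono mult_left_mono) auto
    also have "\<dots> \<le> 1 * R" using small R by (intro mult_right_mono) auto
    finally show "R + \<bar>\<kappa>\<bar> * ((2 * R) ^ 3 * (r - s)) \<le> 2 * R" by simp
  qed
  finally show ?case .
qed (simp add: ell1_def)

definition iterate_field :: "real \<Rightarrow> nat \<Rightarrow> real \<Rightarrow> real \<Rightarrow> complex" where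
  "iterate_field s k r x = synth (\<lambda>n. chr (- \<sigma> * n\<^sup>2) r * iterate s k r n) x"

lemma iterate_field_measurable [measurable]:
  "(\<lambda>(r, x). iterate_field s k r x) \<in> borel_measurable (borel \<Otimes>\<^sub>M borel)"
proof -
  have "(\<lambda>z. LINT n|ints. chr (- \<sigma> * n\<^sup>2) (fst z) * iterate s k (fst z) n * chr n (snd z)) \<in> borel_measurable (borel \<Otimes>\<^sub>M borel)"
    by (rule borel_measurable_integral_count_space) measurable
  then show ?thesis by (simp add: iterate_field_def synth_def case_prod_unfold)
qed

lemma iterate_field_measurable1 [measurable]: "iterate_field s k r \<in> borel_measurable borel"
  unfolding iterate_field_def by measurable

text \<open>
  One step of the contraction: the error of the next Picard iterate is a Duhamel integral whose
  increments are controlled by the dual estimate, so the Christ--Kiselev argument applies.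
\<close>
lemma picard_error:
  assumes st: "0 \<le> s" "s \<le> t" "t \<le> T" "t \<le> s + 2 * pi"
    and R: "ell1 (osc s) \<le> ennreal R" "R \<ge> 0" and small: "\<bar>\<kappa>\<bar> * (t - s) * (8 * R\<^sup>2) \<le> 1"
    and a: "a > 0" "(\<integral>\<^sup>+r. \<integral>\<^sup>+x. ennreal ((2 * ((norm (v r x))\<^sup>2 + (norm (iterate_field s k r x))\<^sup>2))\<^sup>2) \<partial>torus \<partial>segm s t) \<le> ennreal a"
    and b: "b > 0" "(\<integral>\<^sup>+r. \<integral>\<^sup>+x. ennreal (norm (v r x - iterate_field s k r x) ^ 4) \<partial>torus \<partial>segm s t) \<le> ennreal b"
  shows "(\<integral>\<^sup>+r. \<integral>\<^sup>+x. ennreal (norm (v r x - iterate_field s (Suc k) r x) ^ 4) \<partial>torus \<partial>segm s t)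
      \<le> ennreal (2 ^ 20 * pi\<^sup>2 * (64 * pi\<^sup>2 * \<kappa> ^ 4 * (a\<^sup>2 * b)))"
    and "\<And>r A. r \<in> {s..t} \<Longrightarrow> finite A \<Longrightarrow> (\<Sum>n\<in>A. (norm (osc r n - iterate s (Suc k) r n))\<^sup>2)\<^sup>2 \<le> 64 * pi\<^sup>2 * \<kappa> ^ 4 * (a\<^sup>2 * b)"
proof -
  define D where "D = 64 * pi\<^sup>2 * \<kappa> ^ 4 * (a\<^sup>2 * b)"
  define V where "V = (\<lambda>r x. 2 * ((norm (v r x))\<^sup>2 + (norm (iterate_field s k r x))\<^sup>2))"
  define W where "W = (\<lambda>r x. norm (v r x - iterate_field s k r x))"
  define G where "G = (\<lambda>r x. of_real ((norm (v r x))\<^sup>2) * v r x - of_real ((norm (iterate_field s k r x))\<^sup>2) * iterate_field s k r x)"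
  define y where "y = (\<lambda>n r. osc r n - iterate s (Suc k) r n)"
  have [measurable]: "(\<lambda>(r, x). V r x) \<in> borel_measurable (borel \<Otimes>\<^sub>M borel)"
    "(\<lambda>(r, x). W r x) \<in> borel_measurable (borel \<Otimes>\<^sub>M borel)"
    "(\<lambda>(r, x). G r x) \<in> borel_measurable (borel \<Otimes>\<^sub>M borel)"
    unfolding V_def W_def G_def by measurable
  have GVW: "norm (G r x) \<le> V r x * W r x" for r x
    unfolding G_def V_def W_def by (rule cubic_difference_le)
  have D0: "D \<ge> 0" using a b by (simp add: D_def)
  obtain A1 where A1: "mono A1" "continuous_on {s..t} A1" "A1 s = 0" "A1 t \<le> a"
    "\<And>u w. s \<le> u \<Longrightarrow> u \<le> w \<Longrightarrow> w \<le> t \<Longrightarrow> (\<integral>\<^sup>+r. \<integral>\<^sup>+x. ennreal ((V r x)\<^sup>2) \<partial>torus \<partial>segm u w) = ennreal (A1 w - A1 u)"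
    by (rule mass_clock[of "\<lambda>r. \<integral>\<^sup>+x. ennreal ((V r x)\<^sup>2) \<partial>torus" s t a]) (use a st in \<open>auto simp: V_def\<close>)
  obtain B1 where B1: "mono B1" "continuous_on {s..t} B1" "B1 s = 0" "B1 t \<le> b"
    "\<And>u w. s \<le> u \<Longrightarrow> u \<le> w \<Longrightarrow> w \<le> t \<Longrightarrow> (\<integral>\<^sup>+r. \<integral>\<^sup>+x. ennreal (W r x ^ 4) \<partial>torus \<partial>segm u w) = ennreal (B1 w - B1 u)"
    by (rule mass_clock[of "\<lambda>r. \<integral>\<^sup>+x. ennreal (W r x ^ 4) \<partial>torus" s t b]) (use b st in \<open>auto simp: W_def\<close>)
  \<comment> \<open>The mean of the normalised clocks of \<open>V\<^sup>2\<close> and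
    \<open>W\<^sup>4\<close>. Each normalised increment is at most twice the increment of
    \<open>h\<close>, so two factors from \<open>V\<close> and one from \<open>W\<close> give the
    cube of that increment, the power needed for Christ--Kiselev. The 64 in \<open>D\<close> is the
    resulting 8 times the 8 of the dual estimate.\<close>
  define h where "h = (\<lambda>r. (A1 r / a + B1 r / b) / 2)"
  have bdi: "ell1 (iterate s k r) \<le> ennreal (2 * R)" if "r \<in> {s..t}" for r
    by (rule ell1_iterate_le[OF R small that])
  have cub: "chr (\<sigma> * n\<^sup>2) r * fourier_coeff (\<lambda>x. of_real ((norm (iterate_field s k r x))\<^sup>2) * iterate_field s k r x) n
     = cubic \<sigma> r (iterate s k r) n" if "r \<in> {s..t}" for r n
    unfolding iterate_field_def
    by (rule fourier_coeff_cubic) (use bdi[OF that] in \<open>auto intro: le_less_trans\<close>)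
  have cubb: "norm (cubic \<sigma> r (iterate s k r) n) \<le> (2 * R) ^ 3" if "r \<in> {s..t}" for r n
  proof (rule ell1_le_norm)
    have "ell1 (cubic \<sigma> r (iterate s k r)) \<le> ell1 (iterate s k r) ^ 3" by (rule ell1_cubic_le)
    also have "\<dots> \<le> ennreal (2 * R) ^ 3" by (intro power_mono bdi that) auto
    finally show "ell1 (cubic \<sigma> r (iterate s k r)) \<le> ennreal ((2 * R) ^ 3)" using R by (simp add: ennreal_power)
  qed (use R in simp)
  have fin4: "(\<integral>\<^sup>+r. \<integral>\<^sup>+x. ennreal (norm (v r x) ^ 4) \<partial>torus \<partial>segm u w) < \<infinity>" if "s \<le> u" "w \<le> t" for u w
  proof (rule le_less_trans[OF nn_integral_segm_mono v_L4])
    show "{u..w} \<subseteq> {0..T}" using that st by auto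
  qed measurable
  have inc_eq: "y n w - y n u = - \<i> * of_real \<kappa> * (LINT r|segm u w. chr (\<sigma> * n\<^sup>2) r * fourier_coeff (G r) n)"
    if uw: "s \<le> u" "u \<le> w" "w \<le> t" for u w n
  proof -
    define f1 where "f1 = (\<lambda>r. chr (\<sigma> * n\<^sup>2) r * fourier_coeff (\<lambda>x. of_real ((norm (v r x))\<^sup>2) * v r x) n)"
    define f2 where "f2 = (\<lambda>r. cubic \<sigma> r (iterate s k r) n)"
    have [measurable]: "f1 \<in> borel_measurable borel"
      unfolding f1_def by (subst fourier_coeff_eq) measurable
    have [measurable]: "f2 \<in> borel_measurable borel"
      unfolding f2_def by (rule cubic_iterate_measurable)
    have i2: "integrable (segm u' w') f2" if "s \<le> u'" "w' \<le> t" for u' w'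
      unfolding f2_def by (rule integrable_segm_bounded[where B = "(2 * R) ^ 3"]) (use that cubb in auto)
    have i1: "integrable (segm u w) f1"
      unfolding f1_def by (rule integrable_fourier_coeff_cubic) (use fin4[of u w] uw in auto)
    \<comment> \<open>Splitting the coefficient of the difference needs both cubic terms integrable
      in space; for \<open>v r\<close> the \<open>L\<^sup>4\<close> bound gives this at almost every
      time.\<close>
    have ae: "AE r in segm u w. chr (\<sigma> * n\<^sup>2) r * fourier_coeff (G r) n = f1 r - f2 r"
    proof -
      have "AE r in segm u w. (\<integral>\<^sup>+x. ennreal (norm (v r x) ^ 4) \<partial>torus) < \<infinity>"
        by (rule nn_integral_power4_finite_AE) (use fin4 uw in auto)
      moreover have "AE r in segm u w. r \<in> {u..w}" by (simp add: AE_segm)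
      ultimately show ?thesis
      proof eventually_elim
        case (elim r)
        have r: "r \<in> {s..t}" using elim(2) uw by auto
        have ib: "norm (iterate_field s k r x) \<le> 2 * R" for x
          unfolding iterate_field_def
          by (rule norm_synth_le) (use bdi[OF r] R in \<open>auto simp: ell1_def norm_mult\<close>)
        have "norm (of_real ((norm (iterate_field s k r x))\<^sup>2) * iterate_field s k r x * chr (-n) x) \<le> (2 * R)\<^sup>2 * (2 * R)" for x
        proof -
          have "norm (of_real ((norm (iterate_field s k r x))\<^sup>2) * iterate_field s k r x * chr (-n) x) = (norm (iterate_field s k r x))\<^sup>2 * norm (iterate_field s k r x)"
            by (simp add: norm_mult norm_power)
          also have "\<dots> \<le> (2 * R)\<^sup>2 * (2 * R)" using ib[of x] R by (intro mult_mono power_mono) auto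
          finally show ?thesis .
        qed
        then have j2: "integrable torus (\<lambda>x. of_real ((norm (iterate_field s k r x))\<^sup>2) * iterate_field s k r x * chr (-n) x)"
          by (intro integrable_segm_bounded[where B = "(2 * R)\<^sup>2 * (2 * R)"]) auto
        have j1: "integrable torus (\<lambda>x. of_real ((norm (v r x))\<^sup>2) * v r x * chr (-n) x)"
          by (rule integrable_power4_cubic) (use elim in auto)
        have [measurable]: "G r \<in> borel_measurable borel" unfolding G_def by measurable
        have "fourier_coeff (G r) n = fourier_coeff (\<lambda>x. of_real ((norm (v r x))\<^sup>2) * v r x) n
           - fourier_coeff (\<lambda>x. of_real ((norm (iterate_field s k r x))\<^sup>2) * iterate_field s k r x) n"
          by (subst (1 2 3) fourier_coeff_eq, measurable)
             (simp only: G_def left_diff_distrib Bochner_Integration.integral_diff[OF j1 j2] diff_divide_distrib)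
        then show ?case unfolding f1_def f2_def cub[OF r, symmetric] by (simp add: right_diff_distrib)
      qed
    qed
    have [measurable]: "(\<lambda>r. fourier_coeff (G r) n) \<in> borel_measurable borel"
      by (subst fourier_coeff_eq) measurable
    have "(LINT r|segm u w. chr (\<sigma> * n\<^sup>2) r * fourier_coeff (G r) n) = (LINT r|segm u w. f1 r - f2 r)"
      by (rule integral_cong_AE) (use ae in auto)
    also have "\<dots> = (LINT r|segm u w. f1 r) - (LINT r|segm u w. f2 r)" using i1 i2 uw by simp
    also have "(LINT r|segm u w. f2 r) = (LINT r|segm s w. f2 r) - (LINT r|segm s u. f2 r)"
      using integral_segm_split[of f2 s u w] i2[of s w] uw by simp
    finally have eq: "(LINT r|segm u w. chr (\<sigma> * n\<^sup>2) r * fourier_coeff (G r) n)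
      = (LINT r|segm u w. f1 r) - ((LINT r|segm s w. f2 r) - (LINT r|segm s u. f2 r))" .
    have "- \<i> * of_real \<kappa> * (LINT r|segm u w. chr (\<sigma> * n\<^sup>2) r * fourier_coeff (G r) n)
      = - \<i> * of_real \<kappa> * (LINT r|segm u w. f1 r) + \<i> * of_real \<kappa> * ((LINT r|segm s w. f2 r) - (LINT r|segm s u. f2 r))"
      unfolding eq by (simp add: algebra_simps)
    also have "- \<i> * of_real \<kappa> * (LINT r|segm u w. f1 r) = osc w n - osc u n"
      using duhamel[of u w n] uw st by (simp add: f1_def osc_def)
    finally show ?thesis by (simp add: y_def f2_def algebra_simps)
  qed
  have inc: "(\<Sum>n\<in>A. (norm (y n w - y n u))\<^sup>2)\<^sup>2 \<le> D * (h w - h u) ^ 3"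
    if uw: "s \<le> u" "u \<le> w" "w \<le> t" and A: "finite A" for u w A
  proof -
    define da db where "da = A1 w - A1 u" "db = B1 w - B1 u"
    have d0: "da \<ge> 0" "db \<ge> 0" using A1(1) B1(1) uw by (auto simp: da_db_def mono_def)
    have hd: "h w - h u = (da / a + db / b) / 2"
      by (simp add: h_def da_db_def diff_divide_distrib add_divide_distrib)
    have "(\<Sum>n\<in>A. (norm (LINT r|segm u w. chr (\<sigma> * n\<^sup>2) r * fourier_coeff (G r) n))\<^sup>2)\<^sup>2 \<le> 8 * pi\<^sup>2 * (da\<^sup>2 * db)"
      by (rule dual_estimate[where V = V and W = W])
         (use A \<sigma> st uw GVW A1(5)[OF uw] B1(5)[OF uw] d0 in \<open>auto simp: V_def W_def da_db_def\<close>)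
    then have "\<kappa> ^ 4 * (\<Sum>n\<in>A. (norm (LINT r|segm u w. chr (\<sigma> * n\<^sup>2) r * fourier_coeff (G r) n))\<^sup>2)\<^sup>2 \<le> \<kappa> ^ 4 * (8 * pi\<^sup>2 * (da\<^sup>2 * db))"
      by (intro mult_left_mono) auto
    also have "\<kappa> ^ 4 * (\<Sum>n\<in>A. (norm (LINT r|segm u w. chr (\<sigma> * n\<^sup>2) r * fourier_coeff (G r) n))\<^sup>2)\<^sup>2 = (\<Sum>n\<in>A. (norm (y n w - y n u))\<^sup>2)\<^sup>2"
      unfolding inc_eq[OF uw] by (simp add: norm_mult power_mult_distrib sum_distrib_left[symmetric] flip: power_mult)
    also have "\<kappa> ^ 4 * (8 * pi\<^sup>2 * (da\<^sup>2 * db)) \<le> D * (h w - h u) ^ 3"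
    proof -
      have p: "0 \<le> da / a" "0 \<le> db / b" using d0 a(1) b(1) by auto
      have cube: "(2 * x)\<^sup>2 * (2 * x) = 8 * x ^ 3" for x :: real
        by (simp add: power2_eq_square power3_eq_cube)
      have two: "2 * (h w - h u) = da / a + db / b" by (simp add: hd mult.commute)
      have e1: "da / a \<le> 2 * (h w - h u)" "db / b \<le> 2 * (h w - h u)"
        unfolding two using p by (auto intro: add_increasing add_increasing2)
      have "da\<^sup>2 * db = (a\<^sup>2 * b) * ((da / a)\<^sup>2 * (db / b))" using a b by (simp add: power_divide)
      also have "\<dots> \<le> (a\<^sup>2 * b) * ((2 * (h w - h u))\<^sup>2 * (2 * (h w - h u)))"
        using e1 p a(1) b(1) by (intro mult_left_mono mult_mono power_mono) auto
      also have "\<dots> = 8 * (a\<^sup>2 * b) * (h w - h u) ^ 3" unfolding cube by (simp only: mult_ac)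
      finally have "\<kappa> ^ 4 * (8 * pi\<^sup>2 * (da\<^sup>2 * db)) \<le> \<kappa> ^ 4 * (8 * pi\<^sup>2 * (8 * (a\<^sup>2 * b) * (h w - h u) ^ 3))"
        by (intro mult_left_mono) auto
      then show ?thesis by (simp add: D_def mult_ac)
    qed
    finally show ?thesis .
  qed
  have ys: "y n s = 0" for n
    by (simp add: y_def integral_segm_point)
  have hm: "mono h" unfolding h_def using A1(1) B1(1) a b
    by (intro monoI divide_right_mono add_mono) (auto simp: mono_def)
  have hc: "continuous_on {s..t} h" unfolding h_def using A1(2) B1(2) a b by (intro continuous_intros) auto
  have h0: "h s = 0" by (simp add: h_def A1 B1)
  have h1: "h t \<le> 1"
  proof -
    have "A1 t / a \<le> 1" "B1 t / b \<le> 1" using A1(4) B1(4) a b by (auto simp: divide_le_eq)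
    then show ?thesis by (simp add: h_def)
  qed
  show "(\<Sum>n\<in>A. (norm (osc r n - iterate s (Suc k) r n))\<^sup>2)\<^sup>2 \<le> 64 * pi\<^sup>2 * \<kappa> ^ 4 * (a\<^sup>2 * b)"
    if r: "r \<in> {s..t}" and A: "finite A" for r A
  proof -
    have "(\<Sum>n\<in>A. (norm (y n r - y n s))\<^sup>2)\<^sup>2 \<le> D * (h r - h s) ^ 3" using inc[of s r A] r A by auto
    also have "\<dots> \<le> D * 1"
    proof (intro mult_left_mono D0 power_le_one)
      show "0 \<le> h r - h s" using hm r by (auto simp: mono_def)
      show "h r - h s \<le> 1" using monoD[OF hm, of r t] r h0 h1 by auto
    qed
    finally have "(\<Sum>n\<in>A. (norm (y n r))\<^sup>2)\<^sup>2 \<le> D" unfolding ys by simp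
    then show ?thesis unfolding y_def D_def .
  qed
  have Nb: "(\<integral>\<^sup>+r. \<integral>\<^sup>+x. ennreal (norm (wave \<sigma> (\<lambda>n. y n r) {-int N..int N} r x) ^ 4) \<partial>torus \<partial>segm s t)
     \<le> ennreal (2 ^ 20 * pi\<^sup>2 * D)" for N
    by (rule christ_kiselev[where h = h]) (use st \<sigma> hm hc h0 h1 D0 inc ys in auto)
  have [measurable]: "(\<lambda>r. y n r) \<in> borel_measurable borel" for n unfolding y_def by measurable
  have [measurable]: "(\<lambda>(r, x). wave \<sigma> (\<lambda>n. y n r) {-int N..int N} r x) \<in> borel_measurable (borel \<Otimes>\<^sub>M borel)" for N
    unfolding wave_def by measurable
  have bdS: "ell1 (iterate s (Suc k) r) \<le> ennreal (2 * R)" if "r \<in> {s..t}" for r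
    by (rule ell1_iterate_le[OF R small that])
  \<comment> \<open>The Christ--Kiselev bound holds on every finite frequency window with a constant
    independent of \<open>N\<close>. Fatou in space at fixed time, then Fatou in time, passes to the
    full field.\<close>
  have "(\<integral>\<^sup>+r. \<integral>\<^sup>+x. ennreal (norm (v r x - iterate_field s (Suc k) r x) ^ 4) \<partial>torus \<partial>segm s t)
    \<le> (\<integral>\<^sup>+r. liminf (\<lambda>N. \<integral>\<^sup>+x. ennreal (norm (wave \<sigma> (\<lambda>n. y n r) {-int N..int N} r x) ^ 4) \<partial>torus) \<partial>segm s t)"
  proof (rule nn_integral_mono_AE, unfold AE_segm, rule AE_I2, rule impI)
    fix r assume r: "r \<in> {s..t}"
    define a' where "a' = (\<lambda>n. chr (- \<sigma> * n\<^sup>2) r * iterate s (Suc k) r n)"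
    have ea: "ell1 a' \<le> ennreal (2 * R)" using bdS[OF r] by (simp add: ell1_def a'_def norm_mult)
    have fa: "ell1 a' < \<infinity>" using ea by (auto intro: le_less_trans)
    have L: "L2 (synth a')" by (rule L2_bounded[where B = "2 * R"]) (use norm_synth_le[OF ea] R in auto)
    have fc: "fourier_coeff (\<lambda>x. v r x - synth a' x) n = y n r * chr (- \<sigma> * n\<^sup>2) r" for n
      by (subst fourier_coeff_diff[OF v_L2 L], subst fourier_coeff_synth[OF fa])
         (simp add: fourier_coeff_osc a'_def y_def algebra_simps del: iterate.simps)
    have "partial_fourier (\<lambda>x. v r x - synth a' x) N x = wave \<sigma> (\<lambda>n. y n r) {-int N..int N} r x" for N x
      unfolding partial_fourier_def wave_def
      by (intro sum.cong refl) (simp only: fc)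
    then show "(\<integral>\<^sup>+x. ennreal (norm (v r x - iterate_field s (Suc k) r x) ^ 4) \<partial>torus)
       \<le> liminf (\<lambda>N. \<integral>\<^sup>+x. ennreal (norm (wave \<sigma> (\<lambda>n. y n r) {-int N..int N} r x) ^ 4) \<partial>torus)"
      using nn_integral_power4_le_partial_fourier[OF L2_diff[OF v_L2 L], of r]
      by (simp add: iterate_field_def a'_def del: iterate.simps)
  qed
  also have "\<dots> \<le> liminf (\<lambda>N. \<integral>\<^sup>+r. \<integral>\<^sup>+x. ennreal (norm (wave \<sigma> (\<lambda>n. y n r) {-int N..int N} r x) ^ 4) \<partial>torus \<partial>segm s t)"
    by (rule nn_integral_liminf) measurable
  also have "\<dots> \<le> liminf (\<lambda>N::nat. ennreal (2 ^ 20 * pi\<^sup>2 * D))"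
    by (intro Liminf_mono always_eventually allI Nb)
  also have "\<dots> = ennreal (2 ^ 20 * pi\<^sup>2 * D)" by (simp add: Liminf_const)
  finally show "(\<integral>\<^sup>+r. \<integral>\<^sup>+x. ennreal (norm (v r x - iterate_field s (Suc k) r x) ^ 4) \<partial>torus \<partial>segm s t)
      \<le> ennreal (2 ^ 20 * pi\<^sup>2 * (64 * pi\<^sup>2 * \<kappa> ^ 4 * (a\<^sup>2 * b)))" by (simp add: D_def)
qed

end

section \<open>Continuation of absolute summability in time\<close>

context nls_path
begin

text \<open>With \<open>a\<close> bounding the potential, each iteration halves the bound on the
  fourth power of the \<open>L\<^sup>4\<close> error; \<open>2 ^ 26 * pi ^ 4\<close> collects
  \<open>2 ^ 20 * pi\<^sup>2\<close> and \<open>64 * pi\<^sup>2\<close> from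
  \<open>picard_error\<close>. The same estimate makes the iterates converge to the solution mode by
  mode, and finite partial sums carry the invariant bound \<open>2 * R\<close> to the limit.\<close>

lemma path_local:
  assumes st: "0 \<le> s" "s \<le> t" "t \<le> T" "t \<le> s + 2 * pi"
    and R: "ell1 (osc s) \<le> ennreal R" "R \<ge> 0" and small: "\<bar>\<kappa>\<bar> * (t - s) * (8 * R\<^sup>2) \<le> 1"
    and e: "(\<integral>\<^sup>+r. \<integral>\<^sup>+x. ennreal (norm (v r x) ^ 4) \<partial>torus \<partial>segm s t) \<le> ennreal e" "e \<ge> 0"
    and a: "a > 0" "8 * (e + (2 * R) ^ 4 * (2 * pi) * (t - s)) \<le> a" "2 ^ 26 * pi ^ 4 * \<kappa> ^ 4 * a\<^sup>2 \<le> 1 / 2"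
    and r: "r \<in> {s..t}"
  shows "ell1 (osc r) \<le> ennreal (2 * R)"
proof -
  have bdi: "ell1 (iterate s k r) \<le> ennreal (2 * R)" if "r \<in> {s..t}" for r k
    by (rule ell1_iterate_le[OF R small that])
  have ib: "norm (iterate_field s k r x) \<le> 2 * R" if "r \<in> {s..t}" for k r x
    unfolding iterate_field_def
    by (rule norm_synth_le) (use bdi[OF that] R in \<open>auto simp: ell1_def norm_mult\<close>)
  have Va: "(\<integral>\<^sup>+r. \<integral>\<^sup>+x. ennreal ((2 * ((norm (v r x))\<^sup>2 + (norm (iterate_field s k r x))\<^sup>2))\<^sup>2) \<partial>torus \<partial>segm s t) \<le> ennreal a" for k
  proof -
    have "(\<integral>\<^sup>+r. \<integral>\<^sup>+x. ennreal ((2 * ((norm (v r x))\<^sup>2 + (norm (iterate_field s k r x))\<^sup>2))\<^sup>2) \<partial>torus \<partial>segm s t)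
      \<le> (\<integral>\<^sup>+r. \<integral>\<^sup>+x. ennreal 8 * ennreal (norm (v r x) ^ 4) + ennreal (8 * (2 * R) ^ 4) \<partial>torus \<partial>segm s t)"
    proof (rule nn_integral_mono_AE, unfold AE_segm, rule AE_I2, rule impI, rule nn_integral_mono)
      fix r x assume r: "r \<in> {s..t}"
      define p q where "p = norm (v r x)" "q = norm (iterate_field s k r x)"
      have "(2 * (p\<^sup>2 + q\<^sup>2))\<^sup>2 \<le> 8 * p ^ 4 + 8 * q ^ 4"
      proof -
        have "(p\<^sup>2 + q\<^sup>2)\<^sup>2 \<le> 2 * p ^ 4 + 2 * q ^ 4" using norm_add_squared_le[of "p\<^sup>2" "q\<^sup>2"] by simp
        moreover have "(2 * (p\<^sup>2 + q\<^sup>2))\<^sup>2 = 4 * (p\<^sup>2 + q\<^sup>2)\<^sup>2" unfolding power_mult_distrib by simp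
        ultimately show ?thesis by linarith
      qed
      also have "q ^ 4 \<le> (2 * R) ^ 4" using ib[OF r, of k x] by (intro power_mono) (auto simp: p_q_def)
      finally have "(2 * (p\<^sup>2 + q\<^sup>2))\<^sup>2 \<le> 8 * p ^ 4 + 8 * (2 * R) ^ 4" by simp
      then have "ennreal ((2 * (p\<^sup>2 + q\<^sup>2))\<^sup>2) \<le> ennreal (8 * p ^ 4 + 8 * (2 * R) ^ 4)" by (rule ennreal_leI)
      also have "\<dots> = ennreal 8 * ennreal (p ^ 4) + ennreal (8 * (2 * R) ^ 4)"
        using R by (subst ennreal_plus) (auto simp: p_q_def ennreal_mult')
      finally show "ennreal ((2 * ((norm (v r x))\<^sup>2 + (norm (iterate_field s k r x))\<^sup>2))\<^sup>2)
        \<le> ennreal 8 * ennreal (norm (v r x) ^ 4) + ennreal (8 * (2 * R) ^ 4)" by (simp only: p_q_def)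
    qed
    also have "\<dots> = ennreal 8 * (\<integral>\<^sup>+r. \<integral>\<^sup>+x. ennreal (norm (v r x) ^ 4) \<partial>torus \<partial>segm s t)
        + ennreal (8 * (2 * R) ^ 4) * ennreal (2 * pi) * ennreal (t - s)"
      by (simp add: nn_integral_add nn_integral_cmult emeasure_segm)
    also have "\<dots> \<le> ennreal 8 * ennreal e + ennreal (8 * (2 * R) ^ 4) * ennreal (2 * pi) * ennreal (t - s)"
      by (intro add_right_mono mult_left_mono e) auto
    also have "\<dots> = ennreal (8 * (e + (2 * R) ^ 4 * (2 * pi) * (t - s)))"
    proof -
      have "8 * (e + (2 * R) ^ 4 * (2 * pi) * (t - s)) = 8 * e + 8 * (2 * R) ^ 4 * (2 * pi) * (t - s)"
        by (simp add: distrib_left mult.assoc)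
      moreover have "ennreal 8 * ennreal e + ennreal c * ennreal p * ennreal d = ennreal (8 * e + c * p * d)"
        if "0 \<le> c" "0 \<le> p" "0 \<le> d" for c p d using that e(2) by (simp add: ennreal_mult)
      ultimately show ?thesis using R(2) st(2) by (simp add: mult.assoc)
    qed
    also have "\<dots> \<le> ennreal a" using a(2) by (rule ennreal_leI)
    finally show ?thesis .
  qed
  have Eb: "(\<integral>\<^sup>+r. \<integral>\<^sup>+x. ennreal (norm (v r x - iterate_field s k r x) ^ 4) \<partial>torus \<partial>segm s t) \<le> ennreal (a * (1 / 2) ^ k)" for k
  proof (induction k)
    case 0
    have "iterate_field s 0 r x = 0" for r x by (simp add: iterate_field_def synth_def)
    moreover have "e \<le> a"
    proof -
      have "e \<le> a" if "0 \<le> X" "8 * (e + X) \<le> a" for X using that e(2) by simp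
      from this[OF _ a(2)] show ?thesis using R st by simp
    qed
    ultimately show ?case using order_trans[OF e(1) ennreal_leI] by simp
  next
    case (Suc k)
    have "(\<integral>\<^sup>+r. \<integral>\<^sup>+x. ennreal (norm (v r x - iterate_field s (Suc k) r x) ^ 4) \<partial>torus \<partial>segm s t)
      \<le> ennreal (2 ^ 20 * pi\<^sup>2 * (64 * pi\<^sup>2 * \<kappa> ^ 4 * (a\<^sup>2 * (a * (1 / 2) ^ k))))"
      by (rule picard_error(1)[OF st R small a(1) Va _ Suc]) (use a in simp)
    also have "\<dots> \<le> ennreal (a * (1 / 2) ^ Suc k)"
    proof (rule ennreal_leI)
      have "2 ^ 20 * pi\<^sup>2 * (64 * pi\<^sup>2 * \<kappa> ^ 4 * (a\<^sup>2 * (a * (1 / 2) ^ k))) = (2 ^ 26 * pi ^ 4 * \<kappa> ^ 4 * a\<^sup>2) * (a * (1 / 2) ^ k)"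
        by (simp add: eval_nat_numeral mult_ac)
      also have "\<dots> \<le> (1 / 2) * (a * (1 / 2) ^ k)" using a by (intro mult_right_mono) auto
      finally show "2 ^ 20 * pi\<^sup>2 * (64 * pi\<^sup>2 * \<kappa> ^ 4 * (a\<^sup>2 * (a * (1 / 2) ^ k))) \<le> a * (1 / 2) ^ Suc k" by simp
    qed
    finally show ?case .
  qed
  have conv: "(\<lambda>k. iterate s (Suc k) r n) \<longlonglongrightarrow> osc r n" for n
  proof (rule tendsto_power4_le)
    fix k
    have "(\<Sum>n\<in>{n}. (norm (osc r n - iterate s (Suc k) r n))\<^sup>2)\<^sup>2 \<le> 64 * pi\<^sup>2 * \<kappa> ^ 4 * (a\<^sup>2 * (a * (1 / 2) ^ k))"
      by (rule picard_error(2)[OF st R small a(1) Va _ Eb r]) (use a in auto)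
    then show "norm (iterate s (Suc k) r n - osc r n) ^ 4 \<le> 64 * pi\<^sup>2 * \<kappa> ^ 4 * (a\<^sup>2 * (a * (1 / 2) ^ k))"
      by (simp add: norm_minus_commute flip: power_mult del: iterate.simps)
    have "(\<lambda>k. 64 * pi\<^sup>2 * \<kappa> ^ 4 * (a\<^sup>2 * (a * (1 / 2) ^ k))) \<longlonglongrightarrow> 64 * pi\<^sup>2 * \<kappa> ^ 4 * (a\<^sup>2 * (a * 0))"
      by (intro tendsto_intros LIMSEQ_power_zero) simp
    then show "(\<lambda>k. 64 * pi\<^sup>2 * \<kappa> ^ 4 * (a\<^sup>2 * (a * (1 / 2) ^ k))) \<longlonglongrightarrow> 0" by simp
  qed
  show ?thesis
  proof (rule ell1_leI)
    fix A :: "int set" assume A: "finite A"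
    show "(\<Sum>n\<in>A. norm (osc r n)) \<le> 2 * R"
    proof (rule LIMSEQ_le_const2)
      show "(\<lambda>k. \<Sum>n\<in>A. norm (iterate s (Suc k) r n)) \<longlonglongrightarrow> (\<Sum>n\<in>A. norm (osc r n))"
        by (intro tendsto_intros conv)
      show "\<exists>N. \<forall>k\<ge>N. (\<Sum>n\<in>A. norm (iterate s (Suc k) r n)) \<le> 2 * R"
        using ell1_leD[OF bdi[OF r] _ A] R by (auto simp del: iterate.simps)
    qed
  qed
qed

text \<open>The time \<tau> depends on \<open>R\<close> but not on the starting time: the
  \<open>L\<^sup>4\<close> clock is uniformly continuous on the compact interval, so short intervals
  carry little \<open>L\<^sup>4\<close> mass wherever they begin.\<close>

lemma path_local_uniform:
  assumes R: "R \<ge> 0"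
  obtains \<tau> where "\<tau> > 0"
    "\<And>s r. 0 \<le> s \<Longrightarrow> s \<le> r \<Longrightarrow> r \<le> T \<Longrightarrow> r \<le> s + \<tau> \<Longrightarrow> ell1 (osc s) \<le> ennreal R \<Longrightarrow> ell1 (osc r) \<le> ennreal (2 * R)"
proof -
  \<comment> \<open>Chosen so that \<open>2 ^ 26 * pi ^ 4 * \<kappa> ^ 4 * a\<^sup>2\<close> equals
    a quarter of \<open>(\<kappa>\<^sup>2 / (\<kappa>\<^sup>2 + 1))\<^sup>2\<close>, below the 1/2
    needed for contraction; the summand 1 keeps \<open>a\<close> defined when \<kappa>
    vanishes.\<close>
  define a where "a = 1 / (2 ^ 14 * pi\<^sup>2 * (\<kappa>\<^sup>2 + 1))"
  have k0: "\<kappa>\<^sup>2 + 1 > 0" by (rule add_nonneg_pos) auto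
  have a0: "a > 0" using k0 by (simp add: a_def)
  have ak: "2 ^ 26 * pi ^ 4 * \<kappa> ^ 4 * a\<^sup>2 \<le> 1 / 2"
  proof -
    have "2 ^ 26 * pi ^ 4 * \<kappa> ^ 4 * a\<^sup>2 = (1 / 4) * (\<kappa>\<^sup>2 / (\<kappa>\<^sup>2 + 1))\<^sup>2"
      using k0 by (simp add: a_def power_divide power_mult_distrib flip: power_mult)
    also have "\<dots> \<le> (1 / 4) * 1\<^sup>2" using k0 by (intro mult_left_mono power_mono) auto
    finally show ?thesis by simp
  qed
  obtain E where E: "(\<integral>\<^sup>+r. \<integral>\<^sup>+x. ennreal (norm (v r x) ^ 4) \<partial>torus \<partial>segm 0 T) = ennreal E" "E \<ge> 0"
    using v_L4 by (cases "(\<integral>\<^sup>+r. \<integral>\<^sup>+x. ennreal (norm (v r x) ^ 4) \<partial>torus \<partial>segm 0 T)") auto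
  obtain A1 where A1: "mono A1" "continuous_on {0..T} A1" "A1 0 = 0" "A1 T \<le> E"
    "\<And>u w. 0 \<le> u \<Longrightarrow> u \<le> w \<Longrightarrow> w \<le> T \<Longrightarrow> (\<integral>\<^sup>+r. \<integral>\<^sup>+x. ennreal (norm (v r x) ^ 4) \<partial>torus \<partial>segm u w) = ennreal (A1 w - A1 u)"
    by (rule mass_clock[of "\<lambda>r. \<integral>\<^sup>+x. ennreal (norm (v r x) ^ 4) \<partial>torus" 0 T E]) (use E T in auto)
  have "uniformly_continuous_on {0..T} A1"
    by (rule compact_uniformly_continuous[OF A1(2)]) simp
  then obtain \<delta> where \<delta>: "\<delta> > 0" "\<And>u w. u \<in> {0..T} \<Longrightarrow> w \<in> {0..T} \<Longrightarrow> dist w u < \<delta> \<Longrightarrow> dist (A1 w) (A1 u) < a / 16"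
    unfolding uniformly_continuous_on_def using a0 by (metis divide_pos_pos zero_less_numeral)
  \<comment> \<open>The four bounds secure, in this order: \<open>L\<^sup>4\<close> mass below
    \<open>a / 16\<close>, at most one period for Zygmund's bound, invariance of the ball of
    iterates, and \<open>8 * (2 * R) ^ 4 * (2 * pi) * \<tau> \<le> a / 2\<close> for the
    contribution of the iterates to the potential, whence 512 = 2 * 256. The summands 1 keep the
    denominators positive.\<close>
  define \<tau> where "\<tau> = min (min (\<delta> / 2) (2 * pi)) (min (1 / (\<bar>\<kappa>\<bar> * (8 * R\<^sup>2) + 1)) (a / (512 * pi * R ^ 4 + 1)))"
  have pos: "\<bar>\<kappa>\<bar> * (8 * R\<^sup>2) + 1 > 0" "512 * pi * R ^ 4 + 1 > 0"
    by (auto intro!: add_nonneg_pos)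
  have \<tau>0: "\<tau> > 0" using \<delta>(1) a0 pos by (simp add: \<tau>_def)
  have \<tau>: "\<tau> \<le> \<delta> / 2" "\<tau> \<le> 2 * pi" "\<tau> \<le> 1 / (\<bar>\<kappa>\<bar> * (8 * R\<^sup>2) + 1)" "\<tau> \<le> a / (512 * pi * R ^ 4 + 1)"
    unfolding \<tau>_def by (blast intro: min.coboundedI1 min.coboundedI2 order_refl)+
  have \<tau>3: "\<bar>\<kappa>\<bar> * \<tau> * (8 * R\<^sup>2) \<le> 1"
  proof -
    have "\<tau> * (\<bar>\<kappa>\<bar> * (8 * R\<^sup>2) + 1) \<le> 1" using \<tau>(3) pos by (simp add: le_divide_eq)
    then show ?thesis using \<tau>0 by (simp add: algebra_simps)
  qed
  have \<tau>4: "512 * pi * R ^ 4 * \<tau> \<le> a"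
  proof -
    have "\<tau> * (512 * pi * R ^ 4 + 1) \<le> a" using \<tau>(4) pos by (simp add: le_divide_eq)
    then show ?thesis using \<tau>0 by (simp add: algebra_simps)
  qed
  show ?thesis
  proof (rule that[OF \<tau>0])
    fix s r assume sr: "0 \<le> s" "s \<le> r" "r \<le> T" "r \<le> s + \<tau>" and o: "ell1 (osc s) \<le> ennreal R"
    define e where "e = A1 r - A1 s"
    have e: "0 \<le> e" "e < a / 16"
      using monoD[OF A1(1) sr(2)] \<delta>(1) \<delta>(2)[of s r] sr \<tau> by (auto simp: e_def dist_real_def)
    show "ell1 (osc r) \<le> ennreal (2 * R)"
    proof (rule path_local[where t = r and e = e and a = a])
      show "r \<le> s + 2 * pi" using sr \<tau> by simp
      have "\<bar>\<kappa>\<bar> * (r - s) * (8 * R\<^sup>2) \<le> \<bar>\<kappa>\<bar> * \<tau> * (8 * R\<^sup>2)" using sr by (intro mult_right_mono mult_left_mono) auto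
      then show "\<bar>\<kappa>\<bar> * (r - s) * (8 * R\<^sup>2) \<le> 1" using \<tau>3 by (rule order_trans)
      have "(512 * pi * R ^ 4) * (r - s) \<le> (512 * pi * R ^ 4) * \<tau>" using sr by (intro mult_left_mono) auto
      then have "(512 * pi * R ^ 4) * (r - s) \<le> a" using \<tau>4 by (rule order_trans)
      moreover have "8 * ((2 * R) ^ 4 * (2 * pi) * (r - s)) = (512 * pi * R ^ 4) * (r - s) / 2" by simp
      ultimately show "8 * (e + (2 * R) ^ 4 * (2 * pi) * (r - s)) \<le> a" using e by (simp only: distrib_left)
    qed (use sr o R e a0 ak A1(5)[OF sr(1-3)] in \<open>auto simp: e_def\<close>)
  qed
qed

text \<open>A bootstrap in steps of \<tau>. If \<open>L\<close> bounds the norm up to one grid time,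
  the local theory gives the weaker bound \<open>2 * L\<close> one step further, and
  \<open>path_apriori\<close>, run with \<open>2 * L\<close> from time 0, restores \<open>L\<close>.
  This is why the closing condition is written with \<open>2 * L\<close>.\<close>

lemma path_bound:
  assumes K: "ell1 (osc 0) \<le> ennreal K" "K \<ge> 0" and N: "N > 0"
    and KL: "K + real N * (\<bar>\<kappa>\<bar> * (2 * L) ^ 3 + 5 * \<kappa>\<^sup>2 * (T / real N)\<^sup>2 * (2 * L) ^ 5) \<le> L" and L: "L \<ge> 0"
    and t: "t \<in> {0..T}"
  shows "ell1 (osc t) \<le> ennreal L"
proof -
  obtain \<tau> where \<tau>: "\<tau> > 0"
    "\<And>s r. 0 \<le> s \<Longrightarrow> s \<le> r \<Longrightarrow> r \<le> T \<Longrightarrow> r \<le> s + \<tau> \<Longrightarrow> ell1 (osc s) \<le> ennreal L \<Longrightarrow> ell1 (osc r) \<le> ennreal (2 * L)"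
    using path_local_uniform[OF L] by metis
  have KleL: "K \<le> L"
  proof -
    have "0 \<le> real N * (\<bar>\<kappa>\<bar> * (2 * L) ^ 3 + 5 * \<kappa>\<^sup>2 * (T / real N)\<^sup>2 * (2 * L) ^ 5)" using L by simp
    then show ?thesis using KL by linarith
  qed
  have "ell1 (osc r) \<le> ennreal L" if "r \<in> {0..T}" "r \<le> real j * \<tau>" for r j
    using that
  proof (induction j arbitrary: r)
    case 0
    then have "r = 0" by simp
    then show ?case using order_trans[OF K(1) ennreal_leI[OF KleL]] by simp
  next
    case (Suc j)
    have "ell1 (osc r') \<le> ennreal (2 * L)" if r': "r' \<in> {0..r}" for r'
    proof (rule \<tau>(2))
      \<comment> \<open>Going back from \<open>r'\<close> by \<tau>, but not below 0, reaches a time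
        already covered by the induction.\<close>
      show "ell1 (osc (max 0 (r' - \<tau>))) \<le> ennreal L"
        by (rule Suc.IH) (use Suc.prems r' \<tau>(1) in \<open>auto simp: algebra_simps\<close>)
    qed (use Suc.prems r' \<tau>(1) in auto)
    then have "ell1 (osc r) \<le> ell1 (osc 0) + ennreal (real N * (\<bar>\<kappa>\<bar> * (2 * L) ^ 3 + 5 * \<kappa>\<^sup>2 * (r / real N)\<^sup>2 * (2 * L) ^ 5))"
      by (intro path_apriori N) (use Suc.prems L in auto)
    also have "\<dots> \<le> ennreal K + ennreal (real N * (\<bar>\<kappa>\<bar> * (2 * L) ^ 3 + 5 * \<kappa>\<^sup>2 * (T / real N)\<^sup>2 * (2 * L) ^ 5))"
      using Suc.prems L
      by (intro add_mono K ennreal_leI mult_left_mono mult_right_mono power_mono divide_right_mono) auto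
    also have "\<dots> = ennreal (K + real N * (\<bar>\<kappa>\<bar> * (2 * L) ^ 3 + 5 * \<kappa>\<^sup>2 * (T / real N)\<^sup>2 * (2 * L) ^ 5))"
      using K L by (subst ennreal_plus) auto
    also have "\<dots> \<le> ennreal L" using KL by (rule ennreal_leI)
    finally show ?case .
  qed
  moreover obtain j where "t \<le> real j * \<tau>"
    using \<tau>(1) real_arch_simple[of "t / \<tau>"] by (auto simp: divide_le_eq)
  ultimately show ?thesis using t by blast
qed

end

section \<open>Norm bounds for solutions\<close>

lemma LBINT_eq_segm:
  fixes f :: "real \<Rightarrow> complex"
  assumes "a \<le> b" "f \<in> borel_measurable borel"
  shows "(LBINT x=ereal a..ereal b. f x) = integral\<^sup>L (segm a b) f"
  using assms by (simp add: interval_integral_Icc integral_segm)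

lemma LBINT_diff_eq_segm:
  fixes f :: "real \<Rightarrow> complex"
  assumes f: "f \<in> borel_measurable borel" and int: "\<And>M. integrable (segm (-M) M) f" and ab: "a \<le> b"
  shows "(LBINT x=ereal 0..ereal b. f x) - (LBINT x=ereal 0..ereal a. f x) = integral\<^sup>L (segm a b) f"
proof -
  define M where "M = max \<bar>a\<bar> \<bar>b\<bar>"
  have M: "- M \<le> a" "b \<le> M" "0 \<le> M" by (auto simp: M_def)
  have i: "set_integrable lborel {-M..M} f" using int[of M] f by (simp add: integrable_segm)
  have "interval_lebesgue_integrable lborel (min (ereal 0) (min (ereal a) (ereal b))) (max (ereal 0) (max (ereal a) (ereal b))) f"
  proof -
    have e: "min (ereal 0) (min (ereal a) (ereal b)) = ereal (min 0 (min a b))"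
      "max (ereal 0) (max (ereal a) (ereal b)) = ereal (max 0 (max a b))"
      by (simp_all only: ereal_min ereal_max)
    have "set_integrable lborel {min 0 (min a b)<..<max 0 (max a b)} f"
      by (rule set_integrable_subset[OF i]) (use M ab in auto)
    then show ?thesis unfolding e interval_lebesgue_integrable_def by (simp del: ereal_min ereal_max)
  qed
  from interval_integral_sum[OF this]
  have "(LBINT x=ereal 0..ereal a. f x) + (LBINT x=ereal a..ereal b. f x) = (LBINT x=ereal 0..ereal b. f x)" .
  then show ?thesis using LBINT_eq_segm[OF ab f] by (simp add: algebra_simps)
qed

lemma nn_integral_segm_affine:
  assumes f [measurable]: "f \<in> borel_measurable borel" and \<sigma>: "\<sigma> = 1 \<or> \<sigma> = - 1" and that: "s \<le> t"
  shows "nn_integral (segm s t) (\<lambda>r. f (\<tau> + \<sigma> * r)) = nn_integral (segm (min (\<tau> + \<sigma> * s) (\<tau> + \<sigma> * t)) (max (\<tau> + \<sigma> * s) (\<tau> + \<sigma> * t))) f"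
proof -
  have "nn_integral (segm (min (\<tau> + \<sigma> * s) (\<tau> + \<sigma> * t)) (max (\<tau> + \<sigma> * s) (\<tau> + \<sigma> * t))) f
     = (\<integral>\<^sup>+x\<in>{min (\<tau> + \<sigma> * s) (\<tau> + \<sigma> * t)..max (\<tau> + \<sigma> * s) (\<tau> + \<sigma> * t)}. f x \<partial>lborel)"
    by (rule nn_integral_segm) fact
  also have "\<dots> = ennreal \<bar>\<sigma>\<bar> * (\<integral>\<^sup>+x. f (\<tau> + \<sigma> * x) * indicator {min (\<tau> + \<sigma> * s) (\<tau> + \<sigma> * t)..max (\<tau> + \<sigma> * s) (\<tau> + \<sigma> * t)} (\<tau> + \<sigma> * x) \<partial>lborel)"
    by (rule nn_integral_real_affine) (use \<sigma> in auto)
  also have "\<dots> = (\<integral>\<^sup>+x\<in>{s..t}. f (\<tau> + \<sigma> * x) \<partial>lborel)"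
    using \<sigma> that by (auto intro!: nn_integral_cong split: split_indicator)
  finally show ?thesis by (simp add: nn_integral_segm)
qed

lemma integral_segm_affine:
  fixes f :: "real \<Rightarrow> complex"
  assumes f [measurable]: "f \<in> borel_measurable borel" and \<sigma>: "\<sigma> = 1 \<or> \<sigma> = - 1" and that: "s \<le> t"
  shows "integral\<^sup>L (segm s t) (\<lambda>r. f (\<tau> + \<sigma> * r)) = integral\<^sup>L (segm (min (\<tau> + \<sigma> * s) (\<tau> + \<sigma> * t)) (max (\<tau> + \<sigma> * s) (\<tau> + \<sigma> * t))) f"
proof -
  let ?a = "min (\<tau> + \<sigma> * s) (\<tau> + \<sigma> * t)" and ?b = "max (\<tau> + \<sigma> * s) (\<tau> + \<sigma> * t)"
  have "integral\<^sup>L (segm ?a ?b) f = (LINT x|lborel. indicat_real {?a..?b} x *\<^sub>R f x)"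
    by (simp add: integral_segm set_lebesgue_integral_def)
  also have "\<dots> = \<bar>\<sigma>\<bar> *\<^sub>R (LINT x|lborel. indicat_real {?a..?b} (\<tau> + \<sigma> * x) *\<^sub>R f (\<tau> + \<sigma> * x))"
    by (rule lborel_integral_real_affine) (use \<sigma> in auto)
  also have "\<dots> = (LINT x|lborel. indicat_real {s..t} x *\<^sub>R f (\<tau> + \<sigma> * x))"
    using \<sigma> that by (auto intro!: Bochner_Integration.integral_cong split: split_indicator)
  finally show ?thesis by (simp add: integral_segm set_lebesgue_integral_def)
qed

lemma set_integrable_power4_imp:
  assumes [measurable]: "(\<lambda>(s, x). u s x) \<in> borel_measurable (borel \<Otimes>\<^sub>M borel)"
    and int: "set_integrable lborel ({a..b} \<times> {0..2*pi}) (\<lambda>(s, x). (norm (u s x :: complex)) ^ 4)"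
  shows "(\<integral>\<^sup>+s. \<integral>\<^sup>+x. ennreal (norm (u s x) ^ 4) \<partial>torus \<partial>segm a b) < \<infinity>"
proof -
  have "(\<integral>\<^sup>+z. ennreal (norm (indicat_real ({a..b} \<times> {0..2*pi}) z *\<^sub>R (case z of (s, x) \<Rightarrow> norm (u s x) ^ 4))) \<partial>(lborel \<Otimes>\<^sub>M lborel)) < \<infinity>"
    using int unfolding set_integrable_def integrable_iff_bounded lborel_prod by simp
  also have "(\<integral>\<^sup>+z. ennreal (norm (indicat_real ({a..b} \<times> {0..2*pi}) z *\<^sub>R (case z of (s, x) \<Rightarrow> norm (u s x) ^ 4))) \<partial>(lborel \<Otimes>\<^sub>M lborel))
     = (\<integral>\<^sup>+z. (indicator {a..b} (fst z) * (indicator {0..2*pi} (snd z) * ennreal (norm (u (fst z) (snd z)) ^ 4))) \<partial>(lborel \<Otimes>\<^sub>M lborel))"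
    by (intro nn_integral_cong) (auto split: split_indicator)
  also have "\<dots> = (\<integral>\<^sup>+s. \<integral>\<^sup>+x. indicator {a..b} s * (indicator {0..2*pi} x * ennreal (norm (u s x) ^ 4)) \<partial>lborel \<partial>lborel)"
    by (subst lborel.nn_integral_fst[symmetric]) simp_all
  also have "\<dots> = (\<integral>\<^sup>+s. indicator {a..b} s * (\<integral>\<^sup>+x. ennreal (norm (u s x) ^ 4) \<partial>torus) \<partial>lborel)"
    by (intro nn_integral_cong) (simp add: nn_integral_cmult nn_integral_segm mult.commute)
  also have "\<dots> = (\<integral>\<^sup>+s. \<integral>\<^sup>+x. ennreal (norm (u s x) ^ 4) \<partial>torus \<partial>segm a b)"
    by (simp add: nn_integral_segm mult.commute)
  finally show ?thesis .
qed

text \<open>Starting the clock at \<tau> changes the interaction phase of each mode by the constant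
  \<open>chr (- n\<^sup>2) \<tau>\<close>, which factors out of the Duhamel identity; reversing time
  turns \<open>\<epsilon>\<^sup>2\<close> into its negative. One affine substitution treats
  both.\<close>

lemma NLS_solution_path:
  assumes sol: "NLS_solution \<epsilon> a u" and \<sigma>: "\<sigma> = 1 \<or> \<sigma> = - 1" and T: "T \<ge> 0"
  shows "nls_path (\<lambda>r. u (\<tau> + of_int \<sigma> * r)) \<sigma> (of_int \<sigma> * \<epsilon>\<^sup>2) T"
proof
  have um [measurable]: "(\<lambda>(s, x). u s x) \<in> borel_measurable (borel \<Otimes>\<^sub>M borel)"
    using sol unfolding NLS_solution_def borel_prod by blast
  have L2u: "L2 (u t)" for t
    using sol unfolding NLS_solution_def by (blast intro: square_integrable_torus_L2)
  have [measurable]: "u t \<in> borel_measurable borel" for t using L2u by (rule L2_measurable)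
  have L4: "set_integrable lborel ({-M..M} \<times> {0..2*pi}) (\<lambda>(s, x). (norm (u s x)) ^ 4)" if "M > 0" for M
    using sol that unfolding NLS_solution_def by blast
  have fin: "(\<integral>\<^sup>+s. \<integral>\<^sup>+x. ennreal (norm (u s x) ^ 4) \<partial>torus \<partial>segm (-M) M) < \<infinity>" for M
  proof -
    have "(\<integral>\<^sup>+s. \<integral>\<^sup>+x. ennreal (norm (u s x) ^ 4) \<partial>torus \<partial>segm (-M) M)
      \<le> (\<integral>\<^sup>+s. \<integral>\<^sup>+x. ennreal (norm (u s x) ^ 4) \<partial>torus \<partial>segm (-(\<bar>M\<bar> + 1)) (\<bar>M\<bar> + 1))"
      by (rule nn_integral_segm_mono) auto
    also have "\<dots> < \<infinity>"
      by (rule set_integrable_power4_imp[OF um L4]) simp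
    finally show ?thesis .
  qed
  have \<sigma>r: "real_of_int \<sigma> = 1 \<or> real_of_int \<sigma> = - 1" using \<sigma> by auto
  show "\<sigma> \<noteq> 0" using \<sigma> by auto
  show "T \<ge> 0" by fact
  show "(\<lambda>(t, x). u (\<tau> + of_int \<sigma> * t) x) \<in> borel_measurable (borel \<Otimes>\<^sub>M borel)"
    using measurable_compose[of "\<lambda>(t, x). (\<tau> + of_int \<sigma> * t, x)" "borel \<Otimes>\<^sub>M borel" "borel \<Otimes>\<^sub>M borel", OF _ um]
    by (simp add: case_prod_unfold)
  show "L2 (u (\<tau> + of_int \<sigma> * t))" for t by (rule L2u)
  show "(\<integral>\<^sup>+t. \<integral>\<^sup>+x. ennreal (norm (u (\<tau> + of_int \<sigma> * t) x) ^ 4) \<partial>torus \<partial>segm 0 T) < \<infinity>"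
  proof -
    have "(\<integral>\<^sup>+t. \<integral>\<^sup>+x. ennreal (norm (u (\<tau> + of_int \<sigma> * t) x) ^ 4) \<partial>torus \<partial>segm 0 T)
      = (\<integral>\<^sup>+s. \<integral>\<^sup>+x. ennreal (norm (u s x) ^ 4) \<partial>torus \<partial>segm (min (\<tau> + of_int \<sigma> * 0) (\<tau> + of_int \<sigma> * T)) (max (\<tau> + of_int \<sigma> * 0) (\<tau> + of_int \<sigma> * T)))"
      by (rule nn_integral_segm_affine[OF _ \<sigma>r T]) measurable
    also have "\<dots> \<le> (\<integral>\<^sup>+s. \<integral>\<^sup>+x. ennreal (norm (u s x) ^ 4) \<partial>torus \<partial>segm (-(\<bar>\<tau>\<bar> + T)) (\<bar>\<tau>\<bar> + T))"
      by (rule nn_integral_segm_mono) (use \<sigma> T in auto)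
    also have "\<dots> < \<infinity>" by (rule fin)
    finally show ?thesis .
  qed
  fix s t :: real and n :: int assume st: "0 \<le> s" "s \<le> t" "t \<le> T"
  define F where "F = (\<lambda>r. chr (n\<^sup>2) r * fourier_coeff (\<lambda>x. of_real ((norm (u r x))\<^sup>2) * u r x) n)"
  have F [measurable]: "F \<in> borel_measurable borel" unfolding F_def by (subst fourier_coeff_eq) measurable
  have intF: "integrable (segm (-M) M) F" for M
    unfolding F_def by (rule integrable_fourier_coeff_cubic) (use fin in auto)
  have B: "chr (n\<^sup>2) t' * fourier_coeff (u t') n = fourier_coeff (u 0) n - \<i> * of_real (\<epsilon>\<^sup>2) * (LBINT s=ereal 0..ereal t'. F s)" for t'
  proof -
    have e1: "exp (- (\<i> * complex_of_real ((of_int n)\<^sup>2 * r))) = chr (- n\<^sup>2) r" for r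
      by (simp add: chr_conv_exp mult.assoc)
    have "fourier_coeff (u t') n = exp (- (\<i> * of_real ((of_int n)\<^sup>2 * t'))) * fourier_coeff (u 0) n
        - \<i> * of_real (\<epsilon>\<^sup>2) *
          (LBINT s=ereal 0..ereal t'.
             exp (- (\<i> * of_real ((of_int n)\<^sup>2 * (t' - s)))) *
             fourier_coeff (\<lambda>x. of_real ((norm (u s x))\<^sup>2) * u s x) n)"
      using sol unfolding NLS_solution_def by blast
    also have "(\<lambda>s. exp (- (\<i> * of_real ((of_int n)\<^sup>2 * (t' - s)))) * fourier_coeff (\<lambda>x. of_real ((norm (u s x))\<^sup>2) * u s x) n)
      = (\<lambda>s. chr (- n\<^sup>2) t' * F s)"
    proof
      fix s
      have "chr (- n\<^sup>2) (t' - s) = chr (- n\<^sup>2) t' * chr (n\<^sup>2) s"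
        using chr_add_right[of "- n\<^sup>2" t' "- s"] by (simp add: chr_def)
      then show "exp (- (\<i> * of_real ((of_int n)\<^sup>2 * (t' - s)))) * fourier_coeff (\<lambda>x. of_real ((norm (u s x))\<^sup>2) * u s x) n
         = chr (- n\<^sup>2) t' * F s" unfolding e1 by (simp add: F_def mult_ac)
    qed
    finally have "fourier_coeff (u t') n = chr (- n\<^sup>2) t' * (fourier_coeff (u 0) n - \<i> * of_real (\<epsilon>\<^sup>2) * (LBINT s=ereal 0..ereal t'. F s))"
      unfolding e1 by (simp add: algebra_simps)
    then show ?thesis by (simp add: mult.assoc[symmetric])
  qed
  have Bdiff: "chr (n\<^sup>2) t2 * fourier_coeff (u t2) n - chr (n\<^sup>2) t1 * fourier_coeff (u t1) n = - \<i> * of_real (\<epsilon>\<^sup>2) * integral\<^sup>L (segm t1 t2) F"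
    if "t1 \<le> t2" for t1 t2
    unfolding B using LBINT_diff_eq_segm[OF F intF that] by (simp add: algebra_simps)
  let ?s = "\<tau> + of_int \<sigma> * s" and ?t = "\<tau> + of_int \<sigma> * t"
  have sub: "integral\<^sup>L (segm s t) (\<lambda>r. F (\<tau> + of_int \<sigma> * r)) = integral\<^sup>L (segm (min ?s ?t) (max ?s ?t)) F"
    by (rule integral_segm_affine[OF F \<sigma>r st(2)])
  have dir: "chr (n\<^sup>2) ?t * fourier_coeff (u ?t) n - chr (n\<^sup>2) ?s * fourier_coeff (u ?s) n
     = - \<i> * of_real (of_int \<sigma> * \<epsilon>\<^sup>2) * integral\<^sup>L (segm s t) (\<lambda>r. F (\<tau> + of_int \<sigma> * r))"
  proof (cases "\<sigma> = 1")
    case True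
    then show ?thesis unfolding sub using Bdiff[of ?s ?t] st by simp
  next
    case False
    then have m: "\<sigma> = - 1" using \<sigma> by simp
    show ?thesis unfolding sub using Bdiff[of ?t ?s] st unfolding m by (simp add: algebra_simps)
  qed
  have ch: "chr (\<sigma> * n\<^sup>2) r = chr (- n\<^sup>2) \<tau> * chr (n\<^sup>2) (\<tau> + of_int \<sigma> * r)" for r
  proof -
    have "chr (n\<^sup>2) (of_int \<sigma> * r) = chr (\<sigma> * n\<^sup>2) r" by (simp add: chr_def mult_ac)
    then show ?thesis by (simp add: chr_add_right mult.assoc[symmetric])
  qed
  show "chr (\<sigma> * n\<^sup>2) t * fourier_coeff (u ?t) n - chr (\<sigma> * n\<^sup>2) s * fourier_coeff (u ?s) n =
      - \<i> * of_real (of_int \<sigma> * \<epsilon>\<^sup>2) * (LINT r|segm s t. chr (\<sigma> * n\<^sup>2) r *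
        fourier_coeff (\<lambda>x. of_real ((norm (u (\<tau> + of_int \<sigma> * r) x))\<^sup>2) * u (\<tau> + of_int \<sigma> * r) x) n)"
  proof -
    have "chr (\<sigma> * n\<^sup>2) t * fourier_coeff (u ?t) n - chr (\<sigma> * n\<^sup>2) s * fourier_coeff (u ?s) n
      = chr (- n\<^sup>2) \<tau> * (chr (n\<^sup>2) ?t * fourier_coeff (u ?t) n - chr (n\<^sup>2) ?s * fourier_coeff (u ?s) n)"
      unfolding ch by (simp add: algebra_simps)
    also have "\<dots> = - \<i> * of_real (of_int \<sigma> * \<epsilon>\<^sup>2) * (chr (- n\<^sup>2) \<tau> * integral\<^sup>L (segm s t) (\<lambda>r. F (\<tau> + of_int \<sigma> * r)))"
      unfolding dir by (simp only: mult_ac)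
    also have "chr (- n\<^sup>2) \<tau> * integral\<^sup>L (segm s t) (\<lambda>r. F (\<tau> + of_int \<sigma> * r)) = (LINT r|segm s t. chr (\<sigma> * n\<^sup>2) r *
        fourier_coeff (\<lambda>x. of_real ((norm (u (\<tau> + of_int \<sigma> * r) x))\<^sup>2) * u (\<tau> + of_int \<sigma> * r) x) n)"
      unfolding ch F_def by (simp add: mult.assoc)
    finally show ?thesis .
  qed
qed

lemma NLS_FL1_bound:
  assumes sol: "NLS_solution \<epsilon> a u" and K: "FL1_norm (u t1) \<le> ennreal K" "K \<ge> 0" and N: "N > 0"
    and KL: "K + real N * (\<epsilon>\<^sup>2 * (2 * L) ^ 3 + 5 * \<epsilon> ^ 4 * (\<bar>t2 - t1\<bar> / real N)\<^sup>2 * (2 * L) ^ 5) \<le> L" and L: "L \<ge> 0"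
  shows "FL1_norm (u t2) \<le> ennreal L"
proof -
  define \<sigma> :: int where "\<sigma> = (if t1 \<le> t2 then 1 else - 1)"
  define T where "T = \<bar>t2 - t1\<bar>"
  interpret nls_path "\<lambda>r. u (t1 + of_int \<sigma> * r)" \<sigma> "of_int \<sigma> * \<epsilon>\<^sup>2" T
    by (rule NLS_solution_path[OF sol]) (auto simp: \<sigma>_def T_def)
  have "ell1 (osc T) \<le> ennreal L"
  proof (rule path_bound[OF _ K(2) N _ L])
    show "ell1 (osc 0) \<le> ennreal K" using K by (simp add: ell1_osc FL1_norm_eq)
    have "\<bar>real_of_int \<sigma> * \<epsilon>\<^sup>2\<bar> = \<epsilon>\<^sup>2" "(real_of_int \<sigma> * \<epsilon>\<^sup>2)\<^sup>2 = \<epsilon> ^ 4"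
      by (auto simp: \<sigma>_def abs_mult power_mult_distrib simp flip: power_mult)
    then show "K + real N * (\<bar>real_of_int \<sigma> * \<epsilon>\<^sup>2\<bar> * (2 * L) ^ 3 + 5 * (real_of_int \<sigma> * \<epsilon>\<^sup>2)\<^sup>2 * (T / real N)\<^sup>2 * (2 * L) ^ 5) \<le> L"
      using KL by (simp add: T_def)
  qed (auto simp: T_def)
  moreover have "t1 + of_int \<sigma> * T = t2" by (auto simp: \<sigma>_def T_def)
  ultimately show ?thesis by (simp add: ell1_osc FL1_norm_eq)
qed

text \<open>For \<open>N \<ge> \<bar>n\<bar>\<close> the partial sum has \<open>n\<close>-th
  coefficient \<open>a n\<close>, and Bessel's inequality for this single mode bounds the
  discrepancy by the \<open>L\<^sup>2\<close> distance.\<close>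

lemma fourier_coeff_series_sum:
  assumes "is_fourier_series_sum f a" shows "fourier_coeff f n = a n"
proof -
  have L: "L2 f" using assms by (auto simp: is_fourier_series_sum_def intro: square_integrable_torus_L2)
  define S where "S = (\<lambda>N x. \<Sum>k\<in>{- int N..int N}. a k * chr k x)"
  have LS: "L2 (S N)" for N unfolding S_def by (intro L2_trigpoly trigpolyI[OF refl])
  have d: "(\<lambda>N. L2_dist_torus f (S N)) \<longlonglongrightarrow> 0"
    using assms by (simp add: is_fourier_series_sum_def S_def chr_conv_exp)
  have dist: "(L2_dist_torus f (S N))\<^sup>2 = (LINT x|torus. (norm (f x - S N x))\<^sup>2)" for N
  proof -
    have [measurable]: "(\<lambda>x. f x - S N x) \<in> borel_measurable borel" by (rule L2_measurable[OF L2_diff[OF L LS]])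
    have "L2_dist_torus f (S N) = sqrt (LINT x|torus. (norm (f x - S N x))\<^sup>2)"
      unfolding L2_dist_torus_def by (subst integral_segm) auto
    then show ?thesis by (simp add: integral_nonneg_AE)
  qed
  have "(norm (fourier_coeff f n - a n))\<^sup>2 \<le> (L2_dist_torus f (S N))\<^sup>2" if N: "nat \<bar>n\<bar> \<le> N" for N
  proof -
    define r where "r = (\<lambda>x. f x - S N x)"
    have Lr: "L2 r" unfolding r_def by (rule L2_diff[OF L LS])
    have "fourier_coeff r n = fourier_coeff f n - a n"
      unfolding r_def using N by (subst fourier_coeff_diff[OF L LS]) (auto simp: S_def fourier_coeff_trig_sum)
    moreover have "(norm (fourier_coeff r n))\<^sup>2 \<le> (LINT x|torus. (norm (r x))\<^sup>2)"
      using bessel[OF Lr, of "{n}"] by simp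
    ultimately show ?thesis unfolding dist by (simp add: r_def)
  qed
  moreover have "(\<lambda>N. (L2_dist_torus f (S N))\<^sup>2) \<longlonglongrightarrow> 0\<^sup>2" by (intro tendsto_intros d)
  ultimately have "(norm (fourier_coeff f n - a n))\<^sup>2 \<le> 0"
    by (intro LIMSEQ_le_const[of "\<lambda>N. (L2_dist_torus f (S N))\<^sup>2"]) auto
  then show ?thesis by simp
qed

lemma NLS_solution_fourier_coeff_0:
  "NLS_solution \<epsilon> a u \<Longrightarrow> fourier_coeff (u 0) n = a n"
  unfolding NLS_solution_def by (intro fourier_coeff_series_sum) blast

text \<open>
  Time steps of length \<open>\<epsilon>\<^sup>-\<^sup>1\<^sup>/\<^sup>2\<close>: over \<open>O(\<epsilon>\<^sup>-\<^sup>1 \<bar>ln \<epsilon>\<bar>)\<close> the norm, of size \<open>\<epsilon>\<^sup>-\<^sup>1\<^sup>/\<^sup>2\<close>, changes by \<open>O(\<bar>ln \<epsilon>\<bar>)\<close>.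
\<close>
lemma eventually_NLS_FL1_bound:
  assumes KL: "0 \<le> K" "K < L"
  shows "eventually (\<lambda>\<epsilon>. \<forall>a u t1 t2. NLS_solution \<epsilon> a u \<longrightarrow> \<bar>t2 - t1\<bar> \<le> C * (\<bar>ln \<epsilon>\<bar> / \<epsilon>) \<longrightarrow>
    FL1_norm (u t1) \<le> ennreal (K * \<epsilon> powr (-1/2)) \<longrightarrow> FL1_norm (u t2) \<le> ennreal (L * \<epsilon> powr (-1/2))) (at_right 0)"
proof -
  have "((\<lambda>\<epsilon>. (C * \<bar>ln \<epsilon>\<bar> * sqrt \<epsilon> + 2 * \<epsilon>) * (8 * L ^ 3 + 160 * L ^ 5)) \<longlongrightarrow> 0) (at_right 0)"
  proof -
    have "((\<lambda>\<epsilon>::real. \<bar>ln \<epsilon>\<bar> * sqrt \<epsilon>) \<longlongrightarrow> 0) (at_right 0)" by real_asymp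
    moreover have "((\<lambda>\<epsilon>::real. \<epsilon>) \<longlongrightarrow> 0) (at_right 0)" by (rule tendsto_ident_at)
    ultimately have "((\<lambda>\<epsilon>. (C * (\<bar>ln \<epsilon>\<bar> * sqrt \<epsilon>) + 2 * \<epsilon>) * (8 * L ^ 3 + 160 * L ^ 5)) \<longlongrightarrow> (C * 0 + 2 * 0) * (8 * L ^ 3 + 160 * L ^ 5)) (at_right 0)"
      by (intro tendsto_intros)
    then show ?thesis by (simp add: mult.assoc)
  qed
  then have "eventually (\<lambda>\<epsilon>. (C * \<bar>ln \<epsilon>\<bar> * sqrt \<epsilon> + 2 * \<epsilon>) * (8 * L ^ 3 + 160 * L ^ 5) < L - K) (at_right 0)"
    by (rule order_tendstoD(2)) (use KL in simp)
  moreover have "eventually (\<lambda>\<epsilon>::real. \<epsilon> > 0) (at_right 0)" by (simp add: eventually_at_right_less)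
  ultimately show ?thesis
  proof eventually_elim
    case (elim \<epsilon>)
    define q where "q = sqrt \<epsilon>"
    have q: "q > 0" "\<epsilon> = q\<^sup>2" using elim by (auto simp: q_def)
    have pw: "\<epsilon> powr (-1/2) = 1 / q"
      using elim by (simp add: q_def powr_minus powr_half_sqrt inverse_eq_divide flip: minus_divide_left)
    show ?case
    proof (intro allI impI)
      fix a u t1 t2
      assume sol: "NLS_solution \<epsilon> a u" and t: "\<bar>t2 - t1\<bar> \<le> C * (\<bar>ln \<epsilon>\<bar> / \<epsilon>)"
        and K: "FL1_norm (u t1) \<le> ennreal (K * \<epsilon> powr (-1/2))"
      define D where "D = \<bar>t2 - t1\<bar>"
      \<comment> \<open>The step length \<open>D / N\<close> is at most \<open>1 / q\<close>. The
        successor guarantees at least one step; together with the rounding it adds at most 2 to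
        \<open>D * q\<close>.\<close>
      define N where "N = Suc (nat \<lceil>D * q\<rceil>)"
      have D0: "D \<ge> 0" by (simp add: D_def)
      have N1: "D * q \<le> real N"
      proof -
        have "D * q \<le> real (nat \<lceil>D * q\<rceil>)" by (rule real_nat_ceiling_ge)
        then show ?thesis by (simp add: N_def)
      qed
      have N2: "real N \<le> D * q + 2"
      proof -
        have "real (nat \<lceil>D * q\<rceil>) = of_int \<lceil>D * q\<rceil>" using D0 q by simp
        then show ?thesis using ceiling_correct[of "D * q"] by (simp add: N_def)
      qed
      have N0: "N > 0" by (simp add: N_def)
      have DN: "D / real N \<le> 1 / q" using N1 N0 q(1) by (simp add: pos_divide_le_eq pos_le_divide_eq)
      have Lq: "L / q \<ge> 0" using KL q by simp
      \<comment> \<open>With norm bound \<open>L / q\<close> and step length \<open>1 / q\<close>,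
        one step costs \<open>q * Z\<close>; here \<open>Z = (2 * L) ^ 3 + 5 * (2 * L) ^ 5\<close>,
        with the doubled bound of the bootstrap. Over all steps the cost, in units of
        \<open>1 / q\<close>, is the quantity shown above to tend to 0.\<close>
      define Z where "Z = 8 * L ^ 3 + 160 * L ^ 5"
      have Z0: "Z \<ge> 0" using KL by (simp add: Z_def)
      have Zl: "(C * \<bar>ln \<epsilon>\<bar> * q + 2 * q\<^sup>2) * Z < L - K" using elim(1) by (simp only: q_def[symmetric] q(2)[symmetric] Z_def)
      have scale: "\<epsilon>\<^sup>2 * (2 * (L / q)) ^ 3 + 5 * \<epsilon> ^ 4 * (1 / q)\<^sup>2 * (2 * (L / q)) ^ 5 = q * Z"
      proof -
        define l where "l = L / q"
        have L: "L = l * q" using q(1) by (simp add: l_def)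
        have "q ^ 8 * (1 / q)\<^sup>2 = q ^ 6" using q(1) by (simp add: power_divide eval_nat_numeral)
        then have "5 * (q ^ 8 * (1 / q)\<^sup>2) * (2 * l) ^ 5 = q * (160 * (l * q) ^ 5)"
          by (simp add: power_mult_distrib eval_nat_numeral mult_ac)
        moreover have "q ^ 4 * (2 * l) ^ 3 = q * (8 * (l * q) ^ 3)"
          by (simp add: power_mult_distrib eval_nat_numeral mult_ac)
        ultimately have "q ^ 4 * (2 * l) ^ 3 + 5 * q ^ 8 * (1 / q)\<^sup>2 * (2 * l) ^ 5 = q * Z"
          unfolding Z_def L by (simp only: distrib_left mult.assoc)
        then show ?thesis unfolding q(2) l_def[symmetric] by (simp flip: power_mult)
      qed
      have "FL1_norm (u t2) \<le> ennreal (L / q)"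
      proof (rule NLS_FL1_bound[OF sol _ _ N0 _ Lq])
        show "FL1_norm (u t1) \<le> ennreal (K / q)" using K unfolding pw by simp
        show "0 \<le> K / q" using KL q by simp
        have "\<epsilon>\<^sup>2 * (2 * (L / q)) ^ 3 + 5 * \<epsilon> ^ 4 * (D / real N)\<^sup>2 * (2 * (L / q)) ^ 5
          \<le> \<epsilon>\<^sup>2 * (2 * (L / q)) ^ 3 + 5 * \<epsilon> ^ 4 * (1 / q)\<^sup>2 * (2 * (L / q)) ^ 5"
          using DN D0 Lq by (intro add_left_mono mult_right_mono mult_left_mono power_mono) auto
        also have "\<dots> = q * Z" by (rule scale)
        finally have "real N * (\<epsilon>\<^sup>2 * (2 * (L / q)) ^ 3 + 5 * \<epsilon> ^ 4 * (D / real N)\<^sup>2 * (2 * (L / q)) ^ 5)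
          \<le> real N * (q * Z)" by (intro mult_left_mono) auto
        also have "\<dots> \<le> (D * q + 2) * (q * Z)"
          using N2 q(1) Z0 by (intro mult_right_mono) auto
        also have "\<dots> = (D * q\<^sup>2 * q + 2 * q\<^sup>2) * Z / q"
          using q(1) by (simp add: field_simps power2_eq_square)
        also have "\<dots> \<le> (C * \<bar>ln \<epsilon>\<bar> * q + 2 * q\<^sup>2) * Z / q"
        proof (intro divide_right_mono mult_right_mono add_right_mono)
          have "D * q\<^sup>2 \<le> C * (\<bar>ln \<epsilon>\<bar> / q\<^sup>2) * q\<^sup>2"
            using t unfolding D_def[symmetric] q(2)[symmetric] using elim(2) by (intro mult_right_mono) auto
          then show "D * q\<^sup>2 \<le> C * \<bar>ln \<epsilon>\<bar>" using q(1) by simp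
        qed (use q Z0 in auto)
        also have "\<dots> \<le> (L - K) / q"
          using Zl q(1) by (intro divide_right_mono) auto
        finally show "K / q + real N * (\<epsilon>\<^sup>2 * (2 * (L / q)) ^ 3 + 5 * \<epsilon> ^ 4 * (\<bar>t2 - t1\<bar> / real N)\<^sup>2 * (2 * (L / q)) ^ 5) \<le> L / q"
          unfolding D_def diff_divide_distrib by linarith
      qed
      then show "FL1_norm (u t2) \<le> ennreal (L * \<epsilon> powr (-1/2))" unfolding pw by simp
    qed
  qed
qed

section \<open>Tails of Gaussian sums\<close>

abbreviation std_normal :: "real measure" where
  "std_normal \<equiv> density lborel (\<lambda>x. ennreal (std_normal_density x))"

interpretation std_normal: prob_space std_normal
  by (rule prob_space_normal_density) simp

interpretation std_normal2: pair_prob_space std_normal std_normal ..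

lemma nn_integral_std_normal:
  "f \<in> borel_measurable borel \<Longrightarrow> nn_integral std_normal f = (\<integral>\<^sup>+x. ennreal (std_normal_density x) * f x \<partial>lborel)"
  by (rule nn_integral_density) auto

text \<open>An explicit antiderivative on each half-line. In the application
  \<open>\<bar>x\<bar>\<close> is the Jacobian of the substitution \<open>y = s x\<close>, and
  \<open>c\<close> is \<open>1 + s\<^sup>2\<close>.\<close>

lemma nn_integral_radial_section:
  assumes c: "c > 0" and R: "R \<ge> 0"
  shows "(\<integral>\<^sup>+x. ennreal (\<bar>x\<bar> * exp (- c * x\<^sup>2 / 2)) * indicator {x. R < c * x\<^sup>2} x \<partial>lborel) = ennreal (2 * exp (- R / 2) / c)"
proof -
  define \<rho> where "\<rho> = sqrt (R / c)"
  have \<rho>: "\<rho> \<ge> 0" "c * \<rho>\<^sup>2 = R" using c R by (auto simp: \<rho>_def)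
  define f where "f = (\<lambda>x::real. x * exp (- c * x\<^sup>2 / 2))"
  have A: "(\<integral>\<^sup>+x. ennreal (f x) * indicator {\<rho>..} x \<partial>lborel) = ennreal (exp (- R / 2) / c)"
  proof -
    define F where "F = (\<lambda>x::real. - exp (- c * x\<^sup>2 / 2) / c)"
    have "(\<integral>\<^sup>+x. ennreal (f x) * indicator {\<rho>..} x \<partial>lborel) = ennreal (0 - F \<rho>)"
    proof (rule nn_integral_FTC_atLeast)
      show "f \<in> borel_measurable borel" unfolding f_def by measurable
      show "DERIV F x :> f x" for x unfolding F_def f_def using c by (auto intro!: derivative_eq_intros)
      show "0 \<le> f x" if "\<rho> \<le> x" for x using that \<rho> by (simp add: f_def)
      show "(F \<longlongrightarrow> 0) at_top" unfolding F_def using c by real_asymp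
    qed
    also have "0 - F \<rho> = exp (- R / 2) / c" using \<rho>(2) by (simp add: F_def)
    finally show ?thesis .
  qed
  have B: "(\<integral>\<^sup>+x. ennreal (f (- x)) * indicator {..- \<rho>} x \<partial>lborel) = ennreal (exp (- R / 2) / c)"
  proof -
    have "(\<integral>\<^sup>+x. ennreal (f (- x)) * indicator {..- \<rho>} x \<partial>lborel) = ennreal \<bar>- 1\<bar> * (\<integral>\<^sup>+x. ennreal (f (- (0 + (- 1) * x))) * indicator {..- \<rho>} (0 + (- 1) * x) \<partial>lborel)"
      by (rule nn_integral_real_affine) (auto simp: f_def)
    also have "\<dots> = (\<integral>\<^sup>+x. ennreal (f x) * indicator {\<rho>..} x \<partial>lborel)"
      by (auto intro!: nn_integral_cong split: split_indicator)
    finally show ?thesis using A by simp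
  qed
  have "(\<integral>\<^sup>+x. ennreal (\<bar>x\<bar> * exp (- c * x\<^sup>2 / 2)) * indicator {x. R < c * x\<^sup>2} x \<partial>lborel)
    = (\<integral>\<^sup>+x. ennreal (f x) * indicator {\<rho>..} x + ennreal (f (- x)) * indicator {..- \<rho>} x \<partial>lborel)"
  proof (rule nn_integral_cong_AE)
    have "AE x in lborel. x \<noteq> \<rho>" "AE x in lborel. x \<noteq> - \<rho>" by (rule AE_lborel_singleton)+
    then show "AE x in lborel. ennreal (\<bar>x\<bar> * exp (- c * x\<^sup>2 / 2)) * indicator {x. R < c * x\<^sup>2} x =
       ennreal (f x) * indicator {\<rho>..} x + ennreal (f (- x)) * indicator {..- \<rho>} x"
    proof eventually_elim
      case (elim x)
      have "R < c * x\<^sup>2 \<longleftrightarrow> \<rho> < \<bar>x\<bar>"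
      proof -
        have "R < c * x\<^sup>2 \<longleftrightarrow> \<rho>\<^sup>2 < \<bar>x\<bar>\<^sup>2" using c unfolding \<rho>(2)[symmetric] by simp
        also have "\<dots> \<longleftrightarrow> \<rho> < \<bar>x\<bar>" using \<rho>(1) by (meson abs_ge_zero power2_less_imp_less power_strict_mono zero_less_numeral)
        finally show ?thesis .
      qed
      then show ?case using elim \<rho>(1) by (auto simp: f_def split: split_indicator)
    qed
  qed
  also have "\<dots> = ennreal (exp (- R / 2) / c) + ennreal (exp (- R / 2) / c)"
  proof -
    have "(\<integral>\<^sup>+x. ennreal (f x) * indicator {\<rho>..} x + ennreal (f (- x)) * indicator {..- \<rho>} x \<partial>lborel)
      = (\<integral>\<^sup>+x. ennreal (f x) * indicator {\<rho>..} x \<partial>lborel) + (\<integral>\<^sup>+x. ennreal (f (- x)) * indicator {..- \<rho>} x \<partial>lborel)"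
      by (rule nn_integral_add) (auto simp: f_def)
    then show ?thesis unfolding A B .
  qed
  also have "\<dots> = ennreal (2 * exp (- R / 2) / c)" using c by (simp flip: ennreal_plus)
  finally show ?thesis .
qed

text \<open>
  The substitution \<open>y = s x\<close> separates the radius; the remaining integral over the slope \<open>s\<close> does
  not depend on \<open>R\<close> and is fixed by the total mass.
\<close>
lemma std_normal_radius_tail:
  assumes R: "R \<ge> 0"
  shows "(\<integral>\<^sup>+x. \<integral>\<^sup>+y. indicator {z. R < z} (x\<^sup>2 + y\<^sup>2) \<partial>std_normal \<partial>std_normal) = ennreal (exp (- R / 2))"
proof -
  define w where "w = (\<lambda>s::real. ennreal (1 / (pi * (1 + s\<^sup>2))))"
  have tail: "(\<integral>\<^sup>+x. \<integral>\<^sup>+y. indicator {z. R < z} (x\<^sup>2 + y\<^sup>2) \<partial>std_normal \<partial>std_normal) = ennreal (exp (- R / 2)) * (\<integral>\<^sup>+s. w s \<partial>lborel)"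
    if R: "R \<ge> 0" for R
  proof -
    have "(\<integral>\<^sup>+x. \<integral>\<^sup>+y. indicator {z. R < z} (x\<^sup>2 + y\<^sup>2) \<partial>std_normal \<partial>std_normal)
      = (\<integral>\<^sup>+x. \<integral>\<^sup>+y. ennreal (std_normal_density x) * (ennreal (std_normal_density y) * indicator {z. R < z} (x\<^sup>2 + y\<^sup>2)) \<partial>lborel \<partial>lborel)"
      by (simp add: nn_integral_std_normal nn_integral_cmult)
    also have "\<dots> = (\<integral>\<^sup>+x. \<integral>\<^sup>+s. ennreal (1 / (2 * pi)) * (ennreal (\<bar>x\<bar> * exp (- (1 + s\<^sup>2) * x\<^sup>2 / 2)) * indicator {x. R < (1 + s\<^sup>2) * x\<^sup>2} x) \<partial>lborel \<partial>lborel)"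
    proof (rule nn_integral_cong_AE)
      have "AE x in lborel. x \<noteq> (0::real)" by (rule AE_lborel_singleton)
      then show "AE x in lborel. (\<integral>\<^sup>+y. ennreal (std_normal_density x) * (ennreal (std_normal_density y) * indicator {z. R < z} (x\<^sup>2 + y\<^sup>2)) \<partial>lborel)
        = (\<integral>\<^sup>+s. ennreal (1 / (2 * pi)) * (ennreal (\<bar>x\<bar> * exp (- (1 + s\<^sup>2) * x\<^sup>2 / 2)) * indicator {x. R < (1 + s\<^sup>2) * x\<^sup>2} x) \<partial>lborel)"
      proof eventually_elim
        case (elim x)
        have "(\<integral>\<^sup>+y. ennreal (std_normal_density x) * (ennreal (std_normal_density y) * indicator {z. R < z} (x\<^sup>2 + y\<^sup>2)) \<partial>lborel)
          = ennreal \<bar>x\<bar> * (\<integral>\<^sup>+s. ennreal (std_normal_density x) * (ennreal (std_normal_density (0 + x * s)) * indicator {z. R < z} (x\<^sup>2 + (0 + x * s)\<^sup>2)) \<partial>lborel)"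
          by (rule nn_integral_real_affine) (use elim in auto)
        also have "\<dots> = (\<integral>\<^sup>+s. ennreal \<bar>x\<bar> * (ennreal (std_normal_density x) * (ennreal (std_normal_density (0 + x * s)) * indicator {z. R < z} (x\<^sup>2 + (0 + x * s)\<^sup>2))) \<partial>lborel)"
          by (rule nn_integral_cmult[symmetric]) measurable
        also have "\<dots> = (\<integral>\<^sup>+s. ennreal (1 / (2 * pi)) * (ennreal (\<bar>x\<bar> * exp (- (1 + s\<^sup>2) * x\<^sup>2 / 2)) * indicator {x. R < (1 + s\<^sup>2) * x\<^sup>2} x) \<partial>lborel)"
        proof (rule nn_integral_cong)
          fix s :: real
          have e: "\<bar>x\<bar> * (std_normal_density x * std_normal_density (x * s)) = (1 / (2 * pi)) * (\<bar>x\<bar> * exp (- (1 + s\<^sup>2) * x\<^sup>2 / 2))"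
            by (simp add: std_normal_density_def exp_add[symmetric] power_mult_distrib algebra_simps add_divide_distrib[symmetric])
          have i: "indicator {z. R < z} (x\<^sup>2 + (0 + x * s)\<^sup>2) = (indicator {x. R < (1 + s\<^sup>2) * x\<^sup>2} x :: ennreal)"
            by (simp add: indicator_def power_mult_distrib algebra_simps)
          have "ennreal \<bar>x\<bar> * (ennreal (std_normal_density x) * ennreal (std_normal_density (0 + x * s))) = ennreal (1 / (2 * pi)) * ennreal (\<bar>x\<bar> * exp (- (1 + s\<^sup>2) * x\<^sup>2 / 2))"
            using e by (simp flip: ennreal_mult)
          then show "ennreal \<bar>x\<bar> * (ennreal (std_normal_density x) * (ennreal (std_normal_density (0 + x * s)) * indicator {z. R < z} (x\<^sup>2 + (0 + x * s)\<^sup>2)))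
            = ennreal (1 / (2 * pi)) * (ennreal (\<bar>x\<bar> * exp (- (1 + s\<^sup>2) * x\<^sup>2 / 2)) * indicator {x. R < (1 + s\<^sup>2) * x\<^sup>2} x)"
            unfolding i by (simp only: mult.assoc[symmetric])
        qed
        finally show ?case .
      qed
    qed
    also have "\<dots> = (\<integral>\<^sup>+s. \<integral>\<^sup>+x. ennreal (1 / (2 * pi)) * (ennreal (\<bar>x\<bar> * exp (- (1 + s\<^sup>2) * x\<^sup>2 / 2)) * indicator {x. R < (1 + s\<^sup>2) * x\<^sup>2} x) \<partial>lborel \<partial>lborel)"
      by (rule lborel_pair.Fubini') (simp add: case_prod_unfold indicator_def, measurable)
    also have "\<dots> = (\<integral>\<^sup>+s. ennreal (exp (- R / 2)) * w s \<partial>lborel)"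
    proof (rule nn_integral_cong)
      fix s :: real
      have c: "1 + s\<^sup>2 > 0" by (rule add_pos_nonneg) auto
      have "(\<integral>\<^sup>+x. ennreal (1 / (2 * pi)) * (ennreal (\<bar>x\<bar> * exp (- (1 + s\<^sup>2) * x\<^sup>2 / 2)) * indicator {x. R < (1 + s\<^sup>2) * x\<^sup>2} x) \<partial>lborel)
        = ennreal (1 / (2 * pi)) * ennreal (2 * exp (- R / 2) / (1 + s\<^sup>2))"
        by (subst nn_integral_cmult, measurable, subst nn_integral_radial_section[OF c R]) simp
      also have "\<dots> = ennreal (exp (- R / 2)) * w s"
        using c by (simp add: w_def flip: ennreal_mult)
      finally show "(\<integral>\<^sup>+x. ennreal (1 / (2 * pi)) * (ennreal (\<bar>x\<bar> * exp (- (1 + s\<^sup>2) * x\<^sup>2 / 2)) * indicator {x. R < (1 + s\<^sup>2) * x\<^sup>2} x) \<partial>lborel) = ennreal (exp (- R / 2)) * w s" .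
    qed
    also have "\<dots> = ennreal (exp (- R / 2)) * (\<integral>\<^sup>+s. w s \<partial>lborel)"
      by (rule nn_integral_cmult) (simp add: w_def)
    finally show ?thesis .
  qed
  have "(\<integral>\<^sup>+x. \<integral>\<^sup>+y. indicator {z. 0 < z} (x\<^sup>2 + y\<^sup>2) \<partial>std_normal \<partial>std_normal) = (\<integral>\<^sup>+x. 1 \<partial>std_normal)"
  proof (rule nn_integral_cong_AE)
    have "AE x in lborel. x \<noteq> (0::real)" by (rule AE_lborel_singleton)
    then have "AE x in std_normal. x \<noteq> 0" by (subst AE_density) auto
    then show "AE x in std_normal. (\<integral>\<^sup>+y. indicator {z. 0 < z} (x\<^sup>2 + y\<^sup>2) \<partial>std_normal) = 1"
    proof eventually_elim
      case (elim x)
      have "(\<integral>\<^sup>+y. indicator {z. 0 < z} (x\<^sup>2 + y\<^sup>2) \<partial>std_normal) = (\<integral>\<^sup>+y. 1 \<partial>std_normal)"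
        using elim by (intro nn_integral_cong) (auto simp: indicator_def intro: add_pos_nonneg)
      also have "\<dots> = 1" using std_normal.emeasure_space_1 by simp
      finally show ?case .
    qed
  qed
  also have "\<dots> = 1" using std_normal.emeasure_space_1 by simp
  finally have "(\<integral>\<^sup>+s. w s \<partial>lborel) = 1" using tail[of 0] by simp
  then show ?thesis using tail[OF R] by simp
qed

lemma std_normal_moments:
  "integrable std_normal (\<lambda>x. x)" "integrable std_normal (\<lambda>x. x\<^sup>2)"
  "(LINT x|std_normal. x) = 0" "(LINT x|std_normal. x\<^sup>2) = 1"
proof -
  show "integrable std_normal (\<lambda>x. x)" "integrable std_normal (\<lambda>x. x\<^sup>2)"
    using integrable_std_normal_moment[of 1] integrable_std_normal_moment[of 2] by (simp_all add: integrable_density)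
  show "(LINT x|std_normal. x) = 0" "(LINT x|std_normal. x\<^sup>2) = 1"
    using integral_std_normal_moment_odd[of 0] integral_std_normal_moment_even[of 1] by (simp_all add: integral_density fact_2)
qed

lemma std_normal2_product:
  fixes f h :: "real \<Rightarrow> real"
  assumes "integrable std_normal f" "integrable std_normal h"
  shows "integrable (std_normal \<Otimes>\<^sub>M std_normal) (\<lambda>z. f (fst z) * h (snd z))"
    and "(LINT z|(std_normal \<Otimes>\<^sub>M std_normal). f (fst z) * h (snd z)) = (LINT x|std_normal. f x) * (LINT y|std_normal. h y)"
proof -
  have [measurable]: "f \<in> borel_measurable borel" "h \<in> borel_measurable borel"
    using borel_measurable_integrable[OF assms(1)] borel_measurable_integrable[OF assms(2)] by simp_all
  show int: "integrable (std_normal \<Otimes>\<^sub>M std_normal) (\<lambda>z. f (fst z) * h (snd z))"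
  proof (rule std_normal2.Fubini_integrable)
    show "integrable std_normal (\<lambda>x. LINT y|std_normal. norm (f (fst (x, y)) * h (snd (x, y))))"
      using assms by (simp add: abs_mult)
    show "AE x in std_normal. integrable std_normal (\<lambda>y. f (fst (x, y)) * h (snd (x, y)))"
      using assms by simp
  qed measurable
  show "(LINT z|(std_normal \<Otimes>\<^sub>M std_normal). f (fst z) * h (snd z)) = (LINT x|std_normal. f x) * (LINT y|std_normal. h y)"
    using std_normal2.integral_fst'[OF int] by simp
qed

text \<open>For \<open>X = m0 + x a + y b\<close> the three moments give \<open>m0 = 0\<close>,
  \<open>a\<^sup>2 + b\<^sup>2 = 0\<close> and total variance 1. The second relation factors over
  the complex numbers into \<open>b = \<i> a\<close> or \<open>b = - \<i> a\<close>, so the law is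
  circular with \<open>2 * (norm a)\<^sup>2 = 1\<close>, and \<open>2 * (norm X)\<^sup>2\<close> is
  distributed as the squared radius of a standard normal pair.\<close>

lemma complex_gaussian_standard_tail:
  assumes M: "prob_space M" and g: "complex_gaussian M X"
    and m: "prob_space.expectation M X = 0" "prob_space.expectation M (\<lambda>\<omega>. X \<omega> * X \<omega>) = 0"
      "prob_space.expectation M (\<lambda>\<omega>. X \<omega> * cnj (X \<omega>)) = 1"
    and r: "r \<ge> 0"
  shows "emeasure M {\<omega> \<in> space M. norm (X \<omega>) > r} = ennreal (exp (- r\<^sup>2))"
proof -
  have X [measurable]: "X \<in> borel_measurable M" using g by (simp add: complex_gaussian_def)
  let ?P = "std_normal \<Otimes>\<^sub>M std_normal"
  obtain m0 a b where law: "distr M borel X = distr ?P borel (\<lambda>(x, y). m0 + of_real x * a + of_real y * b)"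
    using g unfolding complex_gaussian_def by auto
  define G where "G = (\<lambda>z::real \<times> real. m0 + of_real (fst z) * a + of_real (snd z) * b)"
  have law: "distr M borel X = distr ?P borel G" using law by (simp add: G_def case_prod_unfold)
  have [measurable]: "G \<in> borel_measurable ?P" unfolding G_def by measurable
  have E: "(LINT \<omega>|M. f (X \<omega>)) = (LINT z|?P. f (G z))" if [measurable]: "f \<in> borel_measurable borel" for f :: "complex \<Rightarrow> complex"
    using law integral_distr[of X M borel f] integral_distr[of G ?P borel f] by simp
  note mom = std_normal_moments
  have c1: "integrable std_normal (\<lambda>x. 1::real)" "(LINT x|std_normal. 1::real) = 1"
    using std_normal.prob_space by (simp_all)
  have i: "integrable ?P (\<lambda>z. fst z)" "integrable ?P (\<lambda>z. snd z)" "integrable ?P (\<lambda>z. (fst z)\<^sup>2)" "integrable ?P (\<lambda>z. (snd z)\<^sup>2)"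
      "integrable ?P (\<lambda>z. fst z * snd z)"
    using std_normal2_product(1)[OF mom(1) c1(1)] std_normal2_product(1)[OF c1(1) mom(1)] std_normal2_product(1)[OF mom(2) c1(1)]
      std_normal2_product(1)[OF c1(1) mom(2)] std_normal2_product(1)[OF mom(1) mom(1)] by simp_all
  have v: "(LINT z|?P. fst z) = 0" "(LINT z|?P. snd z) = 0" "(LINT z|?P. (fst z)\<^sup>2) = 1" "(LINT z|?P. (snd z)\<^sup>2) = 1" "(LINT z|?P. fst z * snd z) = 0"
    using std_normal2_product(2)[OF mom(1) c1(1)] std_normal2_product(2)[OF c1(1) mom(1)] std_normal2_product(2)[OF mom(2) c1(1)]
      std_normal2_product(2)[OF c1(1) mom(2)] std_normal2_product(2)[OF mom(1) mom(1)] mom c1 by simp_all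
  have P1: "measure ?P (space ?P) = 1" by (rule std_normal2.P.prob_space)
  have lin: "(LINT z|?P. k0 + of_real (fst z) * k1 + of_real (snd z) * k2 + of_real ((fst z)\<^sup>2) * k3 + of_real ((snd z)\<^sup>2) * k4 + of_real (fst z * snd z) * k5)
     = k0 + k3 + k4" for k0 k1 k2 k3 k4 k5 :: complex
  proof -
    have j: "integrable ?P (\<lambda>z. complex_of_real (f z) * k)" if "integrable ?P f" for f k
      using that by (intro integrable_mult_left integrable_of_real)
    have l: "(LINT z|?P. complex_of_real (f z) * k) = of_real (LINT z|?P. f z) * k" for f k
      by (simp only: integral_mult_left_zero integral_complex_of_real)
    have k0: "integrable ?P (\<lambda>z. k0)" "(LINT z|?P. k0) = k0" using P1 by simp_all
    show ?thesis
      by (simp only: Bochner_Integration.integral_add Bochner_Integration.integrable_add j i l v k0) simp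
  qed
  have m0: "m0 = 0"
  proof -
    have "(LINT \<omega>|M. X \<omega>) = (LINT z|?P. G z)" using E[of "\<lambda>x. x"] by simp
    also have "\<dots> = m0" using lin[of m0 a b 0 0 0] by (simp add: G_def)
    finally show ?thesis using m(1) by simp
  qed
  have sq: "a\<^sup>2 + b\<^sup>2 = 0"
  proof -
    have "(LINT \<omega>|M. X \<omega> * X \<omega>) = (LINT z|?P. G z * G z)" using E[of "\<lambda>x. x * x"] by simp
    also have "\<dots> = (LINT z|?P. 0 + of_real (fst z) * 0 + of_real (snd z) * 0 + of_real ((fst z)\<^sup>2) * a\<^sup>2 + of_real ((snd z)\<^sup>2) * b\<^sup>2 + of_real (fst z * snd z) * (2 * a * b))"
      by (intro Bochner_Integration.integral_cong refl) (simp add: G_def m0 power2_eq_square algebra_simps)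
    also have "\<dots> = a\<^sup>2 + b\<^sup>2" unfolding lin by simp
    finally show ?thesis using m(2) by simp
  qed
  have ab: "a * cnj a + b * cnj b = 1"
  proof -
    have "(LINT \<omega>|M. X \<omega> * cnj (X \<omega>)) = (LINT z|?P. G z * cnj (G z))" using E[of "\<lambda>x. x * cnj x"] by simp
    also have "\<dots> = (LINT z|?P. 0 + of_real (fst z) * 0 + of_real (snd z) * 0 + of_real ((fst z)\<^sup>2) * (a * cnj a) + of_real ((snd z)\<^sup>2) * (b * cnj b) + of_real (fst z * snd z) * (a * cnj b + b * cnj a))"
      by (intro Bochner_Integration.integral_cong refl) (simp add: G_def m0 power2_eq_square algebra_simps)
    also have "\<dots> = a * cnj a + b * cnj b" unfolding lin by simp
    finally show ?thesis using m(3) by simp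
  qed
  have bi: "b = \<i> * a \<or> b = - (\<i> * a)"
  proof -
    have "(b - \<i> * a) * (b + \<i> * a) = 0" using sq by (simp add: algebra_simps power2_eq_square)
    then show ?thesis by (auto simp: add_eq_0_iff2)
  qed
  have "b * cnj b = a * cnj a" using bi by (auto simp: complex_eq_iff)
  then have "a * cnj a + a * cnj a = 1" using ab by simp
  then have "complex_of_real (2 * (norm a)\<^sup>2) = 1" by (simp add: complex_norm_square del: of_real_power)
  then have na: "2 * (norm a)\<^sup>2 = 1" by (metis of_real_eq_1_iff)
  have nG: "2 * (norm (G z))\<^sup>2 = (fst z)\<^sup>2 + (snd z)\<^sup>2" for z
  proof -
    have "(norm (G z))\<^sup>2 = (norm a)\<^sup>2 * ((fst z)\<^sup>2 + (snd z)\<^sup>2)"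
      unfolding cmod_power2 using bi by (auto simp: G_def m0 power2_eq_square algebra_simps)
    then show ?thesis using na by (simp add: mult.assoc[symmetric])
  qed
  have ind: "norm (G z) > r \<longleftrightarrow> 2 * r\<^sup>2 < (fst z)\<^sup>2 + (snd z)\<^sup>2" for z
  proof -
    have "norm (G z) > r \<longleftrightarrow> (norm (G z))\<^sup>2 > r\<^sup>2"
      using r by (meson norm_ge_zero power2_less_imp_less power_strict_mono zero_less_numeral)
    then show ?thesis by (simp add: nG[symmetric])
  qed
  have "emeasure M {\<omega> \<in> space M. norm (X \<omega>) > r} = emeasure (distr M borel X) {x. norm x > r}"
    by (subst emeasure_distr) (auto intro!: arg_cong2[where f = emeasure])
  also have "\<dots> = emeasure ?P {z. norm (G z) > r}"
    unfolding law by (subst emeasure_distr) (auto intro!: arg_cong2[where f = emeasure] simp: space_pair_measure)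
  also have "\<dots> = (\<integral>\<^sup>+z. indicator {z. norm (G z) > r} z \<partial>?P)"
  proof -
    have "{z \<in> space ?P. norm (G z) > r} \<in> sets ?P" by measurable
    then have "{z. norm (G z) > r} \<in> sets ?P" by (simp only: space_pair_measure space_density space_lborel space_borel UNIV_Times_UNIV UNIV_I simp_thms)
    then show ?thesis by (simp only: nn_integral_indicator)
  qed
  also have "\<dots> = (\<integral>\<^sup>+z. indicator {u. 2 * r\<^sup>2 < u} ((fst z)\<^sup>2 + (snd z)\<^sup>2) \<partial>?P)"
    by (intro nn_integral_cong) (simp add: indicator_def ind)
  also have "\<dots> = (\<integral>\<^sup>+x. \<integral>\<^sup>+y. indicator {u. 2 * r\<^sup>2 < u} (x\<^sup>2 + y\<^sup>2) \<partial>std_normal \<partial>std_normal)"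
    by (subst std_normal.nn_integral_fst[symmetric]) simp_all
  also have "\<dots> = ennreal (exp (- r\<^sup>2))" by (subst std_normal_radius_tail) simp_all
  finally show ?thesis .
qed

text \<open>The \<open>\<ell>\<^sup>1\<close> norm sees only the moduli of the Gaussian
  coefficients, so what is carried forward is their independence and the tail
  \<open>exp (- r\<^sup>2)\<close>.\<close>

locale rayleigh_family = prob_space M for M :: "'w measure" +
  fixes X :: "int \<Rightarrow> 'w \<Rightarrow> real"
  assumes indep: "indep_vars (\<lambda>_. borel) X UNIV"
    and X_nonneg: "\<And>k \<omega>. X k \<omega> \<ge> 0"
    and X_tail: "\<And>k r. r \<ge> 0 \<Longrightarrow> emeasure M {\<omega> \<in> space M. X k \<omega> > r} = ennreal (exp (- r\<^sup>2))"
begin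

lemma X_measurable [measurable]: "X k \<in> borel_measurable M"
  using indep by (auto simp: indep_vars_def)

lemma X_prob_tail: "r \<ge> 0 \<Longrightarrow> prob {\<omega> \<in> space M. X k \<omega> > r} = exp (- r\<^sup>2)"
  by (simp add: measure_def X_tail)

lemma nn_integral_gaussian_shift: "(\<integral>\<^sup>+u. ennreal (exp (s * u - u\<^sup>2)) \<partial>lborel) = ennreal (sqrt pi * exp (s\<^sup>2 / 4))" for s :: real
proof -
  have "(\<integral>\<^sup>+u. ennreal (exp (s * u - u\<^sup>2)) \<partial>lborel) = (\<integral>\<^sup>+u. ennreal (sqrt pi * exp (s\<^sup>2 / 4)) * ennreal (normal_density (s / 2) (1 / sqrt 2) u) \<partial>lborel)"
  proof (rule nn_integral_cong)
    fix u
    have "exp (s * u - u\<^sup>2) = (sqrt pi * exp (s\<^sup>2 / 4)) * normal_density (s / 2) (1 / sqrt 2) u"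
    proof -
      have "normal_density (s / 2) (1 / sqrt 2) u = exp (- (u - s / 2)\<^sup>2) / sqrt pi"
        by (simp add: normal_density_def power_divide)
      moreover have "s * u - u\<^sup>2 = s\<^sup>2 / 4 + - (u - s / 2)\<^sup>2"
        by (simp add: power2_eq_square algebra_simps)
      ultimately show ?thesis by (simp only: exp_add) simp
    qed
    then show "ennreal (exp (s * u - u\<^sup>2)) = ennreal (sqrt pi * exp (s\<^sup>2 / 4)) * ennreal (normal_density (s / 2) (1 / sqrt 2) u)"
      by (simp flip: ennreal_mult)
  qed
  also have "\<dots> = ennreal (sqrt pi * exp (s\<^sup>2 / 4)) * (\<integral>\<^sup>+u. ennreal (normal_density (s / 2) (1 / sqrt 2) u) \<partial>lborel)"
    by (rule nn_integral_cmult) measurable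
  also have "(\<integral>\<^sup>+u. ennreal (normal_density (s / 2) (1 / sqrt 2) u) \<partial>lborel) = 1"
    by (subst nn_integral_eq_integral) auto
  finally show ?thesis by simp
qed

text \<open>By layer cake the exponential moment is 1 plus the integral of
  \<open>s * exp (s * u)\<close> against the tail at \<open>u\<close>, which is evaluated by
  completing the square; then \<open>1 + x \<le> exp x\<close>. The term linear in \<open>s\<close>,
  once summed over modes, becomes a multiple of the sum of the \<open>c k\<close>: this is where
  absolute summability enters the upper bound.\<close>

lemma X_mgf:
  assumes s: "s \<ge> 0"
  shows "(\<integral>\<^sup>+\<omega>. ennreal (exp (s * X k \<omega>)) \<partial>M) \<le> ennreal (exp (s\<^sup>2 / 4 + sqrt pi * s))"
proof -
  have pw: "ennreal (exp (s * X k \<omega>)) = 1 + (\<integral>\<^sup>+u. ennreal (s * exp (s * u)) * indicator {0..X k \<omega>} u \<partial>lborel)" for \<omega>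
  proof -
    have "(\<integral>\<^sup>+u. ennreal (s * exp (s * u)) * indicator {0..X k \<omega>} u \<partial>lborel) = ennreal (exp (s * X k \<omega>) - exp (s * 0))"
      by (rule nn_integral_FTC_Icc) (use s X_nonneg in \<open>auto intro!: derivative_eq_intros simp: has_real_derivative_iff_has_vector_derivative[symmetric]\<close>)
    then have "1 + (\<integral>\<^sup>+u. ennreal (s * exp (s * u)) * indicator {0..X k \<omega>} u \<partial>lborel) = ennreal 1 + ennreal (exp (s * X k \<omega>) - 1)"
      by simp
    also have "\<dots> = ennreal (exp (s * X k \<omega>))"
      using s X_nonneg[of k \<omega>] by (subst ennreal_plus[symmetric]) auto
    finally show ?thesis by simp
  qed
  have "(\<integral>\<^sup>+\<omega>. ennreal (exp (s * X k \<omega>)) \<partial>M) = 1 + (\<integral>\<^sup>+\<omega>. \<integral>\<^sup>+u. ennreal (s * exp (s * u)) * indicator {0..X k \<omega>} u \<partial>lborel \<partial>M)"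
    unfolding pw by (subst nn_integral_add) (auto simp: emeasure_space_1 indicator_def, measurable)
  also have "(\<integral>\<^sup>+\<omega>. \<integral>\<^sup>+u. ennreal (s * exp (s * u)) * indicator {0..X k \<omega>} u \<partial>lborel \<partial>M)
    = (\<integral>\<^sup>+u. \<integral>\<^sup>+\<omega>. ennreal (s * exp (s * u)) * indicator {0..X k \<omega>} u \<partial>M \<partial>lborel)"
  proof -
    interpret P: pair_sigma_finite lborel M by standard
    show ?thesis by (rule P.Fubini') (simp add: indicator_def case_prod_unfold, measurable)
  qed
  also have "\<dots> \<le> (\<integral>\<^sup>+u. ennreal s * ennreal (exp (s * u - u\<^sup>2)) \<partial>lborel)"
  proof (rule nn_integral_mono_AE)
    have "AE u in lborel. u \<noteq> (0::real)" by (rule AE_lborel_singleton)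
    then show "AE u in lborel. (\<integral>\<^sup>+\<omega>. ennreal (s * exp (s * u)) * indicator {0..X k \<omega>} u \<partial>M) \<le> ennreal s * ennreal (exp (s * u - u\<^sup>2))"
    proof eventually_elim
      case (elim u)
      have "(\<integral>\<^sup>+\<omega>. ennreal (s * exp (s * u)) * indicator {0..X k \<omega>} u \<partial>M) = ennreal (s * exp (s * u)) * (\<integral>\<^sup>+\<omega>. indicator {0..X k \<omega>} u \<partial>M)"
        by (rule nn_integral_cmult) (simp add: indicator_def, measurable)
      also have "(\<integral>\<^sup>+\<omega>. indicator {0..X k \<omega>} u \<partial>M) \<le> ennreal (exp (- u\<^sup>2))"
      proof (cases "u > 0")
        case False
        then have "indicator {0..X k \<omega>} u = (0::ennreal)" for \<omega> using elim by (auto simp: indicator_def)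
        then show ?thesis by simp
      next
        case True
        \<comment> \<open>The indicator describes \<open>X k \<omega> \<ge> u\<close>, while the
          tails are given for strict inequalities; the bound at \<open>u\<close> is reached as a
          limit of levels \<open>r < u\<close>.\<close>
        have le: "(\<integral>\<^sup>+\<omega>. indicator {0..X k \<omega>} u \<partial>M) \<le> ennreal (exp (- r\<^sup>2))" if r: "0 < r" "r < u" for r
        proof -
          have "(\<integral>\<^sup>+\<omega>. indicator {0..X k \<omega>} u \<partial>M) \<le> (\<integral>\<^sup>+\<omega>. indicator {\<omega> \<in> space M. X k \<omega> > r} \<omega> \<partial>M)"
            by (rule nn_integral_mono) (use r in \<open>auto simp: indicator_def\<close>)
          also have "\<dots> = ennreal (exp (- r\<^sup>2))" using X_tail[of r k] r by simp
          finally show ?thesis .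
        qed
        have "((\<lambda>r. ennreal (exp (- r\<^sup>2))) \<longlongrightarrow> ennreal (exp (- u\<^sup>2))) (at_left u)"
          by (intro tendsto_intros tendsto_ennrealI)
        then show ?thesis
        proof (rule tendsto_lowerbound)
          show "eventually (\<lambda>r. (\<integral>\<^sup>+\<omega>. indicator {0..X k \<omega>} u \<partial>M) \<le> ennreal (exp (- r\<^sup>2))) (at_left u)"
            using eventually_at_left_real[OF True] by eventually_elim (auto intro: le)
        qed simp
      qed
      also have "ennreal (s * exp (s * u)) * ennreal (exp (- u\<^sup>2)) = ennreal s * ennreal (exp (s * u - u\<^sup>2))"
        using s by (simp add: exp_diff exp_minus divide_inverse ennreal_mult mult.assoc)
      finally show ?case by (simp add: mult_left_mono)
    qed
  qed
  also have "\<dots> = ennreal s * ennreal (sqrt pi * exp (s\<^sup>2 / 4))"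
    by (subst nn_integral_cmult) (auto simp: nn_integral_gaussian_shift)
  also have "1 + \<dots> = ennreal (1 + s * (sqrt pi * exp (s\<^sup>2 / 4)))"
    using s by (simp add: ennreal_mult)
  also have "\<dots> \<le> ennreal (exp (s\<^sup>2 / 4 + sqrt pi * s))"
  proof (rule ennreal_leI)
    have "1 + s * (sqrt pi * exp (s\<^sup>2 / 4)) \<le> exp (s\<^sup>2 / 4) * (1 + sqrt pi * s)"
      using one_le_exp_iff[of "s\<^sup>2 / 4"] by (simp add: algebra_simps)
    also have "\<dots> \<le> exp (s\<^sup>2 / 4) * exp (sqrt pi * s)"
      by (intro mult_left_mono exp_ge_add_one_self) auto
    finally show "1 + s * (sqrt pi * exp (s\<^sup>2 / 4)) \<le> exp (s\<^sup>2 / 4 + sqrt pi * s)" by (simp add: exp_add)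
  qed
  finally show ?thesis by (simp add: add_left_mono)
qed

definition weighted_sum :: "(int \<Rightarrow> real) \<Rightarrow> 'w \<Rightarrow> ennreal" where
  "weighted_sum c \<omega> = (\<integral>\<^sup>+k. ennreal (c k * X k \<omega>) \<partial>ints)"

lemma weighted_sum_measurable [measurable]: "weighted_sum c \<in> borel_measurable M"
  unfolding weighted_sum_def by (rule borel_measurable_nn_integral_count_space) measurable

text \<open>Chernoff's bound. The parameter \<mu> is left free because its optimal value depends on
  \<open>R\<close>, and the set \<open>A\<close> enters only through \<open>s1\<close> and
  \<open>s2\<close>, so that the bound survives exhaustion by finite windows.\<close>

lemma finite_sum_tail:
  assumes A: "finite A" and c: "\<And>k. c k \<ge> 0" and l: "\<mu> \<ge> 0"
    and s2: "(\<Sum>k\<in>A. (c k)\<^sup>2) \<le> s2" and s1: "(\<Sum>k\<in>A. c k) \<le> s1"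
  shows "prob {\<omega> \<in> space M. (\<Sum>k\<in>A. c k * X k \<omega>) > R} \<le> exp (- \<mu> * R + \<mu>\<^sup>2 * s2 / 4 + sqrt pi * \<mu> * s1)"
proof -
  let ?E = "{\<omega> \<in> space M. (\<Sum>k\<in>A. c k * X k \<omega>) > R}"
  have "ennreal (exp (\<mu> * R)) * emeasure M ?E = (\<integral>\<^sup>+\<omega>. ennreal (exp (\<mu> * R)) * indicator ?E \<omega> \<partial>M)"
    by (simp add: nn_integral_cmult)
  also have "\<dots> \<le> (\<integral>\<^sup>+\<omega>. (\<Prod>k\<in>A. ennreal (exp (\<mu> * c k * X k \<omega>))) \<partial>M)"
  proof (rule nn_integral_mono)
    fix \<omega>
    have "(\<Prod>k\<in>A. ennreal (exp (\<mu> * c k * X k \<omega>))) = ennreal (exp (\<mu> * (\<Sum>k\<in>A. c k * X k \<omega>)))"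
      using A by (simp add: prod_ennreal exp_sum[symmetric] sum_distrib_left mult.assoc)
    then show "ennreal (exp (\<mu> * R)) * indicator ?E \<omega> \<le> (\<Prod>k\<in>A. ennreal (exp (\<mu> * c k * X k \<omega>)))"
      using l by (auto simp: indicator_def intro!: ennreal_leI mult_left_mono)
  qed
  also have "\<dots> = (\<Prod>k\<in>A. \<integral>\<^sup>+\<omega>. ennreal (exp (\<mu> * c k * X k \<omega>)) \<partial>M)"
  proof (rule indep_vars_nn_integral[OF A])
    show "indep_vars (\<lambda>_. borel) (\<lambda>k \<omega>. ennreal (exp (\<mu> * c k * X k \<omega>))) A"
      by (rule indep_vars_compose2[OF indep_vars_subset[OF indep subset_UNIV], of A "\<lambda>k x. ennreal (exp (\<mu> * c k * x))"]) simp
  qed simp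
  also have "\<dots> \<le> (\<Prod>k\<in>A. ennreal (exp ((\<mu> * c k)\<^sup>2 / 4 + sqrt pi * (\<mu> * c k))))"
    by (intro prod_mono_ennreal X_mgf) (use l c in auto)
  also have "\<dots> = ennreal (exp (\<Sum>k\<in>A. (\<mu> * c k)\<^sup>2 / 4 + sqrt pi * (\<mu> * c k)))"
    using A by (simp add: prod_ennreal exp_sum[symmetric])
  also have "(\<Sum>k\<in>A. (\<mu> * c k)\<^sup>2 / 4 + sqrt pi * (\<mu> * c k)) = \<mu>\<^sup>2 / 4 * (\<Sum>k\<in>A. (c k)\<^sup>2) + sqrt pi * \<mu> * (\<Sum>k\<in>A. c k)"
    by (simp add: sum.distrib sum_distrib_left power_mult_distrib mult.assoc)
  also have "ennreal (exp \<dots>) \<le> ennreal (exp (\<mu>\<^sup>2 / 4 * s2 + sqrt pi * \<mu> * s1))"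
    using s1 s2 l by (intro ennreal_leI) (auto intro!: add_mono mult_left_mono)
  finally have "exp (\<mu> * R) * prob ?E \<le> exp (\<mu>\<^sup>2 / 4 * s2 + sqrt pi * \<mu> * s1)"
    by (simp add: emeasure_eq_measure flip: ennreal_mult)
  then have "prob ?E \<le> exp (\<mu>\<^sup>2 / 4 * s2 + sqrt pi * \<mu> * s1) / exp (\<mu> * R)" by (simp add: le_divide_eq mult.commute)
  then show ?thesis by (simp add: exp_diff[symmetric] algebra_simps)
qed

text \<open>The event for the whole series is covered by the increasing union of the events for
  symmetric windows, and the finite bound does not depend on the window.\<close>

lemma weighted_sum_tail_le:
  assumes c: "\<And>k. c k \<ge> 0" and l: "\<mu> \<ge> 0" and R: "R \<ge> 0"
    and s2: "\<And>A. finite A \<Longrightarrow> (\<Sum>k\<in>A. (c k)\<^sup>2) \<le> s2" and s1: "\<And>A. finite A \<Longrightarrow> (\<Sum>k\<in>A. c k) \<le> s1"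
  shows "prob {\<omega> \<in> space M. weighted_sum c \<omega> > ennreal R} \<le> exp (- \<mu> * R + \<mu>\<^sup>2 * s2 / 4 + sqrt pi * \<mu> * s1)"
proof -
  define E where "E = (\<lambda>N. {\<omega> \<in> space M. (\<Sum>k\<in>{-int N..int N}. c k * X k \<omega>) > R})"
  have [measurable]: "E N \<in> sets M" for N unfolding E_def by measurable
  have "{\<omega> \<in> space M. weighted_sum c \<omega> > ennreal R} \<subseteq> (\<Union>N. E N)"
  proof
    fix \<omega> assume w: "\<omega> \<in> {\<omega> \<in> space M. weighted_sum c \<omega> > ennreal R}"
    show "\<omega> \<in> (\<Union>N. E N)"
    proof (rule ccontr)
      assume n: "\<omega> \<notin> (\<Union>N. E N)"
      have "weighted_sum c \<omega> \<le> ennreal R"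
        unfolding weighted_sum_def
      proof (rule nn_integral_ints_le)
        fix A :: "int set" assume A: "finite A"
        then obtain N where N: "A \<subseteq> {-int N..int N}"
        proof -
          obtain B where "\<forall>a\<in>A. \<bar>a\<bar> \<le> B" using A by (metis (mono_tags) finite_imageI image_eqI Max_ge)
          then have "A \<subseteq> {-int (nat B)..int (nat B)}" by (auto simp: abs_le_iff)
          with that show ?thesis by blast
        qed
        have "(\<Sum>k\<in>A. c k * X k \<omega>) \<le> (\<Sum>k\<in>{-int N..int N}. c k * X k \<omega>)"
          using N c X_nonneg by (intro sum_mono2) auto
        also have "\<dots> \<le> R" using n w by (auto simp: E_def not_less)
        finally show "(\<Sum>k\<in>A. ennreal (c k * X k \<omega>)) \<le> ennreal R"
          using c X_nonneg by (simp add: sum_ennreal ennreal_leI)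
      qed
      with w show False by auto
    qed
  qed
  then have "prob {\<omega> \<in> space M. weighted_sum c \<omega> > ennreal R} \<le> prob (\<Union>N. E N)" by (intro finite_measure_mono) auto
  moreover have "(\<lambda>N. prob (E N)) \<longlonglongrightarrow> prob (\<Union>N. E N)"
  proof (rule finite_Lim_measure_incseq)
    show "incseq E"
    proof (rule incseq_SucI)
      fix N
      have "(\<Sum>k\<in>{-int N..int N}. c k * X k \<omega>) \<le> (\<Sum>k\<in>{-int (Suc N)..int (Suc N)}. c k * X k \<omega>)" for \<omega>
        using c X_nonneg by (intro sum_mono2) auto
      then show "E N \<subseteq> E (Suc N)" unfolding E_def by (auto intro: less_le_trans)
    qed
  qed auto
  moreover have "prob (E N) \<le> exp (- \<mu> * R + \<mu>\<^sup>2 * s2 / 4 + sqrt pi * \<mu> * s1)" for N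
    unfolding E_def by (rule finite_sum_tail) (use c l s1 s2 in auto)
  ultimately show ?thesis by (meson LIMSEQ_le_const2 order_trans)
qed

text \<open>The cheapest way to reach the level \<open>R\<close> is \<open>X\<^sub>k = R c\<^sub>k / \<Sum>\<^sub>j c\<^sub>j\<^sup>2\<close>.\<close>
lemma weighted_sum_tail_ge:
  assumes c: "\<And>k. c k \<ge> 0" and A: "finite A" and s: "(\<Sum>k\<in>A. (c k)\<^sup>2) > 0" and R: "R > 0"
  shows "prob {\<omega> \<in> space M. weighted_sum c \<omega> > ennreal R} \<ge> exp (- R\<^sup>2 / (\<Sum>k\<in>A. (c k)\<^sup>2))"
proof -
  define S where "S = (\<Sum>k\<in>A. (c k)\<^sup>2)"
  have S: "S > 0" using s by (simp add: S_def)
  have ne: "A \<noteq> {}" using s by auto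
  have "exp (- R\<^sup>2 / S) = (\<Prod>k\<in>A. exp (- (R * c k / S)\<^sup>2))"
  proof -
    have "(\<Sum>k\<in>A. - (R * c k / S)\<^sup>2) = - (R\<^sup>2 / S\<^sup>2) * S"
      by (simp add: S_def sum_negf power_divide power_mult_distrib sum_distrib_left sum_divide_distrib)
    also have "\<dots> = - R\<^sup>2 / S" using S by (simp add: power2_eq_square)
    finally show ?thesis using A by (simp add: exp_sum[symmetric])
  qed
  also have "\<dots> = (\<Prod>k\<in>A. prob (X k -` {R * c k / S<..} \<inter> space M))"
  proof (rule prod.cong[OF refl])
    fix k
    have "X k -` {R * c k / S<..} \<inter> space M = {\<omega> \<in> space M. X k \<omega> > R * c k / S}" by auto
    then show "exp (- (R * c k / S)\<^sup>2) = prob (X k -` {R * c k / S<..} \<inter> space M)"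
      using X_prob_tail[of "R * c k / S" k] R S c by simp
  qed
  also have "\<dots> = prob (\<Inter>k\<in>A. X k -` {R * c k / S<..} \<inter> space M)"
    by (rule indep_varsD[OF indep ne A, symmetric]) auto
  also have "\<dots> \<le> prob {\<omega> \<in> space M. weighted_sum c \<omega> > ennreal R}"
  proof (rule finite_measure_mono)
    show "(\<Inter>k\<in>A. X k -` {R * c k / S<..} \<inter> space M) \<subseteq> {\<omega> \<in> space M. weighted_sum c \<omega> > ennreal R}"
    proof
      fix \<omega> assume w: "\<omega> \<in> (\<Inter>k\<in>A. X k -` {R * c k / S<..} \<inter> space M)"
      obtain k0 where k0: "k0 \<in> A" "c k0 > 0"
      proof -
        have "\<exists>k\<in>A. (c k)\<^sup>2 \<noteq> 0" using s by (metis (no_types, lifting) less_irrefl sum.neutral)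
        then show ?thesis using that c by (metis order_le_less power_zero_numeral)
      qed
      have "R = (\<Sum>k\<in>A. c k * (R * c k / S))"
      proof -
        have "(\<Sum>k\<in>A. c k * (R * c k / S)) = (\<Sum>k\<in>A. (R / S) * (c k)\<^sup>2)"
          by (simp add: power2_eq_square mult_ac)
        also have "\<dots> = (R / S) * S" unfolding S_def sum_distrib_left ..
        finally have "(\<Sum>k\<in>A. c k * (R * c k / S)) = (R / S) * S" .
        then show ?thesis using S by simp
      qed
      also have "\<dots> < (\<Sum>k\<in>A. c k * X k \<omega>)"
      proof (rule sum_strict_mono_ex1[OF A])
        have wk: "R * c k / S < X k \<omega>" if "k \<in> A" for k using w that ne by auto
        show "\<forall>k\<in>A. c k * (R * c k / S) \<le> c k * X k \<omega>"
          by (intro ballI mult_left_mono[OF less_imp_le[OF wk] c])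
        show "\<exists>k\<in>A. c k * (R * c k / S) < c k * X k \<omega>"
          by (intro bexI[OF _ k0(1)] mult_strict_left_mono[OF wk[OF k0(1)] k0(2)])
      qed
      finally have "ennreal R < ennreal (\<Sum>k\<in>A. c k * X k \<omega>)" using R by (intro ennreal_lessI) auto
      also have "\<dots> = (\<Sum>k\<in>A. ennreal (c k * X k \<omega>))" using c X_nonneg by (simp add: sum_ennreal)
      also have "\<dots> \<le> weighted_sum c \<omega>" unfolding weighted_sum_def by (rule sum_le_nn_integral_count_space[OF A])
      finally show "\<omega> \<in> {\<omega> \<in> space M. weighted_sum c \<omega> > ennreal R}" using w ne by auto
    qed
  qed measurable
  finally show ?thesis by (simp add: S_def)
qed

text \<open>If the truncated sums were bounded, only finitely many \<open>b k\<close> could reach 1,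
  and the others coincide with their truncations, so \<open>b\<close> would be summable. The
  truncation at 1 is the one produced by the Laplace transforms in
  \<open>weighted_sum_infinite\<close>.\<close>

lemma not_summable_min_unbounded:
  fixes b :: "int \<Rightarrow> real"
  assumes b: "\<And>k. b k \<ge> 0" and ns: "\<not> b summable_on UNIV"
  shows "\<exists>A. finite A \<and> (\<Sum>k\<in>A. min (b k) 1) > L"
proof (rule ccontr)
  assume "\<not> ?thesis"
  then have bd: "(\<Sum>k\<in>A. min (b k) 1) \<le> L" if "finite A" for A using that by (meson linorder_not_le)
  have sm: "(\<lambda>k. min (b k) 1) summable_on UNIV"
  proof (rule nonneg_bdd_above_summable_on)
    show "bdd_above (sum (\<lambda>k. min (b k) 1) ` {F. F \<subseteq> UNIV \<and> finite F})"
      by (rule bdd_aboveI[where M = L]) (use bd in blast)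
  qed (use b in simp)
  have fin: "finite {k. b k \<ge> 1}"
  proof (rule ccontr)
    assume "infinite {k. b k \<ge> 1}"
    then obtain A where A: "finite A" "A \<subseteq> {k. b k \<ge> 1}" "card A = nat \<lceil>L\<rceil> + 1"
      by (metis infinite_arbitrarily_large)
    have "(\<Sum>k\<in>A. min (b k) 1) = real (card A)" using A by (subst sum.cong[of A A _ "\<lambda>_. 1"]) (auto simp: min_def)
    moreover have "real (card A) > L" using A(3) real_nat_ceiling_ge[of L] by simp
    ultimately show False using bd[OF A(1)] by simp
  qed
  have "b summable_on (UNIV - {k. b k \<ge> 1})"
    using summable_on_subset_banach[OF sm, of "UNIV - {k. b k \<ge> 1}"]
    by (rule summable_on_cong[THEN iffD1, rotated]) (auto simp: min_def)
  moreover have "b summable_on {k. b k \<ge> 1}" using fin by simp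
  ultimately have "b summable_on ((UNIV - {k. b k \<ge> 1}) \<union> {k. b k \<ge> 1})" by (rule summable_on_Un_disjoint) auto
  then show False using ns by (simp add: Un_absorb1)
qed

text \<open>Each \<open>X k \<omega> ^ p\<close> dominates the indicator \<open>Y\<close> of
  \<open>X k \<omega> > 1\<close>. By independence the Laplace transform of a finite sum of the
  \<open>b k * Y k \<omega>\<close> is at most
  \<open>exp (- q * (\<Sum>k\<in>A. min (b k) 1))\<close>, which can be made arbitrarily small, so
  by Markov's inequality no finite level bounds the sum with positive probability. It is applied
  with \<open>p = 1\<close> to \<open>c\<close> and with \<open>p = 2\<close> to its
  squares.\<close>

lemma weighted_sum_infinite:
  assumes b: "\<And>k. b k \<ge> 0" and ns: "\<not> b summable_on UNIV"
    and p: "p \<ge> (1::nat)"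
  shows "AE \<omega> in M. (\<integral>\<^sup>+k. ennreal (b k * X k \<omega> ^ p) \<partial>ints) = \<infinity>"
proof -
  define Y :: "int \<Rightarrow> 'w \<Rightarrow> real" where "Y = (\<lambda>k \<omega>. indicator {1<..} (X k \<omega>))"
  \<comment> \<open>The factor \<open>exp (- 1)\<close> is the probability of
    \<open>X k > 1\<close>; the factor \<open>1 - exp (- 1)\<close> comes from the chord of
    \<open>exp (- m)\<close> over \<open>[0, 1]\<close>.\<close>
  define q where "q = exp (- 1 :: real) * (1 - exp (- 1))"
  have q: "q > 0" by (simp add: q_def)
  have Ylap: "(\<integral>\<^sup>+\<omega>. ennreal (exp (- b k * Y k \<omega>)) \<partial>M) \<le> ennreal (exp (- q * min (b k) 1))" for k
  proof -
    let ?E = "{\<omega> \<in> space M. X k \<omega> > 1}"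
    have "(\<integral>\<^sup>+\<omega>. ennreal (exp (- b k * Y k \<omega>)) \<partial>M) = (\<integral>\<^sup>+\<omega>. ennreal (1 - (1 - exp (- b k)) * indicator ?E \<omega>) \<partial>M)"
      by (rule nn_integral_cong) (auto simp: Y_def indicator_def)
    also have "\<dots> = ennreal (LINT \<omega>|M. 1 - (1 - exp (- b k)) * indicator ?E \<omega>)"
    proof (rule nn_integral_eq_integral)
      show "integrable M (\<lambda>\<omega>. 1 - (1 - exp (- b k)) * indicator ?E \<omega>)"
        by (intro Bochner_Integration.integrable_diff integrable_mult_right integrable_real_indicator) (auto simp: emeasure_eq_measure)
      show "AE \<omega> in M. 0 \<le> 1 - (1 - exp (- b k)) * indicator ?E \<omega>"
        using b[of k] by (auto simp: indicator_def)
    qed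
    also have "(LINT \<omega>|M. 1 - (1 - exp (- b k)) * indicator ?E \<omega>) = 1 - (1 - exp (- b k)) * prob ?E"
    proof -
      have "integrable M (\<lambda>\<omega>. (1 - exp (- b k)) * indicat_real ?E \<omega>)"
        by (intro integrable_mult_right integrable_real_indicator) (auto simp: emeasure_eq_measure)
      then show ?thesis by (subst Bochner_Integration.integral_diff) (auto simp: prob_space)
    qed
    also have "prob ?E = exp (- 1)" using X_prob_tail[of 1 k] by simp
    also have "1 - (1 - exp (- b k)) * exp (- 1) \<le> exp (- q * min (b k) 1)"
    proof -
      define m where "m = min (b k) 1"
      have m: "0 \<le> m" "m \<le> 1" "m \<le> b k" using b[of k] by (auto simp: m_def)
      have "exp (- m) \<le> 1 - (1 - exp (- 1)) * m"
      proof -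
        have "exp ((1 - m) *\<^sub>R 0 + m *\<^sub>R (- 1)) \<le> (1 - m) * exp (0::real) + m * exp (- 1)"
          using m by (intro convex_onD[OF exp_convex]) auto
        then show ?thesis by (simp add: algebra_simps)
      qed
      moreover have "exp (- b k) \<le> exp (- m)" using m by simp
      ultimately have "(1 - exp (- 1)) * m \<le> 1 - exp (- b k)" by linarith
      then have "(1 - exp (- b k)) * exp (- 1) \<ge> ((1 - exp (- 1)) * m) * exp (- 1)"
        by (intro mult_right_mono) auto
      then have "1 - (1 - exp (- b k)) * exp (- 1) \<le> 1 + (- q * m)" by (simp add: q_def mult_ac)
      also have "\<dots> \<le> exp (- q * m)" by (rule exp_ge_add_one_self)
      finally show ?thesis by (simp add: m_def)
    qed
    finally show ?thesis by (simp add: ennreal_leI)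
  qed
  define Z where "Z = (\<lambda>\<omega>. \<integral>\<^sup>+k. ennreal (b k * X k \<omega> ^ p) \<partial>ints)"
  have [measurable]: "Z \<in> borel_measurable M"
    unfolding Z_def by (rule borel_measurable_nn_integral_count_space) measurable
  have zero: "prob {\<omega> \<in> space M. Z \<omega> \<le> ennreal (real L)} = 0" for L :: nat
  proof -
    let ?E = "{\<omega> \<in> space M. Z \<omega> \<le> ennreal (real L)}"
    have bound: "prob ?E \<le> exp (real L) * exp (- q * (\<Sum>k\<in>A. min (b k) 1))" if A: "finite A" for A
    proof -
      have "emeasure M ?E = (\<integral>\<^sup>+\<omega>. indicator ?E \<omega> \<partial>M)" by simp
      also have "\<dots> \<le> (\<integral>\<^sup>+\<omega>. ennreal (exp (real L)) * (\<Prod>k\<in>A. ennreal (exp (- b k * Y k \<omega>))) \<partial>M)"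
      proof (rule nn_integral_mono)
        fix \<omega>
        show "indicator ?E \<omega> \<le> ennreal (exp (real L)) * (\<Prod>k\<in>A. ennreal (exp (- b k * Y k \<omega>)))"
        proof (cases "\<omega> \<in> ?E")
          case True
          have "ennreal (\<Sum>k\<in>A. b k * Y k \<omega>) = (\<Sum>k\<in>A. ennreal (b k * Y k \<omega>))"
            using b by (simp add: sum_ennreal Y_def)
          also have "\<dots> \<le> (\<Sum>k\<in>A. ennreal (b k * X k \<omega> ^ p))"
            using b X_nonneg by (intro sum_mono ennreal_leI mult_left_mono) (auto simp: Y_def indicator_def one_le_power)
          also have "\<dots> \<le> Z \<omega>" unfolding Z_def by (rule sum_le_nn_integral_count_space[OF A])
          also have "\<dots> \<le> ennreal (real L)" using True by simp
          finally have "(\<Sum>k\<in>A. b k * Y k \<omega>) \<le> real L" by (simp add: ennreal_le_iff)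
          then have "1 \<le> exp (real L - (\<Sum>k\<in>A. b k * Y k \<omega>))" by simp
          also have "\<dots> = exp (real L) * exp (\<Sum>k\<in>A. - b k * Y k \<omega>)"
            by (simp add: sum_negf exp_diff exp_minus divide_inverse)
          also have "exp (\<Sum>k\<in>A. - b k * Y k \<omega>) = (\<Prod>k\<in>A. exp (- b k * Y k \<omega>))"
            by (rule exp_sum[OF A])
          finally have "ennreal 1 \<le> ennreal (exp (real L) * (\<Prod>k\<in>A. exp (- b k * Y k \<omega>)))" by (rule ennreal_leI)
          then show ?thesis using True by (simp add: ennreal_mult prod_nonneg prod_ennreal)
        qed simp
      qed
      also have "\<dots> = ennreal (exp (real L)) * (\<Prod>k\<in>A. \<integral>\<^sup>+\<omega>. ennreal (exp (- b k * Y k \<omega>)) \<partial>M)"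
      proof (subst nn_integral_cmult)
        show "(\<lambda>\<omega>. \<Prod>k\<in>A. ennreal (exp (- b k * Y k \<omega>))) \<in> borel_measurable M" unfolding Y_def by measurable
        have "(\<integral>\<^sup>+\<omega>. (\<Prod>k\<in>A. ennreal (exp (- b k * Y k \<omega>))) \<partial>M) = (\<Prod>k\<in>A. \<integral>\<^sup>+\<omega>. ennreal (exp (- b k * Y k \<omega>)) \<partial>M)"
        proof (rule indep_vars_nn_integral[OF A])
          show "indep_vars (\<lambda>_. borel) (\<lambda>k \<omega>. ennreal (exp (- b k * Y k \<omega>))) A"
            unfolding Y_def
            by (rule indep_vars_compose2[OF indep_vars_subset[OF indep subset_UNIV], of A "\<lambda>k x. ennreal (exp (- b k * indicator {1<..} x))"]) simp
        qed simp
        then show "ennreal (exp (real L)) * (\<integral>\<^sup>+\<omega>. (\<Prod>k\<in>A. ennreal (exp (- b k * Y k \<omega>))) \<partial>M)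
          = ennreal (exp (real L)) * (\<Prod>k\<in>A. \<integral>\<^sup>+\<omega>. ennreal (exp (- b k * Y k \<omega>)) \<partial>M)" by simp
      qed
      also have "\<dots> \<le> ennreal (exp (real L)) * (\<Prod>k\<in>A. ennreal (exp (- q * min (b k) 1)))"
        by (intro mult_left_mono prod_mono_ennreal Ylap) auto
      also have "\<dots> = ennreal (exp (real L) * exp (- q * (\<Sum>k\<in>A. min (b k) 1)))"
        using A by (simp add: prod_ennreal exp_sum[symmetric] sum_distrib_left sum_negf flip: ennreal_mult)
      finally show ?thesis by (simp add: emeasure_eq_measure)
    qed
    show ?thesis
    proof (rule ccontr)
      assume "prob ?E \<noteq> 0"
      then have pos: "prob ?E > 0" by (simp add: zero_less_measure_iff)
      obtain A where A: "finite A" "(\<Sum>k\<in>A. min (b k) 1) > (real L - ln (prob ?E)) / q"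
        using not_summable_min_unbounded[OF b ns] by blast
      have "q * (\<Sum>k\<in>A. min (b k) 1) > real L - ln (prob ?E)" using A(2) q by (simp add: divide_less_eq mult.commute)
      then have "exp (real L - q * (\<Sum>k\<in>A. min (b k) 1)) < exp (ln (prob ?E))" by simp
      also have "\<dots> = prob ?E" using pos by simp
      finally show False using bound[OF A(1)] by (simp add: exp_diff exp_minus divide_inverse)
    qed
  qed
  have "AE \<omega> in M. \<not> Z \<omega> \<le> ennreal (real L)" for L :: nat
    by (rule AE_I[where N = "{\<omega> \<in> space M. Z \<omega> \<le> ennreal (real L)}"]) (use zero in \<open>auto simp: emeasure_eq_measure\<close>)
  then have "AE \<omega> in M. \<forall>L::nat. \<not> Z \<omega> \<le> ennreal (real L)" by (subst AE_all_countable) auto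
  then show ?thesis
  proof eventually_elim
    case (elim \<omega>)
    show ?case
    proof (rule ccontr)
      assume "(\<integral>\<^sup>+k. ennreal (b k * X k \<omega> ^ p) \<partial>ints) \<noteq> \<infinity>"
      then have "Z \<omega> \<noteq> \<infinity>" by (simp add: Z_def)
      then obtain r where r: "Z \<omega> = ennreal r" "r \<ge> 0" by (cases "Z \<omega>") auto
      obtain L where "r \<le> real L" using real_arch_simple by blast
      then have "Z \<omega> \<le> ennreal (real L)" unfolding r by (rule ennreal_leI)
      with elim show False by blast
    qed
  qed
qed

end

section \<open>Large deviations of the solution\<close>

text \<open>The sum of squares in the theorem is taken in \<open>ereal\<close>, where it exists
  unconditionally; this identifies it with the real sum once summability is known.\<close>

lemma infsum_ereal_of_real:
  fixes f :: "'a \<Rightarrow> real"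
  assumes "f summable_on A" "\<And>x. x \<in> A \<Longrightarrow> f x \<ge> 0"
  shows "(\<Sum>\<^sub>\<infinity>x\<in>A. ereal (f x)) = ereal (infsum f A)"
proof -
  have "(\<Sum>\<^sub>\<infinity>x\<in>A. ereal (f x)) = (SUP F\<in>{F. finite F \<and> F \<subseteq> A}. \<Sum>x\<in>F. ereal (f x))"
    by (rule nonneg_infsum_complete) (use assms in auto)
  also have "\<dots> = ereal (infsum f A)"
    using infsum_nonneg_is_SUPREMUM_ereal[OF assms] by simp
  finally show ?thesis .
qed

text \<open>Taking \<epsilon> times the logarithm turns the two bounds into the rates
  \<open>- (z - \<delta>)\<^sup>2 / \<sigma>\<close>, up to an error
  \<open>K * sqrt \<epsilon>\<close>, and \<open>- (z + \<delta>)\<^sup>2 / \<tau>\<close>; both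
  approach the limit as the auxiliary parameters do. Positivity of \<open>P\<close> is recorded
  because \<open>ln\<close> has a default value at 0.\<close>

lemma ln_rate_tendsto:
  fixes P :: "real \<Rightarrow> real"
  assumes z: "z > 0" and s: "\<sigma> > 0"
    and upper: "\<And>\<delta>. 0 < \<delta> \<Longrightarrow> \<delta> < z \<Longrightarrow>
      eventually (\<lambda>\<epsilon>. P \<epsilon> \<le> exp (- (z - \<delta>)\<^sup>2 / (\<epsilon> * \<sigma>) + K / sqrt \<epsilon>)) (at_right 0)"
    and lower: "\<And>\<delta> \<tau>. 0 < \<delta> \<Longrightarrow> 0 < \<tau> \<Longrightarrow> \<tau> < \<sigma> \<Longrightarrow>
      eventually (\<lambda>\<epsilon>. P \<epsilon> \<ge> exp (- (z + \<delta>)\<^sup>2 / (\<epsilon> * \<tau>))) (at_right 0)"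
  shows "eventually (\<lambda>\<epsilon>. P \<epsilon> > 0) (at_right 0)" "((\<lambda>\<epsilon>. \<epsilon> * ln (P \<epsilon>)) \<longlongrightarrow> - z\<^sup>2 / \<sigma>) (at_right 0)"
proof -
  have pos0: "eventually (\<lambda>\<epsilon>::real. \<epsilon> > 0) (at_right 0)" by (simp add: eventually_at_right_less)
  have "eventually (\<lambda>\<epsilon>. P \<epsilon> \<ge> exp (- (z + 1)\<^sup>2 / (\<epsilon> * (\<sigma> / 2)))) (at_right 0)"
    by (rule lower) (use s in auto)
  then show pos: "eventually (\<lambda>\<epsilon>. P \<epsilon> > 0) (at_right 0)"
    by eventually_elim (rule less_le_trans[OF exp_gt_zero])
  show "((\<lambda>\<epsilon>. \<epsilon> * ln (P \<epsilon>)) \<longlongrightarrow> - z\<^sup>2 / \<sigma>) (at_right 0)"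
  proof (rule order_tendstoI)
    fix x assume x: "x < - z\<^sup>2 / \<sigma>"
    \<comment> \<open>The two parameters of the lower bound are tied together by
      \<open>\<tau> = \<sigma> - \<delta>\<close>, so that a single limit in \<delta> treats
      both.\<close>
    have "((\<lambda>\<delta>. - (z + \<delta>)\<^sup>2 / (\<sigma> - \<delta>)) \<longlongrightarrow> - (z + 0)\<^sup>2 / (\<sigma> - 0)) (at_right 0)"
      by (intro tendsto_intros) (use s in auto)
    then have "eventually (\<lambda>\<delta>. x < - (z + \<delta>)\<^sup>2 / (\<sigma> - \<delta>)) (at_right 0)"
      by (rule order_tendstoD(1)) (use x in simp)
    moreover have "eventually (\<lambda>\<delta>. \<delta> \<in> {0<..<\<sigma>}) (at_right 0)" using eventually_at_right_real[OF s] .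
    ultimately have "eventually (\<lambda>\<delta>. x < - (z + \<delta>)\<^sup>2 / (\<sigma> - \<delta>) \<and> 0 < \<delta> \<and> \<delta> < \<sigma>) (at_right 0)"
      by eventually_elim auto
    then obtain \<delta> where \<delta>: "x < - (z + \<delta>)\<^sup>2 / (\<sigma> - \<delta>)" "0 < \<delta>" "\<delta> < \<sigma>"
      using eventually_happens'[OF trivial_limit_at_right_real] by blast
    have "eventually (\<lambda>\<epsilon>. P \<epsilon> \<ge> exp (- (z + \<delta>)\<^sup>2 / (\<epsilon> * (\<sigma> - \<delta>)))) (at_right 0)"
      by (rule lower) (use \<delta> in auto)
    then show "eventually (\<lambda>\<epsilon>. x < \<epsilon> * ln (P \<epsilon>)) (at_right 0)"
      using pos0
    proof eventually_elim
      case (elim \<epsilon>)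
      have "- (z + \<delta>)\<^sup>2 / (\<sigma> - \<delta>) = \<epsilon> * ln (exp (- (z + \<delta>)\<^sup>2 / (\<epsilon> * (\<sigma> - \<delta>))))" using elim by simp
      also have "\<dots> \<le> \<epsilon> * ln (P \<epsilon>)"
        using elim by (intro mult_left_mono ln_mono) (auto intro: less_le_trans[OF exp_gt_zero])
      finally show ?case using \<delta>(1) by simp
    qed
  next
    fix x assume x: "- z\<^sup>2 / \<sigma> < x"
    have "((\<lambda>\<delta>. - (z - \<delta>)\<^sup>2 / \<sigma>) \<longlongrightarrow> - (z - 0)\<^sup>2 / \<sigma>) (at_right 0)"
      by (intro tendsto_intros) (use s in auto)
    then have "eventually (\<lambda>\<delta>. - (z - \<delta>)\<^sup>2 / \<sigma> < x) (at_right 0)"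
      by (rule order_tendstoD(2)) (use x in simp)
    moreover have "eventually (\<lambda>\<delta>. \<delta> \<in> {0<..<z}) (at_right 0)" using eventually_at_right_real[OF z] .
    ultimately have "eventually (\<lambda>\<delta>. - (z - \<delta>)\<^sup>2 / \<sigma> < x \<and> 0 < \<delta> \<and> \<delta> < z) (at_right 0)"
      by eventually_elim auto
    then obtain \<delta> where \<delta>: "- (z - \<delta>)\<^sup>2 / \<sigma> < x" "0 < \<delta>" "\<delta> < z"
      using eventually_happens'[OF trivial_limit_at_right_real] by blast
    have "((\<lambda>\<epsilon>. - (z - \<delta>)\<^sup>2 / \<sigma> + K * sqrt \<epsilon>) \<longlongrightarrow> - (z - \<delta>)\<^sup>2 / \<sigma> + K * sqrt 0) (at_right 0)"
      by (intro tendsto_intros)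
    then have "eventually (\<lambda>\<epsilon>. - (z - \<delta>)\<^sup>2 / \<sigma> + K * sqrt \<epsilon> < x) (at_right 0)"
      by (rule order_tendstoD(2)) (use \<delta> in simp)
    then show "eventually (\<lambda>\<epsilon>. \<epsilon> * ln (P \<epsilon>) < x) (at_right 0)"
      using upper[OF \<delta>(2,3)] pos pos0
    proof eventually_elim
      case (elim \<epsilon>)
      have "\<epsilon> * ln (P \<epsilon>) \<le> \<epsilon> * ln (exp (- (z - \<delta>)\<^sup>2 / (\<epsilon> * \<sigma>) + K / sqrt \<epsilon>))"
        using elim by (intro mult_left_mono ln_mono) auto
      also have "\<dots> = - (z - \<delta>)\<^sup>2 / \<sigma> + K * (\<epsilon> / sqrt \<epsilon>)"
        using elim by (simp add: distrib_left right_diff_distrib)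
      also have "\<epsilon> / sqrt \<epsilon> = sqrt \<epsilon>" using elim by (simp add: real_div_sqrt)
      finally show ?case using elim(1) by simp
    qed
  qed
qed

locale random_nls = prob_space M for M :: "'w measure" +
  fixes g :: "int \<Rightarrow> 'w \<Rightarrow> complex"
    and c :: "int \<Rightarrow> real"
    and u :: "real \<Rightarrow> 'w \<Rightarrow> real \<Rightarrow> real \<Rightarrow> complex"
    and t :: "real \<Rightarrow> real"
    and z0 :: real
  assumes g_iid: "iid_standard_complex_gaussians M g"
    and c_nonneg: "\<And>k. c k \<ge> 0"
    and sol: "\<And>\<epsilon>. \<epsilon> > 0 \<Longrightarrow>
           AE \<omega> in M. NLS_solution \<epsilon> (\<lambda>k. of_real (c k) * g k \<omega>) (u \<epsilon> \<omega>)"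
    and coeff_measurable: "\<And>\<epsilon> s n. \<epsilon> > 0 \<Longrightarrow> (\<lambda>\<omega>. fourier_coeff (u \<epsilon> \<omega> s) n) \<in> borel_measurable M"
    and t_bigo: "t \<in> O[at_right 0](\<lambda>\<epsilon>. \<bar>ln \<epsilon>\<bar> / \<epsilon>)"
    and z0: "z0 > 0"
begin

sublocale rayleigh_family M "\<lambda>k \<omega>. norm (g k \<omega>)"
proof
  show "indep_vars (\<lambda>_. borel) (\<lambda>k \<omega>. norm (g k \<omega>)) UNIV"
    using g_iid unfolding iid_standard_complex_gaussians_def
    by (intro indep_vars_compose2[where X = g and Y = "\<lambda>_. norm"]) auto
  show "emeasure M {\<omega> \<in> space M. r < norm (g k \<omega>)} = ennreal (exp (- r\<^sup>2))" if "r \<ge> 0" for k r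
    by (rule complex_gaussian_standard_tail[OF prob_space_axioms _ _ _ _ that])
       (use g_iid in \<open>auto simp: iid_standard_complex_gaussians_def\<close>)
qed auto

definition exceed :: "real \<Rightarrow> 'w set" where
  "exceed \<epsilon> = {\<omega> \<in> space M. FL1_norm (u \<epsilon> \<omega> (t \<epsilon>)) > ennreal (z0 * \<epsilon> powr (-1/2))}"

lemma exceed_measurable: "\<epsilon> > 0 \<Longrightarrow> exceed \<epsilon> \<in> sets M"
proof -
  assume e: "\<epsilon> > 0"
  note [measurable] = coeff_measurable[OF e]
  have [measurable]: "(\<lambda>\<omega>. FL1_norm (u \<epsilon> \<omega> (t \<epsilon>))) \<in> borel_measurable M"
    unfolding FL1_norm_eq ell1_def by (rule borel_measurable_nn_integral_count_space) measurable
  show ?thesis unfolding exceed_def by measurable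
qed

lemma FL1_norm_initial:
  assumes "NLS_solution \<epsilon> (\<lambda>k. of_real (c k) * g k \<omega>) (u \<epsilon> \<omega>)"
  shows "FL1_norm (u \<epsilon> \<omega> 0) = weighted_sum c \<omega>"
  using c_nonneg by (simp add: FL1_norm_eq ell1_def NLS_solution_fourier_coeff_0[OF assms] weighted_sum_def norm_mult)

text \<open>The flow can be run in both directions, so one bound compares the two norms both ways.\<close>
lemma exceed_compare:
  assumes \<delta>: "0 < \<delta>"
  shows "eventually (\<lambda>\<epsilon>. AE \<omega> in M. \<omega> \<in> space M \<longrightarrow>
      weighted_sum c \<omega> > ennreal ((z0 + \<delta>) * \<epsilon> powr (-1/2)) \<longrightarrow> \<omega> \<in> exceed \<epsilon>) (at_right 0)"
    and "\<delta> < z0 \<Longrightarrow> eventually (\<lambda>\<epsilon>. AE \<omega> in M. \<omega> \<in> exceed \<epsilon> \<longrightarrow>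
      weighted_sum c \<omega> > ennreal ((z0 - \<delta>) * \<epsilon> powr (-1/2))) (at_right 0)"
proof -
  obtain C where C: "eventually (\<lambda>\<epsilon>. norm (t \<epsilon>) \<le> C * norm (\<bar>ln \<epsilon>\<bar> / \<epsilon>)) (at_right 0)"
    using t_bigo by (elim landau_o.bigE) auto
  have pos: "eventually (\<lambda>\<epsilon>::real. \<epsilon> > 0) (at_right 0)" by (simp add: eventually_at_right_less)
  have tb: "eventually (\<lambda>\<epsilon>. \<bar>t \<epsilon>\<bar> \<le> C * (\<bar>ln \<epsilon>\<bar> / \<epsilon>)) (at_right 0)"
    using C pos by eventually_elim simp
  \<comment> \<open>Used from time \<open>t \<epsilon>\<close> back to 0 and in contrapositive form:
    a norm of at most level \<open>z0\<close> at the later evaluation would force the initial one to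
    be at most level \<open>z0 + \<delta>\<close>.\<close>
  have 1: "0 \<le> z0" "z0 < z0 + \<delta>" using z0 \<delta> by auto
  show "eventually (\<lambda>\<epsilon>. AE \<omega> in M. \<omega> \<in> space M \<longrightarrow>
      weighted_sum c \<omega> > ennreal ((z0 + \<delta>) * \<epsilon> powr (-1/2)) \<longrightarrow> \<omega> \<in> exceed \<epsilon>) (at_right 0)"
    using eventually_NLS_FL1_bound[OF 1, of C] tb pos
  proof eventually_elim
    case (elim \<epsilon>)
    note bound = elim(1) and time = elim(2)
    show ?case using sol[OF elim(3)]
    proof eventually_elim
      case (elim \<omega>)
      then have "FL1_norm (u \<epsilon> \<omega> (t \<epsilon>)) \<le> ennreal (z0 * \<epsilon> powr (-1/2)) \<Longrightarrow> FL1_norm (u \<epsilon> \<omega> 0) \<le> ennreal ((z0 + \<delta>) * \<epsilon> powr (-1/2))"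
        using bound[rule_format, OF elim, of 0 "t \<epsilon>"] time by simp
      then show ?case unfolding exceed_def FL1_norm_initial[OF elim] by (auto simp: not_le[symmetric])
    qed
  qed
  assume "\<delta> < z0"
  \<comment> \<open>Now the bound runs from 0 to \<open>t \<epsilon>\<close>: an initial norm of at
    most level \<open>z0 - \<delta>\<close> cannot exceed \<open>z0\<close>.\<close>
  then have 2: "0 \<le> z0 - \<delta>" "z0 - \<delta> < z0" using \<delta> by auto
  show "eventually (\<lambda>\<epsilon>. AE \<omega> in M. \<omega> \<in> exceed \<epsilon> \<longrightarrow>
      weighted_sum c \<omega> > ennreal ((z0 - \<delta>) * \<epsilon> powr (-1/2))) (at_right 0)"
    using eventually_NLS_FL1_bound[OF 2, of C] tb pos
  proof eventually_elim
    case (elim \<epsilon>)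
    note bound = elim(1) and time = elim(2)
    show ?case using sol[OF elim(3)]
    proof eventually_elim
      case (elim \<omega>)
      then have "FL1_norm (u \<epsilon> \<omega> 0) \<le> ennreal ((z0 - \<delta>) * \<epsilon> powr (-1/2)) \<Longrightarrow> FL1_norm (u \<epsilon> \<omega> (t \<epsilon>)) \<le> ennreal (z0 * \<epsilon> powr (-1/2))"
        using bound[rule_format, OF elim, of "t \<epsilon>" 0] time by simp
      then show ?case unfolding exceed_def FL1_norm_initial[OF elim] by (auto simp: not_le[symmetric])
    qed
  qed
qed

text \<open>Square summability is forced by the existence of solutions with \<open>L\<^sup>2\<close>
  data: otherwise the sum of the squared initial coefficients would be almost surely infinite,
  against Bessel. It also matters for the converse direction, because an infinite sum of squares
  would make the claimed limit 0, the very value taken for non-summable \<open>c\<close>.\<close>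

lemma c_squared_summable: "(\<lambda>k. (c k)\<^sup>2) summable_on UNIV"
proof (rule ccontr)
  assume ns: "\<not> ?thesis"
  have "AE \<omega> in M. (\<integral>\<^sup>+k. ennreal ((c k)\<^sup>2 * norm (g k \<omega>) ^ 2) \<partial>ints) = \<infinity>"
    by (rule weighted_sum_infinite[OF _ ns]) auto
  moreover have "AE \<omega> in M. NLS_solution 1 (\<lambda>k. of_real (c k) * g k \<omega>) (u 1 \<omega>)" by (rule sol) simp
  ultimately have "AE \<omega> in M. False"
  proof eventually_elim
    case (elim \<omega>)
    have L: "L2 (u 1 \<omega> 0)" using elim(2) unfolding NLS_solution_def by (blast intro: square_integrable_torus_L2)
    have "(\<integral>\<^sup>+k. ennreal ((c k)\<^sup>2 * norm (g k \<omega>) ^ 2) \<partial>ints) \<le> ennreal (LINT x|torus. (norm (u 1 \<omega> 0 x))\<^sup>2)"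
    proof (rule nn_integral_ints_le)
      fix A :: "int set" assume A: "finite A"
      have "(\<Sum>k\<in>A. (c k)\<^sup>2 * norm (g k \<omega>) ^ 2) \<le> (LINT x|torus. (norm (u 1 \<omega> 0 x))\<^sup>2)"
        using bessel[OF L A] c_nonneg
        by (simp add: NLS_solution_fourier_coeff_0[OF elim(2)] norm_mult power_mult_distrib)
      then show "(\<Sum>k\<in>A. ennreal ((c k)\<^sup>2 * norm (g k \<omega>) ^ 2)) \<le> ennreal (LINT x|torus. (norm (u 1 \<omega> 0 x))\<^sup>2)"
        by (simp add: sum_ennreal ennreal_leI)
    qed
    then show ?case using elim(1) by (simp add: top_unique)
  qed
  then show False by simp
qed

abbreviation variance_sum :: real where
  "variance_sum \<equiv> (\<Sum>\<^sub>\<infinity>k. (c k)\<^sup>2)"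

lemma sum_squares_le: "finite A \<Longrightarrow> (\<Sum>k\<in>A. (c k)\<^sup>2) \<le> variance_sum"
  by (rule finite_sum_le_infsum[OF c_squared_summable]) auto

lemma log_prob_tendsto:
  assumes summable: "c summable_on UNIV" and pos: "variance_sum > 0"
  shows "((\<lambda>\<epsilon>. ereal \<epsilon> * log_prob (prob (exceed \<epsilon>))) \<longlongrightarrow> ereal (- z0\<^sup>2 / variance_sum)) (at_right 0)"
proof -
  have e0: "eventually (\<lambda>\<epsilon>::real. \<epsilon> > 0) (at_right 0)" by (simp add: eventually_at_right_less)
  define s1 where "s1 = infsum c UNIV"
  have s1: "(\<Sum>k\<in>A. c k) \<le> s1" if "finite A" for A
    unfolding s1_def by (rule finite_sum_le_infsum[OF summable]) (use that c_nonneg in auto)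
  have pw: "(\<epsilon> powr (-1/2))\<^sup>2 = 1 / \<epsilon>" "\<epsilon> powr (-1/2) = 1 / sqrt \<epsilon>" if "\<epsilon> > 0" for \<epsilon> :: real
  proof -
    show "\<epsilon> powr (-1/2) = 1 / sqrt \<epsilon>"
      using that by (simp add: powr_minus powr_half_sqrt inverse_eq_divide flip: minus_divide_left)
    then show "(\<epsilon> powr (-1/2))\<^sup>2 = 1 / \<epsilon>" using that by (simp add: power_divide)
  qed
  define K where "K = 2 * sqrt pi * s1 * z0 / variance_sum"
  have s10: "s1 \<ge> 0" using s1[of "{}"] by simp
  have upper: "eventually (\<lambda>\<epsilon>. prob (exceed \<epsilon>) \<le> exp (- (z0 - \<delta>)\<^sup>2 / (\<epsilon> * variance_sum) + K / sqrt \<epsilon>)) (at_right 0)"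
    if \<delta>: "0 < \<delta>" "\<delta> < z0" for \<delta>
  proof -
    show ?thesis
      using exceed_compare(2)[OF \<delta>] e0
    proof eventually_elim
      case (elim \<epsilon>)
      define R where "R = (z0 - \<delta>) * \<epsilon> powr (-1/2)"
      have R: "R \<ge> 0" using \<delta> by (simp add: R_def)
      have R2: "R\<^sup>2 = (z0 - \<delta>)\<^sup>2 / \<epsilon>" "R \<le> z0 / sqrt \<epsilon>"
        using \<delta> elim(2) unfolding R_def power_mult_distrib pw(1)[OF elim(2)] unfolding pw(2)[OF elim(2)]
        by (simp_all add: divide_right_mono)
      \<comment> \<open>The minimiser of
        \<open>- \<mu> * R + \<mu>\<^sup>2 * variance_sum / 4\<close>, with value
        \<open>- R\<^sup>2 / variance_sum\<close>. The remaining term, linear in \<mu>, is of order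
        \<open>1 / sqrt \<epsilon>\<close>, hence negligible after multiplication by
        \<epsilon>.\<close>
      define \<mu> where "\<mu> = 2 * R / variance_sum"
      have \<mu>: "\<mu> \<ge> 0" using R pos by (simp add: \<mu>_def)
      have "prob (exceed \<epsilon>) \<le> prob {\<omega> \<in> space M. weighted_sum c \<omega> > ennreal R}"
      proof (rule finite_measure_mono_AE)
        show "AE \<omega> in M. \<omega> \<in> exceed \<epsilon> \<longrightarrow> \<omega> \<in> {\<omega> \<in> space M. weighted_sum c \<omega> > ennreal R}"
          using elim(1) by eventually_elim (auto simp: exceed_def R_def)
      qed measurable
      also have "\<dots> \<le> exp (- \<mu> * R + \<mu>\<^sup>2 * variance_sum / 4 + sqrt pi * \<mu> * s1)"
        by (rule weighted_sum_tail_le) (use c_nonneg \<mu> R sum_squares_le s1 in auto)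
      also have "- \<mu> * R + \<mu>\<^sup>2 * variance_sum / 4 = - R\<^sup>2 / variance_sum"
        using pos by (simp add: \<mu>_def power2_eq_square field_simps)
      also have "- R\<^sup>2 / variance_sum = - (z0 - \<delta>)\<^sup>2 / (\<epsilon> * variance_sum)" by (simp add: R2)
      also have "sqrt pi * \<mu> * s1 \<le> K / sqrt \<epsilon>"
      proof -
        have "sqrt pi * \<mu> * s1 = (2 * sqrt pi * s1 / variance_sum) * R" by (simp add: \<mu>_def)
        also have "\<dots> \<le> (2 * sqrt pi * s1 / variance_sum) * (z0 / sqrt \<epsilon>)"
          using s10 pos R2(2) by (intro mult_left_mono) auto
        finally show ?thesis by (simp add: K_def)
      qed
      finally show ?case by simp
    qed
  qed
  have lower: "eventually (\<lambda>\<epsilon>. prob (exceed \<epsilon>) \<ge> exp (- (z0 + \<delta>)\<^sup>2 / (\<epsilon> * \<tau>))) (at_right 0)"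
    if \<delta>: "0 < \<delta>" and \<tau>: "0 < \<tau>" "\<tau> < variance_sum" for \<delta> \<tau>
  proof -
    \<comment> \<open>Finitely many modes already carry variance at least \<tau>; the remaining ones
      only add nonnegative terms to the sum.\<close>
    obtain A where A: "finite A" "dist (\<Sum>k\<in>A. (c k)\<^sup>2) variance_sum \<le> variance_sum - \<tau>"
      using infsum_finite_approximation[OF c_squared_summable, of "variance_sum - \<tau>"] \<tau> by auto
    have SA: "\<tau> \<le> (\<Sum>k\<in>A. (c k)\<^sup>2)" using A(2) by (auto simp: dist_real_def)
    show ?thesis
      using exceed_compare(1)[OF \<delta>] e0
    proof eventually_elim
      case (elim \<epsilon>)
      define R where "R = (z0 + \<delta>) * \<epsilon> powr (-1/2)"
      have R: "R > 0" using \<delta> z0 elim(2) by (simp add: R_def)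
      have R2: "R\<^sup>2 = (z0 + \<delta>)\<^sup>2 / \<epsilon>"
        unfolding R_def power_mult_distrib pw(1)[OF elim(2)] by simp
      have "R\<^sup>2 / (\<Sum>k\<in>A. (c k)\<^sup>2) \<le> R\<^sup>2 / \<tau>" using SA \<tau> by (intro divide_left_mono) auto
      then have "exp (- R\<^sup>2 / \<tau>) \<le> exp (- R\<^sup>2 / (\<Sum>k\<in>A. (c k)\<^sup>2))" by simp
      also have "\<dots> \<le> prob {\<omega> \<in> space M. weighted_sum c \<omega> > ennreal R}"
        by (rule weighted_sum_tail_ge) (use c_nonneg A R SA \<tau> in auto)
      also have "\<dots> \<le> prob (exceed \<epsilon>)"
      proof (rule finite_measure_mono_AE[OF _ exceed_measurable[OF elim(2)]])
        show "AE \<omega> in M. \<omega> \<in> {\<omega> \<in> space M. weighted_sum c \<omega> > ennreal R} \<longrightarrow> \<omega> \<in> exceed \<epsilon>"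
          using elim(1) by eventually_elim (auto simp: R_def)
      qed
      finally show ?case by (simp add: R2)
    qed
  qed
  have rate: "eventually (\<lambda>\<epsilon>. prob (exceed \<epsilon>) > 0) (at_right 0)"
    "((\<lambda>\<epsilon>. \<epsilon> * ln (prob (exceed \<epsilon>))) \<longlongrightarrow> - z0\<^sup>2 / variance_sum) (at_right 0)"
    using ln_rate_tendsto[where P = "\<lambda>\<epsilon>. prob (exceed \<epsilon>)", OF z0 pos] upper lower by blast+
  have "eventually (\<lambda>\<epsilon>. ereal (\<epsilon> * ln (prob (exceed \<epsilon>))) = ereal \<epsilon> * log_prob (prob (exceed \<epsilon>))) (at_right 0)"
    using rate(1) by eventually_elim (simp add: log_prob_def)
  moreover have "((\<lambda>\<epsilon>. ereal (\<epsilon> * ln (prob (exceed \<epsilon>)))) \<longlongrightarrow> ereal (- z0\<^sup>2 / variance_sum)) (at_right 0)"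
    using rate(2) by (rule tendsto_ereal)
  ultimately show ?thesis by (rule Lim_transform_eventually[rotated])
qed

text \<open>With zero data the norm stays below the level, so the probability is exactly 0 for small
  \<epsilon>. The convention for \<open>log_prob\<close> at 0 then matches division by the zero
  variance in \<open>ereal\<close>.\<close>

lemma log_prob_tendsto_degenerate:
  assumes c0: "\<And>k. c k = 0"
  shows "((\<lambda>\<epsilon>. ereal \<epsilon> * log_prob (prob (exceed \<epsilon>))) \<longlongrightarrow> - \<infinity>) (at_right 0)"
proof (rule tendsto_eventually)
  have z2: "0 < z0 / 2" "z0 / 2 < z0" using z0 by auto
  have "eventually (\<lambda>\<epsilon>::real. \<epsilon> > 0) (at_right 0)" by (simp add: eventually_at_right_less)
  with exceed_compare(2)[OF z2] show "eventually (\<lambda>\<epsilon>. ereal \<epsilon> * log_prob (prob (exceed \<epsilon>)) = - \<infinity>) (at_right 0)"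
  proof eventually_elim
    case (elim \<epsilon>)
    have "AE \<omega> in M. \<omega> \<notin> exceed \<epsilon>" using elim(1) by eventually_elim (simp add: weighted_sum_def c0)
    then have "prob (exceed \<epsilon>) = 0"
      using exceed_measurable[OF elim(2)] by (simp add: prob_eq_0)
    then show ?case using elim(2) by (simp add: log_prob_def)
  qed
qed

lemma log_prob_tendsto_not_summable:
  assumes ns: "\<not> c summable_on UNIV"
  shows "((\<lambda>\<epsilon>. ereal \<epsilon> * log_prob (prob (exceed \<epsilon>))) \<longlongrightarrow> 0) (at_right 0)"
proof (rule tendsto_eventually)
  have inf: "AE \<omega> in M. weighted_sum c \<omega> = \<infinity>"
    using weighted_sum_infinite[OF c_nonneg ns, of 1] by (simp add: weighted_sum_def)
  have one: "(0::real) < 1" by simp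
  have "eventually (\<lambda>\<epsilon>::real. \<epsilon> > 0) (at_right 0)" by (simp add: eventually_at_right_less)
  with exceed_compare(1)[OF one] show "eventually (\<lambda>\<epsilon>. ereal \<epsilon> * log_prob (prob (exceed \<epsilon>)) = 0) (at_right 0)"
  proof eventually_elim
    case (elim \<epsilon>)
    have "AE \<omega> in M. \<omega> \<in> exceed \<epsilon>" using elim(1) inf AE_space by eventually_elim auto
    then have "prob (exceed \<epsilon>) = 1"
      using exceed_measurable[OF elim(2)] by (simp add: prob_eq_1)
    then show ?case by (simp add: log_prob_def)
  qed
qed

lemma log_prob_tendsto_iff_summable:
  "((\<lambda>\<epsilon>. ereal \<epsilon> * log_prob (prob (exceed \<epsilon>))) \<longlongrightarrow> - (ereal (z0\<^sup>2) / (\<Sum>\<^sub>\<infinity>k. ereal ((c k)\<^sup>2)))) (at_right 0)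
    \<longleftrightarrow> c summable_on UNIV"
proof -
  have S: "(\<Sum>\<^sub>\<infinity>k. ereal ((c k)\<^sup>2)) = ereal variance_sum"
    by (rule infsum_ereal_of_real[OF c_squared_summable]) simp
  have V0: "variance_sum \<ge> 0" by (rule infsum_nonneg) simp
  have Vpos: "variance_sum > 0" if "c k \<noteq> 0" for k
    using sum_squares_le[of "{k}"] that by (auto intro: less_le_trans[of _ "(c k)\<^sup>2"])
  have rate: "- (ereal (z0\<^sup>2) / ereal variance_sum) = ereal (- z0\<^sup>2 / variance_sum)" if "variance_sum > 0"
    using that by simp
  show ?thesis
  proof
    assume lim: "((\<lambda>\<epsilon>. ereal \<epsilon> * log_prob (prob (exceed \<epsilon>))) \<longlongrightarrow> - (ereal (z0\<^sup>2) / (\<Sum>\<^sub>\<infinity>k. ereal ((c k)\<^sup>2)))) (at_right 0)"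
    show "c summable_on UNIV"
    proof (rule ccontr)
      assume ns: "\<not> c summable_on UNIV"
      then obtain k where "c k \<noteq> 0" by (metis (no_types, lifting) summable_on_0)
      then have V: "variance_sum > 0" by (rule Vpos)
      \<comment> \<open>Uniqueness of limits equates the claimed rate with 0, whereas a finite
        positive variance makes that rate strictly negative.\<close>
      have "- (ereal (z0\<^sup>2) / ereal variance_sum) = 0"
        using tendsto_unique[OF trivial_limit_at_right_real lim log_prob_tendsto_not_summable[OF ns]] unfolding S .
      then show False using V z0 unfolding rate[OF V] by simp
    qed
  next
    assume summable: "c summable_on UNIV"
    show "((\<lambda>\<epsilon>. ereal \<epsilon> * log_prob (prob (exceed \<epsilon>))) \<longlongrightarrow> - (ereal (z0\<^sup>2) / (\<Sum>\<^sub>\<infinity>k. ereal ((c k)\<^sup>2)))) (at_right 0)"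
    proof (cases "\<forall>k. c k = 0")
      case True
      then have "variance_sum = 0" by simp
      then have "- (ereal (z0\<^sup>2) / ereal variance_sum) = - \<infinity>" using z0 by simp
      then show ?thesis unfolding S using log_prob_tendsto_degenerate True by simp
    next
      case False
      then have V: "variance_sum > 0" using Vpos by auto
      show ?thesis unfolding S rate[OF V] by (rule log_prob_tendsto[OF summable V])
    qed
  qed
qed

end

theorem theorem1p1:
  fixes M :: "'w measure"
    and g :: "int \<Rightarrow> 'w \<Rightarrow> complex"
    and c :: "int \<Rightarrow> real"
    and u :: "real \<Rightarrow> 'w \<Rightarrow> real \<Rightarrow> real \<Rightarrow> complex"
    and t :: "real \<Rightarrow> real"
    and z0 :: real
  assumes "prob_space M"
    and "iid_standard_complex_gaussians M g"
    and "\<And>k. c k \<ge> 0"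
    and "\<And>\<epsilon>. \<epsilon> > 0 \<Longrightarrow>
           AE \<omega> in M. NLS_solution \<epsilon> (\<lambda>k. of_real (c k) * g k \<omega>) (u \<epsilon> \<omega>)"
    and "\<And>\<epsilon> s n. \<epsilon> > 0 \<Longrightarrow> (\<lambda>\<omega>. fourier_coeff (u \<epsilon> \<omega> s) n) \<in> borel_measurable M"
    and "t \<in> O[at_right 0](\<lambda>\<epsilon>. \<bar>ln \<epsilon>\<bar> / \<epsilon>)"
    and "z0 > 0"
  shows "((\<lambda>\<epsilon>. ereal \<epsilon> * log_prob (measure M
             {\<omega> \<in> space M. FL1_norm (u \<epsilon> \<omega> (t \<epsilon>)) > ennreal (z0 * \<epsilon> powr (-1/2))}))
           \<longlongrightarrow> - (ereal (z0\<^sup>2) / (\<Sum>\<^sub>\<infinity>k. ereal ((c k)\<^sup>2)))) (at_right 0)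
         \<longleftrightarrow> c summable_on UNIV"
proof -
  interpret random_nls M g c u t z0
    by (intro random_nls.intro random_nls_axioms.intro assms)
  show ?thesis using log_prob_tendsto_iff_summable unfolding exceed_def .
qed

end
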